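(* Consider the problem $\min_{x\in\mathcal{X}}\varphi(x):=f(x)+g(x)$ and let $\{x_k\}_{k\ge1}\subset\mathcal{X}$ be produced by the proximal stochastic subgradient method $x_{k+1}=T_{\alpha_k}(x_k-\alpha_k\zeta(x_k,\omega_k))$, where $\omega_k\sim P$ are sampled independently and $\alpha_k>0$ (with $\zeta$ and $T$ as in the context). Suppose that: 1. $\mathcal{X}\subseteq\mathbb{R}^d$ is closed, $f,g\colon\mathbb{R}^d\to\mathbb{R}$ are locally Lipschitz, and $g$ is bounded from below on $\mathcal{X}$; 2. there exists a function $L\colon\mathbb{R}^d\to\mathbb{R}$, bounded on bounded sets, satisfying $L(x)\ge\sup_{z:\,g(z)\le g(x)}\frac{g(x)-g(z)}{\|x-z\|}$ (supremum over $z\ne x$); 3. $\sum_{k}\alpha_k=\infty$ and $\sum_k\alpha_k^2<\infty$; 4. almost surely, $\sup_{k\ge1}\|x_k\|<\infty$; 5. there exists a function $p\colon\mathbb{R}^d\to\mathbb{R}_+$, bounded on bounded sets, such that $\mathbb{E}_\omega[\zeta(x,\omega)]\in\partial f(x)$ and $\mathbb{E}_\omega[\|\zeta(x,\omega)\|^2]\le p(x)$ for all $x\in\mathcal{X}$; 6. for every convergent sequence $\{z_k\}_{k\ge1}$, $\mathbb{E}_\omega[\sup_{k\ge1}\|\zeta(z_k,\omega)\|]<\infty$. Suppose moreover that: (a) (Weak Sard) the set of composite noncritical values is dense in $\mathbb{R}$; (b) (Descent) whenever $z\colon\mathbb{R}_+\to\mathcal{X}$ is an absolutely continuous curve satisfying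 $\dot z(t)\in-(\partial f+\partial g+N_{\mathcal{X}})(z(t))$ for a.e. $t\ge0$, and $z(0)$ is not composite critical, there exists a real $T>0$ satisfying $\varphi(z(T))<\sup_{t\in[0,T]}\varphi(z(t))\le\varphi(z(0))$. Then almost surely, every limit point of the iterates $\{x_k\}_{k\ge1}$ is composite critical and the function values $\{\varphi(x_k)\}_{k\ge1}$ converge.
   Context: The Clarke subdifferential of a locally Lipschitz $f$ is $\partial f(x)=\mathrm{conv}\{\lim_i\nabla f(x_i):x_i\to x,\ x_i\in\Omega\}$, with $\Omega$ any full-measure set of differentiability points. For $x\in\mathcal{X}$: the proximal normal cone is $N^P_{\mathcal{X}}(x)=\{\lambda v: x\in\mathrm{proj}_{\mathcal{X}}(x+v),\ \lambda\ge0\}$, with $\mathrm{proj}_{\mathcal{X}}$ the nearest-point map; the limiting normal cone $N^L_{\mathcal{X}}(x)$ consists of all $v$ for which there are $x_i\in\mathcal{X}$, $v_i\in N^P_{\mathcal{X}}(x_i)$ with $(x_i,v_i)\to(x,v)$; the Clarke normal cone is $N_{\mathcal{X}}(x)=\mathrm{cl}\,\mathrm{conv}\,N^L_{\mathcal{X}}(x)$. A point $x\in\mathcal{X}$ is composite critical if $0\in\partial f(x)+\partial g(x)+N_{\mathcal{X}}(x)$; a real $r$ is a composite critical value if $r=f(x)+g(x)$ for some composite critical $x$, and a composite noncritical value otherwise. Oracle: $(\Omega,\mathcal{F},P)$ is a probability space and $\zeta\colon\mathbb{R}^d\times\Omega\to\mathbb{R}^d$ is measurable with $\mathbb{E}_\omega[\zeta(x,\omega)]\in\partial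 f(x)$ for all $x\in\mathbb{R}^d$. Proximal selection: $T_{(\cdot)}(\cdot)\colon(0,\infty)\times\mathbb{R}^d\to\mathbb{R}^d$ is a fixed measurable map with $T_\alpha(z)\in\mathrm{argmin}_{x\in\mathcal{X}}\{g(x)+\frac1{2\alpha}\|x-z\|^2\}$ for all $\alpha>0$, $z\in\mathbb{R}^d$. A limit point of a sequence is a limit of some subsequence. *)

theory Defs
  imports "HOL-Probability.Probability" "HOL-Library.Set_Algebras"
begin

definition locally_lipschitz :: "('a::metric_space \<Rightarrow> 'b::metric_space) \<Rightarrow> bool" where
  "locally_lipschitz f \<longleftrightarrow> (\<forall>x. \<exists>e>0. \<exists>C. C-lipschitz_on (ball x e) f)"

definition bounded_on_bounded_sets :: "('a::metric_space \<Rightarrow> 'b::metric_space) \<Rightarrow> bool" where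
  "bounded_on_bounded_sets h \<longleftrightarrow> (\<forall>B. bounded B \<longrightarrow> bounded (h ` B))"

(* The Clarke subdifferential does not depend on the full-measure set of differentiability
   points from which gradients are taken. Here it is the set of all differentiability points,
   which has full measure for locally Lipschitz f by Rademacher's theorem. *)
definition clarke_subdiff :: "('a::euclidean_space \<Rightarrow> real) \<Rightarrow> 'a \<Rightarrow> 'a set" where
  "clarke_subdiff f x = convex hull {v. \<exists>y u. y \<longlonglongrightarrow> x \<and>
     (\<forall>i::nat. y i \<in> {w. f differentiable (at w)} \<and> GDERIV f (y i) :> u i) \<and> u \<longlonglongrightarrow> v}"

(* The set-valued nearest-point map; closest_point from the library selects a single point. *)
definition proj_set :: "'a::euclidean_space set \<Rightarrow> 'a \<Rightarrow> 'a set" where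
  "proj_set X y = {x. is_arg_min (\<lambda>w. norm (w - y)) (\<lambda>w. w \<in> X) x}"

definition proximal_normal_cone :: "'a::euclidean_space set \<Rightarrow> 'a \<Rightarrow> 'a set" where
  "proximal_normal_cone X x = {c *\<^sub>R v | c v. x \<in> proj_set X (x + v) \<and> 0 \<le> c}"

definition limiting_normal_cone :: "'a::euclidean_space set \<Rightarrow> 'a \<Rightarrow> 'a set" where
  "limiting_normal_cone X x = {v. \<exists>y u.
     (\<forall>i::nat. y i \<in> X \<and> u i \<in> proximal_normal_cone X (y i)) \<and> y \<longlonglongrightarrow> x \<and> u \<longlonglongrightarrow> v}"

definition clarke_normal_cone :: "'a::euclidean_space set \<Rightarrow> 'a \<Rightarrow> 'a set" where
  "clarke_normal_cone X x = closure (convex hull (limiting_normal_cone X x))"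

(* The sums of sets here are Minkowski sums. *)
definition composite_subdiff ::
  "('a::euclidean_space \<Rightarrow> real) \<Rightarrow> ('a \<Rightarrow> real) \<Rightarrow> 'a set \<Rightarrow> 'a \<Rightarrow> 'a set" where
  "composite_subdiff f g X x = clarke_subdiff f x + clarke_subdiff g x + clarke_normal_cone X x"

definition composite_critical ::
  "('a::euclidean_space \<Rightarrow> real) \<Rightarrow> ('a \<Rightarrow> real) \<Rightarrow> 'a set \<Rightarrow> 'a \<Rightarrow> bool" where
  "composite_critical f g X x \<longleftrightarrow> x \<in> X \<and> 0 \<in> composite_subdiff f g X x"

definition composite_critical_value ::
  "('a::euclidean_space \<Rightarrow> real) \<Rightarrow> ('a \<Rightarrow> real) \<Rightarrow> 'a set \<Rightarrow> real \<Rightarrow> bool" where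
  "composite_critical_value f g X r \<longleftrightarrow> (\<exists>x. composite_critical f g X x \<and> r = f x + g x)"

definition abs_cont_on :: "real set \<Rightarrow> (real \<Rightarrow> 'a::real_normed_vector) \<Rightarrow> bool" where
  "abs_cont_on S z \<longleftrightarrow> (\<forall>e>0. \<exists>d>0. \<forall>(n::nat) a b.
     (\<forall>i<n. a i \<le> b i \<and> {a i..b i} \<subseteq> S) \<and>
     disjoint_family_on (\<lambda>i. {a i<..<b i}) {..<n} \<and>
     (\<Sum>i<n. b i - a i) < d \<longrightarrow> (\<Sum>i<n. norm (z (b i) - z (a i))) < e)"

(* A curve on the half-line is absolutely continuous if it is so on every compact interval.
   Its values at negative times play no role. *)
definition abs_cont_curve :: "'a::real_normed_vector set \<Rightarrow> (real \<Rightarrow> 'a) \<Rightarrow> bool" where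
  "abs_cont_curve X z \<longleftrightarrow> (\<forall>t\<ge>0. z t \<in> X) \<and> (\<forall>b>0. abs_cont_on {0..b} z)"

(* The negative of a set is written as an image, since the prefix minus is set complement. *)
definition subgradient_trajectory ::
  "('a::euclidean_space \<Rightarrow> real) \<Rightarrow> ('a \<Rightarrow> real) \<Rightarrow> 'a set \<Rightarrow> (real \<Rightarrow> 'a) \<Rightarrow> bool" where
  "subgradient_trajectory f g X z \<longleftrightarrow> abs_cont_curve X z \<and>
     (AE t in lborel. t \<ge> 0 \<longrightarrow>
        (\<exists>v. (z has_vector_derivative v) (at t) \<and> v \<in> uminus ` composite_subdiff f g X (z t)))"

definition limit_point :: "(nat \<Rightarrow> 'a::topological_space) \<Rightarrow> 'a \<Rightarrow> bool" where
  "limit_point x c \<longleftrightarrow> (\<exists>r. strict_mono r \<and> (x \<circ> r) \<longlonglongrightarrow> c)"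

end

theory Submission
  imports Defs "HOL-Complex_Analysis.Great_Picard"
begin

text \<open>Writing \<open>\<mu>\<close> for the mean of the oracle, the optimality condition of the proximal step turns the
  method into an inexact subgradient iteration
  \<open>x (k+1) = x k - \<alpha> k (m k + v k + \<rho> k n k + e k)\<close>
  with \<open>m k = \<mu> (x k)\<close> in the subdifferential of \<open>f\<close> at \<open>x k\<close>, with \<open>v k\<close> in the subdifferential of
  \<open>g\<close> and \<open>n k\<close> a bounded normal of \<open>X\<close>, both at \<open>x (k+1)\<close>, and with noise
  \<open>e k = \<zeta> k - \<mu> (x k)\<close>. The size \<open>\<rho> k\<close> is controlled by the norm of \<open>\<zeta> k\<close>. On the event that the iterates
  stay in a ball, \<open>\<Sum> \<alpha> e\<close> and \<open>\<Sum> \<alpha> (\<parallel>\<zeta>\<parallel> - E\<parallel>\<zeta>\<parallel>)\<close> converge almost surely, as martingales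
  bounded in \<open>L\<^sup>2\<close>. Hence the interpolated iterates are asymptotically Lipschitz and their shifts subconverge
  locally uniformly to curves; their difference quotients are averages of vectors near the closed convex
  set \<open>- (\<partial>f + \<partial>g + N)\<close>, so the limit curves are subgradient trajectories.
  If \<open>\<phi> (x k)\<close>, where \<open>\<phi> = f + g\<close>, oscillated, then it would upcross some interval with noncritical
  left endpoint \<open>r\<close> infinitely often, and a trajectory started at a limit of the last exits from
  \<open>\<phi> \<le> r\<close> would contradict the descent property. Along trajectories started at limit points \<open>\<phi>\<close> is then constant, so limit points
  are critical.

  Because the Clarke subdifferential is defined by gradients, optimality of the proximal step rests on
  Rademacher's theorem and a mean value inequality at points of differentiability, applied to an exact
  penalization of the constraint by the distance to \<open>X\<close>.\<close>

section \<open>Differentiation of Lipschitz functions on the line\<close>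

text \<open>The obstacle is that neither the oracle nor the normal part of a proximal step is
  bounded along a path: the bound on \<open>\<rho> k\<close> grows with the norm of
  \<open>\<zeta> k\<close>. Only averages over windows of fixed length, in the time scale of the
  partial sums of \<alpha>, can be bounded. This is why the norms of the oracle need a martingale of
  their own, centred at means that the second moment bounds on bounded sets. These moment bounds are
  uniform only on balls, so each martingale difference carries the indicator of a ball at the
  current iterate; the random bound on the path is absorbed by a countable union over integer radii.
  The endpoint r of the crossed interval is chosen noncritical because the iterates just before and
  just after the last exits have the same limit, whose value is therefore exactly r. So the limit
  curve starts at a noncritical point. In Rademacher's theorem, difference quotients are taken along
  the steps 1/(n+1), which keeps all exceptional sets Borel; the Lipschitz bound later recovers all
  small steps.\<close>

lemma Vitali_covering_intervals:
  fixes S :: "real set" and K :: "(real \<times> real) set"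
  assumes K: "\<And>i. i \<in> K \<Longrightarrow> fst i < snd i"
    and S: "\<And>s d. s \<in> S \<Longrightarrow> 0 < d \<Longrightarrow> \<exists>i\<in>K. s \<in> {fst i..snd i} \<and> snd i - fst i < d"
  obtains C where "countable C" "C \<subseteq> K" "disjoint_family_on (\<lambda>i. {fst i..snd i}) C"
    "negligible (S - (\<Union>i\<in>C. {fst i..snd i}))"
proof -
  let ?a = "\<lambda>i. (fst i + snd i) / 2 :: real" and ?r = "\<lambda>i. (snd i - fst i) / 2 :: real"
  have eq: "cball (?a i) (?r i) = {fst i..snd i}" for i
    unfolding cball_eq_atLeastAtMost by (simp add: field_simps)
  have "\<exists>i. i \<in> K \<and> s \<in> cball (?a i) (?r i) \<and> ?r i < d" if "s \<in> S" "0 < d" for s d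
    unfolding eq using S[OF that(1), of "2 * d"] that(2) by fastforce
  then obtain C where "countable C" "C \<subseteq> K"
    "pairwise (\<lambda>i j. disjnt (cball (?a i) (?r i)) (cball (?a j) (?r j))) C"
    "negligible (S - (\<Union>i\<in>C. cball (?a i) (?r i)))"
    using Vitali_covering_theorem_cballs[of K ?r S ?a] K by auto
  then show ?thesis
    unfolding eq
    by (intro that) (auto simp: pairwise_def disjoint_family_on_def disjnt_def)
qed

text \<open>Two nested Vitali coverings, first by intervals of slope at most \<open>p\<close> and then, inside these, by
  intervals of slope at least \<open>q\<close>, give \<open>q |E| \<le> p |E|\<close>.\<close>

lemma null_set_of_two_slopes:
  fixes F :: "real \<Rightarrow> real"
  assumes mono: "\<And>s t. s \<le> t \<Longrightarrow> F s \<le> F t" and cont: "continuous_on UNIV F"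
    and pq: "0 \<le> p" "p < q"
    and E: "E \<in> sets borel" "bounded E"
    and low: "\<And>s d. s \<in> E \<Longrightarrow> 0 < d \<Longrightarrow>
      \<exists>a b. a < b \<and> s \<in> {a..b} \<and> b - a < d \<and> F b - F a \<le> p * (b - a)"
    and high: "\<And>s d. s \<in> E \<Longrightarrow> 0 < d \<Longrightarrow>
      \<exists>a b. a < b \<and> s \<in> {a..b} \<and> b - a < d \<and> q * (b - a) \<le> F b - F a"
  shows "emeasure lborel E = 0"
proof -
  \<comment> \<open>The Stieltjes measure of \<open>F\<close> makes increments over disjoint
    intervals countably additive, so the increments over the two coverings compare by monotonicity
    of a measure.\<close>
  define \<mu> where "\<mu> = interval_measure F"
  have sets\<mu>[simp]: "sets \<mu> = sets borel" by (simp add: \<mu>_def)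
  have \<mu>: "emeasure \<mu> {a..b} = ennreal (F b - F a)" if "a < b" for a b
    using emeasure_interval_measure_Icc[OF _ mono cont, of a b] that by (simp add: \<mu>_def)
  have UN_sets: "(\<Union>i\<in>A. {fst i..snd i}) \<in> sets borel" if "countable A" for A :: "(real \<times> real) set"
    using that by (intro sets.countable_UN') auto
  have fin: "emeasure lborel E < \<infinity>"
    using E(2) by (rule emeasure_bounded_finite)
  have bound: "ennreal q * emeasure lborel E \<le> ennreal p * (emeasure lborel E + ennreal e)"
    if e: "0 < e" for e
  proof -
    obtain U where U: "open U" "E \<subseteq> U" "emeasure lborel (U - E) \<le> e"
      using outer_regular_lborel_le[OF E(1) e] .
    have U_le: "emeasure lborel U \<le> emeasure lborel E + ennreal e"
    proof -
      have "emeasure lborel (E \<union> (U - E)) \<le> emeasure lborel E + emeasure lborel (U - E)"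
        using E(1) U(1) by (intro emeasure_subadditive) auto
      also have "E \<union> (U - E) = U" using U(2) by auto
      finally show ?thesis using U(3) by (meson add_left_mono order_trans)
    qed
    define K where "K = {i. fst i < snd i \<and> {fst i..snd i} \<subseteq> U \<and>
      F (snd i) - F (fst i) \<le> p * (snd i - fst i)}"
    have covK: "\<exists>i\<in>K. s \<in> {fst i..snd i} \<and> snd i - fst i < d" if sE: "s \<in> E" and d: "0 < d" for s d
    proof -
      obtain r where r: "r > 0" "ball s r \<subseteq> U" 
        by (rule openE[OF U(1) subsetD[OF U(2) sE]])
      obtain a b where ab: "a < b" "s \<in> {a..b}" "b - a < min d r" "F b - F a \<le> p * (b - a)"
        using low[OF sE, of "min d r"] d r(1) unfolding min_less_iff_conj by blast
      have "{a..b} \<subseteq> ball s r" using ab by (auto simp: dist_real_def)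
      then show ?thesis using ab r by (intro bexI[of _ "(a, b)"]) (auto simp: K_def)
    qed
    have K_less: "fst i < snd i" if "i \<in> K" for i
      using that by (simp add: K_def)
    obtain C where C: "countable C" "C \<subseteq> K" "disjoint_family_on (\<lambda>i. {fst i..snd i}) C"
      "negligible (E - (\<Union>i\<in>C. {fst i..snd i}))"
      by (rule Vitali_covering_intervals[OF K_less covK])
    \<comment> \<open>Open interiors, so that short intervals around a point of \<open>V\<close> fit
      inside it. The price is the set of endpoints, which is countable.\<close>
    define V where "V = (\<Union>i\<in>C. {fst i<..<snd i})"
    have oV: "open V" by (auto simp: V_def)
    define K' where "K' = {i. fst i < snd i \<and> {fst i..snd i} \<subseteq> V \<and>
      q * (snd i - fst i) \<le> F (snd i) - F (fst i)}"
    have covK': "\<exists>i\<in>K'. s \<in> {fst i..snd i} \<and> snd i - fst i < d" if sE: "s \<in> E \<inter> V" and d: "0 < d" for s d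
    proof -
      obtain r where r: "r > 0" "ball s r \<subseteq> V" 
        by (rule openE[OF oV IntD2[OF sE]])
      obtain a b where ab: "a < b" "s \<in> {a..b}" "b - a < min d r" "q * (b - a) \<le> F b - F a"
        using high[of s "min d r"] sE d r(1) unfolding min_less_iff_conj Int_iff by blast
      have "{a..b} \<subseteq> ball s r" using ab by (auto simp: dist_real_def)
      then show ?thesis using ab r by (intro bexI[of _ "(a, b)"]) (auto simp: K'_def)
    qed
    have K'_less: "fst i < snd i" if "i \<in> K'" for i
      using that by (simp add: K'_def)
    obtain D where D: "countable D" "D \<subseteq> K'" "disjoint_family_on (\<lambda>i. {fst i..snd i}) D"
      "negligible (E \<inter> V - (\<Union>i\<in>D. {fst i..snd i}))"
      by (rule Vitali_covering_intervals[OF K'_less covK'])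
    let ?N = "(E - (\<Union>i\<in>C. {fst i..snd i})) \<union> (fst ` C \<union> snd ` C) \<union>
      (E \<inter> V - (\<Union>i\<in>D. {fst i..snd i}))"
    have "negligible ?N"
      using C(1,4) D(4)
      by (intro negligible_Un)
        (auto simp: negligible_iff_null_sets intro!: null_sets_completionI countable_imp_null_set_lborel)
    moreover have measN: "?N \<in> sets borel"
    proof -
      have "fst ` C \<union> snd ` C \<in> null_sets lborel"
        using C(1) by (intro countable_imp_null_set_lborel) simp
      then have "fst ` C \<union> snd ` C \<in> sets borel" by auto
      then show ?thesis
        by (rule sets.Un[OF sets.Un[OF sets.Diff[OF E(1) UN_sets[OF C(1)]]]
              sets.Diff[OF sets.Int[OF E(1) borel_open[OF oV]] UN_sets[OF D(1)]]])
    qed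
    ultimately have N0: "emeasure lborel ?N = 0"
      using null_sets_completion_iff[of ?N lborel] by (auto simp: negligible_iff_null_sets)
    have "E \<subseteq> ?N \<union> (\<Union>i\<in>D. {fst i..snd i})"
    proof
      fix s assume s: "s \<in> E"
      consider "s \<notin> (\<Union>i\<in>C. {fst i..snd i})" | i where "i \<in> C" "s = fst i \<or> s = snd i" | "s \<in> V"
        unfolding V_def by (fastforce simp: less_le)
      then show "s \<in> ?N \<union> (\<Union>i\<in>D. {fst i..snd i})"
        using s by cases auto
    qed
    then have "emeasure lborel E \<le> emeasure lborel (?N \<union> (\<Union>i\<in>D. {fst i..snd i}))"
      using measN D(1) UN_sets by (intro emeasure_mono) auto
    also have "\<dots> \<le> emeasure lborel ?N + emeasure lborel (\<Union>i\<in>D. {fst i..snd i})"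
      using measN D(1) UN_sets by (intro emeasure_subadditive) auto
    also have "\<dots> = emeasure lborel (\<Union>i\<in>D. {fst i..snd i})"
      using N0 by simp
    also have "\<dots> = (\<integral>\<^sup>+i. emeasure lborel {fst i..snd i} \<partial>count_space D)"
      using D by (intro emeasure_UN_countable) auto
    finally have "ennreal q * emeasure lborel E \<le>
        ennreal q * (\<integral>\<^sup>+i. emeasure lborel {fst i..snd i} \<partial>count_space D)"
      by (rule mult_left_mono) simp
    also have "\<dots> = (\<integral>\<^sup>+i. ennreal q * emeasure lborel {fst i..snd i} \<partial>count_space D)"
      by (rule nn_integral_cmult[symmetric]) auto
    also have "\<dots> \<le> (\<integral>\<^sup>+i. emeasure \<mu> {fst i..snd i} \<partial>count_space D)"
    proof (rule nn_integral_mono)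
      fix i assume "i \<in> space (count_space D)"
      then have "i \<in> K'" using D by auto
      then show "ennreal q * emeasure lborel {fst i..snd i} \<le> emeasure \<mu> {fst i..snd i}"
        using pq by (auto simp: \<mu> K'_def ennreal_mult'[symmetric] intro!: ennreal_leI)
    qed
    also have "\<dots> = emeasure \<mu> (\<Union>i\<in>D. {fst i..snd i})"
      using D by (intro emeasure_UN_countable[symmetric]) auto
    also have "\<dots> \<le> emeasure \<mu> (\<Union>i\<in>C. {fst i..snd i})"
    proof (rule emeasure_mono)
      show "(\<Union>i\<in>D. {fst i..snd i}) \<subseteq> (\<Union>i\<in>C. {fst i..snd i})"
      proof -
        have "(\<Union>i\<in>D. {fst i..snd i}) \<subseteq> V" using D(2) by (auto simp: K'_def)
        also have "V \<subseteq> (\<Union>i\<in>C. {fst i..snd i})"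
          unfolding V_def by (intro UN_mono) auto
        finally show ?thesis .
      qed
    qed (use C UN_sets in auto)
    also have "\<dots> = (\<integral>\<^sup>+i. emeasure \<mu> {fst i..snd i} \<partial>count_space C)"
      using C by (intro emeasure_UN_countable) auto
    also have "\<dots> \<le> (\<integral>\<^sup>+i. ennreal p * emeasure lborel {fst i..snd i} \<partial>count_space C)"
    proof (rule nn_integral_mono)
      fix i assume "i \<in> space (count_space C)"
      then have "i \<in> K" using C by auto
      then show "emeasure \<mu> {fst i..snd i} \<le> ennreal p * emeasure lborel {fst i..snd i}"
        using pq by (auto simp: \<mu> K_def ennreal_mult'[symmetric] intro!: ennreal_leI)
    qed
    also have "\<dots> = ennreal p * (\<integral>\<^sup>+i. emeasure lborel {fst i..snd i} \<partial>count_space C)"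
      by (rule nn_integral_cmult) auto
    also have "(\<integral>\<^sup>+i. emeasure lborel {fst i..snd i} \<partial>count_space C) = emeasure lborel (\<Union>i\<in>C. {fst i..snd i})"
      using C by (intro emeasure_UN_countable[symmetric]) auto
    also have "emeasure lborel (\<Union>i\<in>C. {fst i..snd i}) \<le> emeasure lborel U"
      using C(2) U(1) by (intro emeasure_mono) (auto simp: K_def)
    also note U_le
    finally show ?thesis by (simp add: mult_left_mono)
  qed
  \<comment> \<open>\<open>E\<close> has finite measure, so letting \<open>e\<close> tend to 0 gives
    q m <= p m in the reals, which forces m = 0 because p < q.\<close>
  define m where "m = measure lborel E"
  have m: "emeasure lborel E = ennreal m" "m \<ge> 0"
    using fin by (auto simp: m_def emeasure_eq_ennreal_measure)
  have "q * m \<le> p * (m + e)" if "0 < e" for e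
    using bound[OF that] m pq that
    by (simp add: ennreal_plus[symmetric] ennreal_mult'[symmetric] del: ennreal_plus)
  moreover have "((\<lambda>e. p * (m + e)) \<longlongrightarrow> p * (m + 0)) (at_right 0)"
    by (intro tendsto_intros)
  ultimately have "q * m \<le> p * (m + 0)"
    by (intro tendsto_lowerbound[where F = "at_right 0" and f = "\<lambda>e. p * (m + e)"])
      (auto simp: eventually_at_filter)
  then have "q * m \<le> p * m" by simp
  with pq m(2) have "m = 0" by (metis mult_le_cancel_right not_le order_le_less)
  then show ?thesis using m by simp
qed

text \<open>A bounded sequence whose liminf lies below its limsup crosses some rational interval
  infinitely often, and the interval may be taken nonnegative because the sequence is. It serves for
  difference quotients and, after a shift, for the objective values.\<close>

lemma convergent_if_no_oscillation:
  fixes X :: "nat \<Rightarrow> real"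
  assumes bnd: "\<And>n. 0 \<le> X n" "\<And>n. X n \<le> K"
    and no: "\<And>p q. p \<in> \<rat> \<Longrightarrow> q \<in> \<rat> \<Longrightarrow> 0 \<le> p \<Longrightarrow> p < q \<Longrightarrow>
      \<not> ((\<forall>m. \<exists>n\<ge>m. X n < p) \<and> (\<forall>m. \<exists>n\<ge>m. q < X n))"
  shows "convergent X"
proof -
  let ?X = "\<lambda>n. ereal (X n)"
  have l0: "0 \<le> liminf ?X" by (intro Liminf_bounded) (simp add: bnd)
  have uK: "limsup ?X \<le> ereal K" by (intro Limsup_bounded) (simp add: bnd)
  have le: "liminf ?X \<le> limsup ?X" by (rule Liminf_le_Limsup) simp
  have "\<not> liminf ?X < limsup ?X"
  proof
    assume "liminf ?X < limsup ?X"
    then obtain r where r: "liminf ?X < ereal r" "ereal r < limsup ?X" by (meson ereal_dense2)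
    then obtain r' where r': "ereal r < ereal r'" "ereal r' < limsup ?X" by (meson ereal_dense2)
    obtain p where p: "p \<in> \<rat>" "r < p" "p < r'" using r' Rats_dense_in_real[of r r'] by auto
    obtain q where q: "q \<in> \<rat>" "p < q" "q < r'" using p Rats_dense_in_real[of p r'] by auto
    have lp: "liminf ?X < ereal p" using r(1) p(2) by (metis ereal_less_eq(3) less_le_trans less_imp_le)
    have qu: "ereal q < limsup ?X" using r'(2) q(3) by (metis ereal_less_eq(3) le_less_trans less_imp_le)
    have "\<exists>n\<ge>m. X n < p" for m
    proof (rule ccontr)
      assume "\<not> ?thesis"
      then have "eventually (\<lambda>n. ereal p \<le> ?X n) sequentially"
        by (auto simp: eventually_sequentially not_less)
      from Liminf_bounded[OF this] lp show False by simp
    qed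
    moreover have "\<exists>n\<ge>m. q < X n" for m
    proof (rule ccontr)
      assume "\<not> ?thesis"
      then have "eventually (\<lambda>n. ?X n \<le> ereal q) sequentially"
        by (auto simp: eventually_sequentially not_less)
      from Limsup_bounded[OF this] qu show False by simp
    qed
    moreover have "0 \<le> p"
      using order_le_less_trans[OF l0 lp] by simp
    ultimately show False using no[OF p(1) q(1) _ q(2)] by blast
  qed
  then have eq: "liminf ?X = limsup ?X" using le by simp
  obtain L where L: "liminf ?X = ereal L"
    using l0 uK unfolding eq[symmetric] by (cases "liminf ?X") auto
  have "?X \<longlonglongrightarrow> ereal L"
    using eq L by (intro Liminf_eq_Limsup) auto
  then show ?thesis by (auto simp: convergent_def)
qed

text \<open>For rational p < q, the points where the quotients infinitely often fall below p and
  infinitely often exceed q satisfy both slope conditions of \<open>null_set_of_two_slopes\<close>,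
  with the intervals [s, s + 1/(n+1)]. A sequence of steps makes these sets Borel, and the ball of
  radius N makes them bounded.\<close>

lemma AE_convergent_quotients_mono:
  fixes F :: "real \<Rightarrow> real"
  assumes mono: "\<And>s t. s \<le> t \<Longrightarrow> F s \<le> F t" and lip: "K-lipschitz_on UNIV F"
  shows "AE s in lborel. convergent (\<lambda>n. real (Suc n) * (F (s + 1 / real (Suc n)) - F s))"
proof -
  have cont: "continuous_on UNIV F" using lip by (rule lipschitz_on_continuous_on)
  then have [measurable]: "F \<in> borel_measurable borel" by (rule borel_measurable_continuous_onI)
  define Q where "Q n s = real (Suc n) * (F (s + 1 / real (Suc n)) - F s)" for n s
  have [measurable]: "Q n \<in> borel_measurable borel" for n
    unfolding Q_def by measurable
  have Q: "0 \<le> Q n s" "Q n s \<le> K" for n s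
  proof -
    show "0 \<le> Q n s" using mono[of s "s + 1 / real (Suc n)"] by (simp add: Q_def)
    have "\<bar>F (s + 1 / real (Suc n)) - F s\<bar> \<le> K * \<bar>1 / real (Suc n)\<bar>"
      using lipschitz_onD[OF lip, of "s + 1 / real (Suc n)" s] by (simp add: dist_real_def)
    then show "Q n s \<le> K"
      by (simp add: Q_def field_simps abs_le_iff)
  qed
  define E where "E p q N = {s \<in> ball 0 (real N). (\<forall>m. \<exists>n\<ge>m. Q n s < p) \<and> (\<forall>m. \<exists>n\<ge>m. q < Q n s)}"
    for p q N
  have E_sets: "E p q N \<in> sets borel" for p q N
    unfolding E_def by measurable
  have "AE s in lborel. s \<notin> E p q N" if "0 \<le> p" "p < q" for p q N
  proof -
    have near: "\<exists>a b. a < b \<and> s \<in> {a..b} \<and> b - a < d \<and> P (F b - F a) (b - a)"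
      if inf: "\<forall>m. \<exists>n\<ge>m. P' (Q n s)" and "0 < d"
        and PP: "\<And>n. P' (Q n s) \<Longrightarrow> P (Q n s / real (Suc n)) (1 / real (Suc n))" for s d P P'
    proof -
      obtain m where m: "1 / real (Suc m) < d" using \<open>0 < d\<close> by (meson nat_approx_posE)
      obtain n where n: "n \<ge> m" "P' (Q n s)" using inf by blast
      have "1 / real (Suc n) \<le> 1 / real (Suc m)" using n(1) by (simp add: frac_le)
      with m PP[OF n(2)] show ?thesis
        by (intro exI[of _ s] exI[of _ "s + 1 / real (Suc n)"]) (simp add: Q_def)
    qed
    have "emeasure lborel (E p q N) = 0"
    proof (rule null_set_of_two_slopes[OF mono cont that E_sets])
      show "bounded (E p q N)" by (rule bounded_subset[OF bounded_ball[of 0 "real N"]]) (auto simp: E_def)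
      show "\<exists>a b. a < b \<and> s \<in> {a..b} \<and> b - a < d \<and> F b - F a \<le> p * (b - a)"
        if "s \<in> E p q N" "0 < d" for s d
        using that by (intro near[where P' = "\<lambda>x. x < p"]) (auto simp: E_def divide_simps)
      show "\<exists>a b. a < b \<and> s \<in> {a..b} \<and> b - a < d \<and> q * (b - a) \<le> F b - F a"
        if "s \<in> E p q N" "0 < d" for s d
        using that by (intro near[where P' = "\<lambda>x. q < x" and P = "\<lambda>x y. q * y \<le> x"]) (auto simp: E_def divide_simps)
    qed
    then show ?thesis using E_sets by (intro AE_not_in) (auto simp: null_sets_def)
  qed
  then have "AE s in lborel. \<forall>p\<in>\<rat>. \<forall>q\<in>\<rat>. \<forall>N. 0 \<le> p \<longrightarrow> p < q \<longrightarrow> s \<notin> E p q N"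
    by (auto simp: AE_all_countable AE_ball_countable countable_rat)
  then show ?thesis
  proof (eventually_elim)
    fix s assume s: "\<forall>p\<in>\<rat>. \<forall>q\<in>\<rat>. \<forall>N. 0 \<le> p \<longrightarrow> p < q \<longrightarrow> s \<notin> E p q N"
    obtain N :: nat where "norm s < real N" using reals_Archimedean2 by blast
    then have N: "s \<in> ball 0 (real N)" by simp
    have "convergent (\<lambda>n. Q n s)"
    proof (rule convergent_if_no_oscillation[where X = "\<lambda>n. Q n s", OF Q])
      fix p q :: real assume "p \<in> \<rat>" "q \<in> \<rat>" "0 \<le> p" "p < q"
      then have "s \<notin> E p q N" using s by blast
      then show "\<not> ((\<forall>m. \<exists>n\<ge>m. Q n s < p) \<and> (\<forall>m. \<exists>n\<ge>m. q < Q n s))"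
        using N unfolding E_def by blast
    qed
    then show "convergent (\<lambda>n. real (Suc n) * (F (s + 1 / real (Suc n)) - F s))"
      unfolding Q_def .
  qed
qed

text \<open>Adding a linear function of slope K makes \<open>F\<close> nondecreasing and shifts
  every quotient by the same constant.\<close>

lemma AE_convergent_quotients_lipschitz:
  fixes F :: "real \<Rightarrow> real"
  assumes lip: "K-lipschitz_on UNIV F"
  shows "AE s in lborel. convergent (\<lambda>n. real (Suc n) * (F (s + 1 / real (Suc n)) - F s))"
proof -
  define G where "G s = F s + K * s" for s
  have K: "0 \<le> K" using lip by (rule lipschitz_on_nonneg)
  have FD: "\<bar>F s - F t\<bar> \<le> K * \<bar>s - t\<bar>" for s t
    using lipschitz_onD[OF lip, of s t] by (simp add: dist_real_def)
  have "G s \<le> G t" if "s \<le> t" for s t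
    using FD[of s t] that by (simp add: G_def algebra_simps abs_if split: if_splits)
  moreover have "(2 * K)-lipschitz_on UNIV G"
  proof (rule lipschitz_onI)
    fix s t :: real
    have "\<bar>G s - G t\<bar> = \<bar>(F s - F t) + K * (s - t)\<bar>" by (simp add: G_def algebra_simps)
    also have "\<dots> \<le> \<bar>F s - F t\<bar> + \<bar>K * (s - t)\<bar>" by (rule abs_triangle_ineq)
    also have "\<dots> \<le> 2 * K * \<bar>s - t\<bar>" using FD[of s t] K by (simp add: abs_mult)
    finally show "dist (G s) (G t) \<le> 2 * K * dist s t" by (simp add: dist_real_def)
  qed (use K in simp)
  ultimately have "AE s in lborel. convergent (\<lambda>n. real (Suc n) * (G (s + 1 / real (Suc n)) - G s))"
    by (rule AE_convergent_quotients_mono)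
  then show ?thesis
  proof (eventually_elim)
    fix s assume "convergent (\<lambda>n. real (Suc n) * (G (s + 1 / real (Suc n)) - G s))"
    then have "convergent (\<lambda>n. real (Suc n) * (G (s + 1 / real (Suc n)) - G s) + (- K))"
      by (intro convergent_add convergent_const)
    moreover have "real (Suc n) * (G (s + 1 / real (Suc n)) - G s) + (- K) =
        real (Suc n) * (F (s + 1 / real (Suc n)) - F s)" for n
      by (simp add: G_def field_simps)
    ultimately show "convergent (\<lambda>n. real (Suc n) * (F (s + 1 / real (Suc n)) - F s))" by simp
  qed
qed

section \<open>Null sets along parallel lines, and directional derivatives\<close>

lemma AE_lborel_translate:
  fixes c :: "'a::euclidean_space"
  assumes "N \<in> sets borel"
  shows "(AE x in lborel. x + c \<notin> N) \<longleftrightarrow> (AE x in lborel. x \<notin> N)"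
proof -
  have "(AE x in distr lborel borel ((+) c). x \<notin> N) \<longleftrightarrow> (AE x in lborel. c + x \<notin> N)"
    using assms by (intro AE_distr_iff) auto
  then show ?thesis unfolding lborel_distr_plus by (simp add: add.commute)
qed

text \<open>Fubini exchanges the two quantifiers; for each fixed t, translation invariance reduces
  the inner condition to one on \<open>N\<close> alone, so the quantifier over t becomes
  vacuous.\<close>

lemma AE_lborel_on_lines:
  fixes v :: "'a::euclidean_space"
  assumes [measurable]: "N \<in> sets borel"
  shows "(AE x in lborel. AE t in lborel. x + t *\<^sub>R v \<notin> N) \<longleftrightarrow> (AE x in lborel. x \<notin> N)"
proof -
  have "(AE x in lborel. AE t in lborel. x + t *\<^sub>R v \<notin> N) \<longleftrightarrow>
      (AE t in (lborel :: real measure). AE x in lborel. x + t *\<^sub>R v \<notin> N)"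
    by (rule lborel_pair.AE_commute) measurable
  also have "\<dots> \<longleftrightarrow> (AE t in (lborel :: real measure). AE x in lborel. x \<notin> N)"
    by (simp add: AE_lborel_translate)
  also have "\<dots> \<longleftrightarrow> (AE x in lborel. x \<notin> N)"
    by (cases "AE x in lborel. x \<notin> N") (auto simp: AE_iff_null)
  finally show ?thesis .
qed


text \<open>Steps 1/(n+1) instead of a continuous step size keep the limit a measurable function of
  the point. \<open>dderiv\<close> has a default value where the sequence diverges, so it carries
  information only almost everywhere.\<close>

definition quot :: "('a::real_normed_vector \<Rightarrow> real) \<Rightarrow> 'a \<Rightarrow> nat \<Rightarrow> 'a \<Rightarrow> real" where
  "quot h v n x = real (Suc n) * (h (x + (1 / real (Suc n)) *\<^sub>R v) - h x)"

definition dderiv :: "('a::real_normed_vector \<Rightarrow> real) \<Rightarrow> 'a \<Rightarrow> 'a \<Rightarrow> real" where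
  "dderiv h v x = lim (\<lambda>n. quot h v n x)"

lemma lipschitz_on_UNIV_abs:
  fixes h :: "'a::real_normed_vector \<Rightarrow> real"
  assumes "C-lipschitz_on UNIV h"
  shows "\<bar>h x - h y\<bar> \<le> C * norm (x - y)"
  using lipschitz_onD[OF assms, of x y] by (simp add: dist_real_def dist_norm)

lemma quot_bound:
  assumes "C-lipschitz_on UNIV h"
  shows "\<bar>quot h v n x\<bar> \<le> C * norm v"
proof -
  have "\<bar>quot h v n x\<bar> = real (Suc n) * \<bar>h (x + (1 / real (Suc n)) *\<^sub>R v) - h x\<bar>"
    by (simp add: quot_def abs_mult)
  also have "\<dots> \<le> real (Suc n) * (C * norm ((1 / real (Suc n)) *\<^sub>R v))"
    using lipschitz_on_UNIV_abs[OF assms, of "x + (1 / real (Suc n)) *\<^sub>R v" x]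
    by (intro mult_left_mono) auto
  also have "\<dots> = C * norm v" by simp
  finally show ?thesis .
qed

lemma quot_add:
  "quot h (v + w) n x = quot h v n (x + (1 / real (Suc n)) *\<^sub>R w) + quot h w n x"
  by (simp add: quot_def algebra_simps)

lemma lipschitz_borel_measurable:
  fixes h :: "'a::euclidean_space \<Rightarrow> real"
  shows "C-lipschitz_on UNIV h \<Longrightarrow> h \<in> borel_measurable borel"
  by (intro borel_measurable_continuous_onI lipschitz_on_continuous_on)

lemma quot_measurable:
  fixes h :: "'a::euclidean_space \<Rightarrow> real"
  assumes "C-lipschitz_on UNIV h"
  shows "quot h v n \<in> borel_measurable borel"
proof -
  note [measurable] = lipschitz_borel_measurable[OF assms]
  show ?thesis unfolding quot_def[abs_def] by measurable
qed

lemma dderiv_measurable: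
  fixes h :: "'a::euclidean_space \<Rightarrow> real"
  assumes "C-lipschitz_on UNIV h"
  shows "dderiv h v \<in> borel_measurable borel"
  unfolding dderiv_def[abs_def] using quot_measurable[OF assms] by (intro borel_measurable_lim_metric)

text \<open>On each line in direction \<open>v\<close> the function is Lipschitz in one variable, so
  the one-dimensional theorem applies, and Fubini assembles the exceptional parameters of the lines
  into a null set of the space.\<close>

lemma AE_convergent_quot:
  fixes h :: "'a::euclidean_space \<Rightarrow> real"
  assumes lip: "C-lipschitz_on UNIV h"
  shows "AE x in lborel. convergent (\<lambda>n. quot h v n x)"
proof -
  note [measurable] = quot_measurable[OF lip]
  define N where "N = {x. \<not> convergent (\<lambda>n. quot h v n x)}"
  have N[measurable]: "N \<in> sets borel"
    unfolding N_def Cauchy_convergent_iff[symmetric] by measurable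
  have "AE t in lborel. x + t *\<^sub>R v \<notin> N" for x
  proof -
    have "(C * norm v)-lipschitz_on UNIV (\<lambda>t. h (x + t *\<^sub>R v))"
    proof (rule lipschitz_onI)
      show "dist (h (x + s *\<^sub>R v)) (h (x + t *\<^sub>R v)) \<le> C * norm v * dist s t" for s t
        using lipschitz_on_UNIV_abs[OF lip, of "x + s *\<^sub>R v" "x + t *\<^sub>R v"]
        by (simp add: dist_real_def mult_ac scaleR_diff_left[symmetric])
    qed (use lipschitz_on_nonneg[OF lip] in simp)
    from AE_convergent_quotients_lipschitz[OF this] show ?thesis
      by eventually_elim (simp add: N_def quot_def scaleR_add_left add.assoc)
  qed
  then have "AE x in lborel. AE t in lborel. x + t *\<^sub>R v \<notin> N" by simp
  then show ?thesis unfolding AE_lborel_on_lines[OF N] by (simp add: N_def)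
qed

lemma AE_quot_tendsto:
  fixes h :: "'a::euclidean_space \<Rightarrow> real"
  assumes lip: "C-lipschitz_on UNIV h"
  shows "AE x in lborel. (\<lambda>n. quot h v n x) \<longlonglongrightarrow> dderiv h v x"
  using AE_convergent_quot[OF lip] by (simp add: dderiv_def convergent_LIMSEQ_iff)

lemma AE_dderiv_bound:
  fixes h :: "'a::euclidean_space \<Rightarrow> real"
  assumes lip: "C-lipschitz_on UNIV h"
  shows "AE x in lborel. \<bar>dderiv h v x\<bar> \<le> C * norm v"
  using AE_quot_tendsto[OF lip, of v]
proof eventually_elim
  fix x assume "(\<lambda>n. quot h v n x) \<longlonglongrightarrow> dderiv h v x"
  then have "(\<lambda>n. \<bar>quot h v n x\<bar>) \<longlonglongrightarrow> \<bar>dderiv h v x\<bar>" by (rule tendsto_rabs)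
  then show "\<bar>dderiv h v x\<bar> \<le> C * norm v"
    by (rule LIMSEQ_le_const2) (simp add: quot_bound[OF lip])
qed

lemma integrable_indicator_box_bounded:
  fixes k :: "'a::euclidean_space \<Rightarrow> real"
  assumes [measurable]: "k \<in> borel_measurable borel" and bnd: "AE x in lborel. \<bar>k x\<bar> \<le> K"
  shows "integrable lborel (\<lambda>x. indicator (box l u) x * k x)"
proof (rule Bochner_Integration.integrable_bound)
  have "emeasure lborel (box l u) < \<infinity>" by (rule emeasure_bounded_finite) simp
  then show "integrable lborel (\<lambda>x. indicator (box l u) x * K)"
    by (intro integrable_mult_left) (simp add: less_top[symmetric])
  show "AE x in lborel. norm (indicator (box l u) x * k x) \<le> norm (indicator (box l u) x * K)"
    using bnd by eventually_elim (auto simp: indicator_def)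
qed measurable

text \<open>Shifting by the bound K gives a nonnegative density. The measures with densities k + K
  and K agree on boxes, an intersection-stable generator, and densities are unique almost
  everywhere.\<close>

lemma AE_eq_0_if_integral_box_eq_0:
  fixes k :: "'a::euclidean_space \<Rightarrow> real"
  assumes k[measurable]: "k \<in> borel_measurable borel" and bnd: "AE x in lborel. \<bar>k x\<bar> \<le> K"
    and int: "\<And>l u. (\<integral>x. indicator (box l u) x * k x \<partial>lborel) = 0"
  shows "AE x in lborel. k x = 0"
proof -
  have K: "0 \<le> K"
  proof (rule ccontr)
    assume neg: "\<not> 0 \<le> K"
    have "AE x in (lborel :: 'a measure). False" using bnd by eventually_elim (use neg in auto)
    then show False by (simp add: AE_iff_null null_sets_def)
  qed
  let ?E = "range (\<lambda>(a, b). box a b :: 'a set)"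
  let ?A = "\<lambda>n::nat. box (- (real n *\<^sub>R One)) (real n *\<^sub>R One) :: 'a set"
  have "density lborel (\<lambda>x. ennreal (k x + K)) = density lborel (\<lambda>x. ennreal K)"
  proof (rule measure_eqI_generator_eq)
    show "Int_stable ?E" by (auto simp: Int_stable_def box_Int_box)
    show "?E \<subseteq> Pow UNIV" "sets (density lborel (\<lambda>x. ennreal (k x + K))) = sigma_sets UNIV ?E"
      "sets (density lborel (\<lambda>x. ennreal K)) = sigma_sets UNIV ?E"
      by (simp_all add: borel_eq_box)
    show "range ?A \<subseteq> ?E" "(\<Union>i. ?A i) = UNIV" unfolding UN_box_eq_UNIV by auto
    have fin: "emeasure lborel (box l u) < \<infinity>" for l u :: 'a
      by (rule emeasure_bounded_finite) simp
    have intK: "integrable lborel (\<lambda>x. indicator (box l u) x * K :: real)" for l u :: 'a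
      using fin by (intro integrable_mult_left) (simp add: less_top[symmetric])
    have intk: "integrable lborel (\<lambda>x. indicator (box l u) x * k x :: real)" for l u
      by (rule integrable_indicator_box_bounded[OF k bnd])
    show eq: "emeasure (density lborel (\<lambda>x. ennreal (k x + K))) X = emeasure (density lborel (\<lambda>x. ennreal K)) X"
      if "X \<in> ?E" for X
    proof -
      obtain l u where X: "X = box l u" using \<open>X \<in> ?E\<close> by auto
      have "emeasure (density lborel (\<lambda>x. ennreal (k x + K))) X =
          (\<integral>\<^sup>+x. ennreal (indicator X x * k x + indicator X x * K) \<partial>lborel)"
        unfolding X by (subst emeasure_density) (auto intro!: nn_integral_cong simp: indicator_def)
      also have "\<dots> = ennreal (\<integral>x. indicator X x * k x + indicator X x * K \<partial>lborel)"
        unfolding X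
      proof (rule nn_integral_eq_integral)
        show "integrable lborel (\<lambda>x. indicator (box l u) x * k x + indicator (box l u) x * K)"
          using intk intK by (rule Bochner_Integration.integrable_add)
        show "AE x in lborel. 0 \<le> indicator (box l u) x * k x + indicator (box l u) x * K"
          using bnd by eventually_elim (auto simp: indicator_def)
      qed
      also have "(\<integral>x. indicator X x * k x + indicator X x * K \<partial>lborel) = (\<integral>x. indicator X x * K \<partial>lborel)"
        unfolding X using int[of l u] by (subst Bochner_Integration.integral_add[OF intk intK]) simp
      also have "ennreal \<dots> = (\<integral>\<^sup>+x. ennreal (indicator X x * K) \<partial>lborel)"
        unfolding X using intK K by (intro nn_integral_eq_integral[symmetric]) auto
      also have "\<dots> = emeasure (density lborel (\<lambda>x. ennreal K)) X"
        unfolding X using K by (subst emeasure_density) (auto intro!: nn_integral_cong simp: indicator_def)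
      finally show ?thesis .
    qed
    have "emeasure (density lborel (\<lambda>x. ennreal K)) (?A i) = ennreal K * emeasure lborel (?A i)" for i
      by (subst emeasure_density) (auto simp: nn_integral_cmult_indicator)
    moreover have "?A i \<in> ?E" for i by auto
    ultimately show "emeasure (density lborel (\<lambda>x. ennreal (k x + K))) (?A i) \<noteq> \<infinity>" for i
      using fin[of "- (real i *\<^sub>R One)" "real i *\<^sub>R One"]
      by (subst eq) (auto simp: ennreal_mult_eq_top_iff)
  qed
  then have "AE x in lborel. ennreal (k x + K) = ennreal K"
    by (intro sigma_finite_measure.density_unique[OF sigma_finite_lborel]) auto
  with bnd show ?thesis
    by eventually_elim (use K in auto)
qed

section \<open>Rademacher's theorem and a mean value inequality\<close>

lemma LIMSEQ_scaled_inverse_Suc: "(\<lambda>n. (1 / real (Suc n)) *\<^sub>R (w::'a::real_normed_vector)) \<longlonglongrightarrow> 0"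
  using tendsto_scaleR[OF lim_1_over_n[THEN LIMSEQ_Suc] tendsto_const[of w]] by simp

lemma indicator_box_shift_tendsto:
  fixes x :: "'a::euclidean_space"
  assumes x: "x \<notin> frontier (box l u)" and y: "y \<longlonglongrightarrow> 0"
  shows "(\<lambda>n. indicator (box l u) (x - y n) :: real) \<longlonglongrightarrow> indicator (box l u) x"
proof -
  have lim: "(\<lambda>n. x - y n) \<longlonglongrightarrow> x" using tendsto_diff[OF tendsto_const y, of x] by simp
  show ?thesis
  proof (cases "x \<in> box l u")
    case True
    then have "eventually (\<lambda>n. x - y n \<in> box l u) sequentially"
      using topological_tendstoD[OF lim open_box] by blast
    then have "eventually (\<lambda>n. indicator (box l u) (x - y n) = (indicator (box l u) x :: real)) sequentially"
      by eventually_elim (use True in simp)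
    then show ?thesis by (rule tendsto_eventually)
  next
    case False
    then have "x \<in> - closure (box l u)" using x unfolding frontier_def interior_open[OF open_box] by simp
    then have "eventually (\<lambda>n. x - y n \<in> - closure (box l u)) sequentially"
      using topological_tendstoD[OF lim, of "- closure (box l u)"] by blast
    then have "eventually (\<lambda>n. indicator (box l u) (x - y n) = (indicator (box l u) x :: real)) sequentially"
      by eventually_elim (use False closure_subset in \<open>auto simp: indicator_def\<close>)
    then show ?thesis by (rule tendsto_eventually)
  qed
qed

lemma integral_lborel_translate:
  fixes k :: "'a::euclidean_space \<Rightarrow> real"
  assumes [measurable]: "k \<in> borel_measurable borel"
  shows "(\<integral>x. k (x + c) \<partial>lborel) = (\<integral>x. k x \<partial>lborel)"
proof -
  have "(\<integral>x. k x \<partial>lborel) = (\<integral>x. k x \<partial>distr lborel borel ((+) c))"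
    unfolding lborel_distr_plus ..
  also have "\<dots> = (\<integral>x. k (c + x) \<partial>lborel)" by (rule integral_distr) auto
  finally show ?thesis by (simp add: add.commute)
qed

text \<open>Integrated over a box, the shift in \<open>quot_add\<close> moves onto the indicator of the box and
  disappears in the limit.\<close>

lemma AE_dderiv_add:
  fixes h :: "'a::euclidean_space \<Rightarrow> real"
  assumes lip: "C-lipschitz_on UNIV h"
  shows "AE x in lborel. dderiv h (v + w) x = dderiv h v x + dderiv h w x"
proof -
  note [measurable] = quot_measurable[OF lip] dderiv_measurable[OF lip]
  have C: "0 \<le> C" using lip by (rule lipschitz_on_nonneg)
  have int_box: "(\<lambda>n. \<integral>x. indicator (box l u) x * quot h v n x \<partial>lborel) \<longlonglongrightarrow>
      (\<integral>x. indicator (box l u) x * dderiv h v x \<partial>lborel)" for l u v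
  proof (rule integral_dominated_convergence)
    show "integrable lborel (\<lambda>x. indicator (box l u) x * (C * norm v))"
      using C by (intro integrable_indicator_box_bounded[where K = "C * norm v"]) auto
    show "AE x in lborel. (\<lambda>n. indicator (box l u) x * quot h v n x) \<longlonglongrightarrow> indicator (box l u) x * dderiv h v x"
      using AE_quot_tendsto[OF lip, of v] by eventually_elim (intro tendsto_intros)
    show "AE x in lborel. norm (indicator (box l u) x * quot h v n x) \<le> indicator (box l u) x * (C * norm v)" for n
      using quot_bound[OF lip, of v n] by (intro AE_I2) (auto simp: indicator_def)
  qed measurable
  have int_shift: "(\<lambda>n. \<integral>x. indicator (box l u) x * quot h v n (x + (1 / real (Suc n)) *\<^sub>R w) \<partial>lborel) \<longlonglongrightarrow>
      (\<integral>x. indicator (box l u) x * dderiv h v x \<partial>lborel)" for l u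
  proof -
    have "(\<integral>x. indicator (box l u) x * quot h v n (x + (1 / real (Suc n)) *\<^sub>R w) \<partial>lborel) =
        (\<integral>x. indicator (box l u) (x - (1 / real (Suc n)) *\<^sub>R w) * quot h v n x \<partial>lborel)" for n
      using integral_lborel_translate[of "\<lambda>x. indicator (box l u) (x - (1 / real (Suc n)) *\<^sub>R w) * quot h v n x"
          "(1 / real (Suc n)) *\<^sub>R w"] by simp
    moreover have "(\<lambda>n. \<integral>x. indicator (box l u) (x - (1 / real (Suc n)) *\<^sub>R w) * quot h v n x \<partial>lborel) \<longlonglongrightarrow>
      (\<integral>x. indicator (box l u) x * dderiv h v x \<partial>lborel)"
    proof (rule integral_dominated_convergence)
      \<comment> \<open>Each shift has norm at most that of \<open>w\<close>, so this enlarged box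
        contains all shifted boxes and provides one integrable majorant.\<close>
      define B where "B = box (l - norm w *\<^sub>R One) (u + norm w *\<^sub>R One :: 'a)"
      show "integrable lborel (\<lambda>x. indicator B x * (C * norm v))"
        unfolding B_def using C by (intro integrable_indicator_box_bounded[where K = "C * norm v"]) auto
      have "AE x in lborel. x \<notin> frontier (box l u)"
        using negligible_convex_frontier[OF convex_box(2)[of l u]]
        by (intro AE_not_in) (auto simp: negligible_iff_null_sets null_sets_completion_iff)
      with AE_quot_tendsto[OF lip, of v]
      show "AE x in lborel. (\<lambda>n. indicator (box l u) (x - (1 / real (Suc n)) *\<^sub>R w) * quot h v n x)
          \<longlonglongrightarrow> indicator (box l u) x * dderiv h v x"
        by eventually_elim (intro tendsto_intros indicator_box_shift_tendsto LIMSEQ_scaled_inverse_Suc)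
      have sub: "x \<in> B" if "x - (1 / real (Suc n)) *\<^sub>R w \<in> box l u" for x n
      proof -
        have "\<bar>((1 / real (Suc n)) *\<^sub>R w) \<bullet> b\<bar> \<le> norm w" if "b \<in> Basis" for b
        proof -
          have "\<bar>((1 / real (Suc n)) *\<^sub>R w) \<bullet> b\<bar> \<le> norm ((1 / real (Suc n)) *\<^sub>R w)"
            using that by (rule Basis_le_norm)
          also have "\<dots> \<le> norm w" by (simp add: divide_le_eq mult_le_cancel_left1)
          finally show ?thesis .
        qed
        note le = this
        show ?thesis
          unfolding B_def mem_box
        proof
          fix b :: 'a assume b: "b \<in> Basis"
          have "l \<bullet> b < (x - (1 / real (Suc n)) *\<^sub>R w) \<bullet> b" "(x - (1 / real (Suc n)) *\<^sub>R w) \<bullet> b < u \<bullet> b"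
            using that b unfolding mem_box by blast+
          moreover have One: "(norm w *\<^sub>R One) \<bullet> b = norm w" using b by simp
          ultimately show "(l - norm w *\<^sub>R One) \<bullet> b < x \<bullet> b \<and> x \<bullet> b < (u + norm w *\<^sub>R One) \<bullet> b"
            using le[OF b] One b unfolding inner_diff_left inner_add_left by linarith
        qed
      qed
      show "AE x in lborel. norm (indicator (box l u) (x - (1 / real (Suc n)) *\<^sub>R w) * quot h v n x)
          \<le> indicator B x * (C * norm v)" for n
        using quot_bound[OF lip, of v n] sub C by (intro AE_I2) (auto simp: indicator_def)
    qed measurable
    ultimately show ?thesis by simp
  qed
  have intq: "integrable lborel (\<lambda>x. indicator (box l u) x * quot h w n x)"
    "integrable lborel (\<lambda>x. indicator (box l u) x * quot h v n (x + (1 / real (Suc n)) *\<^sub>R w))" for l u n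
    using quot_bound[OF lip] by (intro integrable_indicator_box_bounded AE_I2; measurable)+
  have intd: "integrable lborel (\<lambda>x. indicator (box l u) x * dderiv h v x)" for l u v
    by (rule integrable_indicator_box_bounded[OF _ AE_dderiv_bound[OF lip]]) measurable
  have "(\<integral>x. indicator (box l u) x * dderiv h (v + w) x \<partial>lborel) =
      (\<integral>x. indicator (box l u) x * dderiv h v x \<partial>lborel) + (\<integral>x. indicator (box l u) x * dderiv h w x \<partial>lborel)" for l u
  proof (rule LIMSEQ_unique[OF int_box])
    have "(\<integral>x. indicator (box l u) x * quot h (v + w) n x \<partial>lborel) =
        (\<integral>x. indicator (box l u) x * quot h v n (x + (1 / real (Suc n)) *\<^sub>R w) \<partial>lborel) +
        (\<integral>x. indicator (box l u) x * quot h w n x \<partial>lborel)" for n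
      by (subst Bochner_Integration.integral_add[symmetric, OF intq(2) intq(1)])
        (simp add: quot_add distrib_left)
    then show "(\<lambda>n. \<integral>x. indicator (box l u) x * quot h (v + w) n x \<partial>lborel) \<longlonglongrightarrow>
      (\<integral>x. indicator (box l u) x * dderiv h v x \<partial>lborel) + (\<integral>x. indicator (box l u) x * dderiv h w x \<partial>lborel)"
      using tendsto_add[OF int_shift int_box] by simp
  qed
  then have box0: "(\<integral>x. indicator (box l u) x * (dderiv h (v + w) x - dderiv h v x - dderiv h w x) \<partial>lborel) = 0" for l u
    using intd by (simp add: right_diff_distrib)
  have "AE x in lborel. dderiv h (v + w) x - dderiv h v x - dderiv h w x = 0"
  proof (rule AE_eq_0_if_integral_box_eq_0[OF _ _ box0])
    show "AE x in lborel. \<bar>dderiv h (v + w) x - dderiv h v x - dderiv h w x\<bar> \<le> C * norm (v + w) + C * norm v + C * norm w"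
      using AE_dderiv_bound[OF lip, of "v + w"] AE_dderiv_bound[OF lip, of v] AE_dderiv_bound[OF lip, of w]
      by eventually_elim linarith
  qed measurable
  then show ?thesis by eventually_elim simp
qed

text \<open>With m = floor (1/s), the step 1/m differs from s by at most s/m. The Lipschitz bound
  then puts the quotient at s within 2K/m of the quotient at 1/m, and m tends to infinity as s tends
  to 0.\<close>

lemma lipschitz_quotient_right_limit:
  fixes k :: "real \<Rightarrow> real"
  assumes lip: "\<And>s t. \<bar>k s - k t\<bar> \<le> K * \<bar>s - t\<bar>" and k0: "k 0 = 0"
    and lim: "(\<lambda>n. real (Suc n) * k (1 / real (Suc n))) \<longlonglongrightarrow> L"
  shows "((\<lambda>s. k s / s) \<longlongrightarrow> L) (at_right 0)"
proof -
  define m where "m s = nat \<lfloor>1 / s\<rfloor>" for s :: real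
  have "filterlim (\<lambda>s::real. 1 / s) at_top (at_right 0)"
    using filterlim_inverse_at_top_right by (simp add: inverse_eq_divide)
  then have m_lim: "filterlim m at_top (at_right 0)"
    unfolding m_def
    by (intro filterlim_compose[OF filterlim_nat_sequentially]
        filterlim_compose[OF filterlim_floor_sequentially])
  have lim': "(\<lambda>n. real n * k (1 / real n)) \<longlonglongrightarrow> L"
    using lim by (subst filterlim_sequentially_Suc[symmetric])
  have A: "((\<lambda>s. real (m s) * k (1 / real (m s))) \<longlongrightarrow> L) (at_right 0)"
    by (rule filterlim_compose[OF lim' m_lim])
  have "((\<lambda>n. 2 * K / real n) \<longlongrightarrow> 0) sequentially" by (rule lim_const_over_n)
  then have B: "((\<lambda>s. 2 * K / real (m s)) \<longlongrightarrow> 0) (at_right 0)"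
    by (rule filterlim_compose[OF _ m_lim])
  have K: "0 \<le> K" using lip[of 0 1] by simp
  have "eventually (\<lambda>s::real. 0 < s \<and> s \<le> 1) (at_right 0)"
    by (auto simp: eventually_at_right_field intro!: exI[of _ 1])
  then have "eventually (\<lambda>s. norm (k s / s - real (m s) * k (1 / real (m s))) \<le> 2 * K / real (m s)) (at_right 0)"
  proof eventually_elim
    fix s :: real assume s: "0 < s \<and> s \<le> 1"
    have m1: "real (m s) \<le> 1 / s" "1 / s < real (m s) + 1" "1 \<le> real (m s)"
    proof -
      have "1 \<le> \<lfloor>1 / s\<rfloor>" using s by (simp add: le_floor_iff)
      then have *: "real (m s) = of_int \<lfloor>1 / s\<rfloor>" "1 \<le> real (m s)"
        unfolding m_def by linarith+
      then show "real (m s) \<le> 1 / s" "1 / s < real (m s) + 1" "1 \<le> real (m s)" by linarith+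
    qed
    define M where "M = real (m s)"
    note m1 = m1[folded M_def]
    have sM: "s \<le> 1 / M" "M * s \<le> 1" "1 \<le> M * s + s" using m1 s by (auto simp: field_simps)
    have "\<bar>k s - k (1 / M)\<bar> \<le> K * (1 / M - s)" using lip[of s "1 / M"] sM(1) by simp
    then have "\<bar>k s - k (1 / M)\<bar> / s \<le> K * (1 / M - s) / s" using s by (intro divide_right_mono) auto
    also have "\<dots> = K * ((1 / M - s) / s)" by simp
    also have "\<dots> \<le> K * (1 / M)"
    proof (rule mult_left_mono[OF _ K])
      have "1 / M - s = (1 - M * s) / M" using m1 by (simp add: field_simps)
      also have "\<dots> \<le> s / M" using m1 sM by (intro divide_right_mono) auto
      finally have "(1 / M - s) / s \<le> (s / M) / s" using s by (intro divide_right_mono) auto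
      then show "(1 / M - s) / s \<le> 1 / M" using s by simp
    qed
    finally have 1: "\<bar>(k s - k (1 / M)) / s\<bar> \<le> K / M" using s by simp
    have "\<bar>k (1 / M)\<bar> \<le> K * (1 / M)" using lip[of "1 / M" 0] k0 m1 by simp
    then have "\<bar>k (1 / M) * (1 / s - M)\<bar> \<le> (K * (1 / M)) * 1"
      unfolding abs_mult using m1 K by (intro mult_mono) auto
    then have 2: "\<bar>k (1 / M) / s - M * k (1 / M)\<bar> \<le> K / M" by (simp add: algebra_simps)
    have "k s / s - M * k (1 / M) = (k s - k (1 / M)) / s + (k (1 / M) / s - M * k (1 / M))"
      by (simp add: diff_divide_distrib)
    then show "norm (k s / s - real (m s) * k (1 / real (m s))) \<le> 2 * K / real (m s)"
      using 1 2 unfolding M_def[symmetric] real_norm_def by linarith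
  qed
  then have "((\<lambda>s. k s / s - real (m s) * k (1 / real (m s))) \<longlongrightarrow> 0) (at_right 0)"
    by (rule Lim_null_comparison[OF _ B])
  from tendsto_add[OF this A] show ?thesis by simp
qed

lemma quot_right_limit:
  fixes h :: "'a::real_normed_vector \<Rightarrow> real"
  assumes lip: "C-lipschitz_on UNIV h" and lim: "(\<lambda>n. quot h v n x) \<longlonglongrightarrow> L"
  shows "((\<lambda>s. (h (x + s *\<^sub>R v) - h x) / s) \<longlongrightarrow> L) (at_right 0)"
proof (rule lipschitz_quotient_right_limit)
  show "\<bar>(h (x + s *\<^sub>R v) - h x) - (h (x + t *\<^sub>R v) - h x)\<bar> \<le> (C * norm v) * \<bar>s - t\<bar>" for s t
    using lipschitz_on_UNIV_abs[OF lip, of "x + s *\<^sub>R v" "x + t *\<^sub>R v"]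
    by (simp add: mult_ac scaleR_diff_left[symmetric])
  show "(\<lambda>n. real (Suc n) * (h (x + (1 / real (Suc n)) *\<^sub>R v) - h x)) \<longlonglongrightarrow> L"
    using lim by (simp add: quot_def)
qed simp

text \<open>For c > 0 this is a change of step size in the one-sided limit; the steps 1/(n+1) by
  themselves are not invariant under scaling. For c < 0, additivity along \<open>v\<close> and
  \<open>- v\<close> supplies the sign that one-sided limits do not give.\<close>

lemma AE_dderiv_scale:
  fixes h :: "'a::euclidean_space \<Rightarrow> real"
  assumes lip: "C-lipschitz_on UNIV h"
  shows "AE x in lborel. dderiv h (c *\<^sub>R v) x = c * dderiv h v x"
proof -
  have zero: "dderiv h 0 x = 0" for x by (simp add: dderiv_def quot_def)
  have pos: "AE x in lborel. dderiv h (c *\<^sub>R v) x = c * dderiv h v x" if c: "0 < c" for c v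
    using AE_quot_tendsto[OF lip, of v] AE_quot_tendsto[OF lip, of "c *\<^sub>R v"]
  proof eventually_elim
    fix x assume x: "(\<lambda>n. quot h v n x) \<longlonglongrightarrow> dderiv h v x"
      "(\<lambda>n. quot h (c *\<^sub>R v) n x) \<longlonglongrightarrow> dderiv h (c *\<^sub>R v) x"
    have fl: "filterlim (\<lambda>s. c * s) (at_right 0) (at_right 0)"
    proof -
      have "((\<lambda>s. c * s) \<longlongrightarrow> c * 0) (at_right 0)" by (intro tendsto_intros)
      moreover have "eventually (\<lambda>s::real. 0 < s) (at_right 0)" by (simp add: eventually_at_filter)
      then have "eventually (\<lambda>s. c * s \<in> {0<..} \<and> c * s \<noteq> 0) (at_right 0)"
        by eventually_elim (use c in auto)
      ultimately show ?thesis unfolding filterlim_at by simp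
    qed
    have "((\<lambda>s. c * ((h (x + (c * s) *\<^sub>R v) - h x) / (c * s))) \<longlongrightarrow> c * dderiv h v x) (at_right 0)"
      by (intro tendsto_mult tendsto_const filterlim_compose[OF quot_right_limit[OF lip x(1)] fl])
    then have "((\<lambda>s. (h (x + s *\<^sub>R c *\<^sub>R v) - h x) / s) \<longlongrightarrow> c * dderiv h v x) (at_right 0)"
      using c by (simp add: mult.commute)
    then show "dderiv h (c *\<^sub>R v) x = c * dderiv h v x"
      using quot_right_limit[OF lip x(2)] by (intro tendsto_unique[of "at_right (0::real)"]) auto
  qed
  consider "c > 0" | "c = 0" | "c < 0" by linarith
  then show ?thesis
  proof cases
    case 3
    have "AE x in lborel. dderiv h (c *\<^sub>R v) x = (- c) * dderiv h (- v) x"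
      using pos[of "- c" "- v"] 3 by simp
    moreover have "AE x in lborel. 0 = dderiv h v x + dderiv h (- v) x"
      using AE_dderiv_add[OF lip, of v "- v"] by (simp add: zero)
    ultimately show ?thesis 
    proof eventually_elim
      fix x assume x: "dderiv h (c *\<^sub>R v) x = (- c) * dderiv h (- v) x"
        "0 = dderiv h v x + dderiv h (- v) x"
      from x(2) have "dderiv h (- v) x = - dderiv h v x" by linarith
      with x(1) show "dderiv h (c *\<^sub>R v) x = c * dderiv h v x" by simp
    qed
  qed (simp_all add: pos zero)
qed

lemma AE_dderiv_linear:
  fixes h :: "'a::euclidean_space \<Rightarrow> real"
  assumes lip: "C-lipschitz_on UNIV h"
  shows "AE x in lborel. dderiv h v x = v \<bullet> (\<Sum>b\<in>Basis. dderiv h b x *\<^sub>R b)"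
proof -
  have "AE x in lborel. dderiv h (\<Sum>b\<in>S. (v \<bullet> b) *\<^sub>R b) x = (\<Sum>b\<in>S. (v \<bullet> b) * dderiv h b x)"
    if "finite S" for S
    using that
  proof (induction S)
    case empty
    show ?case by (simp add: dderiv_def quot_def)
  next
    case (insert b S)
    show ?case
      using insert.IH AE_dderiv_scale[OF lip, of "v \<bullet> b" b]
        AE_dderiv_add[OF lip, of "(v \<bullet> b) *\<^sub>R b" "\<Sum>b\<in>S. (v \<bullet> b) *\<^sub>R b"]
      by eventually_elim (use insert in simp)
  qed
  from this[OF finite_Basis] show ?thesis
    by (simp add: euclidean_representation inner_sum_right mult.commute)
qed

text \<open>The null set off which a directional derivative exists and is linear depends on the
  direction, so only countably many directions can be treated at once. A countable dense set is
  enough: the unit sphere is compact, and the Lipschitz bound controls the passage to a nearby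
  direction.\<close>

theorem AE_lipschitz_gradient:
  fixes h :: "'a::euclidean_space \<Rightarrow> real"
  assumes lip: "C-lipschitz_on UNIV h"
  shows "AE x in lborel. GDERIV h x :> (\<Sum>b\<in>Basis. dderiv h b x *\<^sub>R b)"
proof -
  obtain Q :: "'a set" where Q: "countable Q" "\<And>U. open U \<Longrightarrow> U \<noteq> {} \<Longrightarrow> \<exists>q\<in>Q. q \<in> U"
    using countable_dense_exists by (metis)
  have "AE x in lborel. \<forall>q\<in>Q. (\<lambda>n. quot h q n x) \<longlonglongrightarrow> dderiv h q x \<and>
      dderiv h q x = q \<bullet> (\<Sum>b\<in>Basis. dderiv h b x *\<^sub>R b)"
    unfolding AE_ball_countable[OF Q(1)]
  proof
    fix q show "AE x in lborel. (\<lambda>n. quot h q n x) \<longlonglongrightarrow> dderiv h q x \<and>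
        dderiv h q x = q \<bullet> (\<Sum>b\<in>Basis. dderiv h b x *\<^sub>R b)"
      using AE_quot_tendsto[OF lip, of q] AE_dderiv_linear[OF lip, of q] by eventually_elim blast
  qed
  then show ?thesis
  proof eventually_elim
    fix x
    define G where "G = (\<Sum>b\<in>Basis. dderiv h b x *\<^sub>R b)"
    assume "\<forall>q\<in>Q. (\<lambda>n. quot h q n x) \<longlonglongrightarrow> dderiv h q x \<and>
        dderiv h q x = q \<bullet> (\<Sum>b\<in>Basis. dderiv h b x *\<^sub>R b)"
    then have qlim: "((\<lambda>s. (h (x + s *\<^sub>R q) - h x) / s) \<longlongrightarrow> q \<bullet> G) (at_right 0)" if "q \<in> Q" for q
      using that quot_right_limit[OF lip, of q x] by (auto simp: G_def)
    have C: "0 \<le> C" using lip by (rule lipschitz_on_nonneg)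
    have main: "\<exists>d>0. \<forall>y. norm y < d \<longrightarrow> \<bar>h (x + y) - h x - y \<bullet> G\<bar> \<le> e * norm y" if e: "0 < e" for e
    proof -
      \<comment> \<open>Per unit length the error is C times \<eta> for changing the direction
        inside \<open>h\<close>, \<eta> for the difference quotient, and norm G times \<eta> for
        changing the direction in the linear term.\<close>
      define \<eta> where "\<eta> = e / (C + 1 + norm G)"
      have pos: "0 < C + 1 + norm G" using C norm_ge_zero[of G] by linarith
      then have \<eta>: "0 < \<eta>" using e by (simp add: \<eta>_def)
      have "sphere (0::'a) 1 \<subseteq> (\<Union>q\<in>Q. ball q \<eta>)"
      proof
        fix z :: 'a
        obtain q where "q \<in> Q" "q \<in> ball z \<eta>" using Q(2)[of "ball z \<eta>"] \<eta> by auto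
        then show "z \<in> (\<Union>q\<in>Q. ball q \<eta>)" by (auto simp: dist_commute)
      qed
      then obtain F where F: "F \<subseteq> Q" "finite F" "sphere (0::'a) 1 \<subseteq> (\<Union>q\<in>F. ball q \<eta>)"
        using compactE_image[OF compact_sphere[of "0::'a" 1], of Q "\<lambda>q. ball q \<eta>"] by auto
      have "eventually (\<lambda>s. \<forall>q\<in>F. \<bar>(h (x + s *\<^sub>R q) - h x) / s - q \<bullet> G\<bar> < \<eta>) (at_right 0)"
        unfolding eventually_ball_finite_distrib[OF F(2)]
        using tendstoD[OF qlim \<eta>] F(1) by (auto simp: dist_real_def)
      then obtain d where d: "d > 0" "\<And>s q. 0 < s \<Longrightarrow> s < d \<Longrightarrow> q \<in> F \<Longrightarrow>
          \<bar>(h (x + s *\<^sub>R q) - h x) / s - q \<bullet> G\<bar> < \<eta>"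
        unfolding eventually_at_right_field by blast
      have "\<bar>h (x + y) - h x - y \<bullet> G\<bar> \<le> e * norm y" if y: "norm y < d" for y
      proof (cases "y = 0")
        case False
        define s where "s = norm y"
        define z where "z = y /\<^sub>R s"
        have s: "0 < s" "s < d" using False y by (auto simp: s_def)
        have yz: "y = s *\<^sub>R z" using s by (simp add: z_def)
        have "norm z = 1" using False by (simp add: z_def s_def)
        then obtain q where q: "q \<in> F" "norm (z - q) < \<eta>"
          using F(3) by (auto simp: subset_iff dist_norm norm_minus_commute)
        have 1: "\<bar>h (x + s *\<^sub>R z) - h (x + s *\<^sub>R q)\<bar> \<le> C * (s * \<eta>)"
        proof -
          have "\<bar>h (x + s *\<^sub>R z) - h (x + s *\<^sub>R q)\<bar> \<le> C * (s * norm (z - q))"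
            using lipschitz_on_UNIV_abs[OF lip, of "x + s *\<^sub>R z" "x + s *\<^sub>R q"] s
            by (simp add: scaleR_diff_right[symmetric])
          also have "\<dots> \<le> C * (s * \<eta>)" using q s C by (intro mult_left_mono) auto
          finally show ?thesis .
        qed
        have 2: "\<bar>h (x + s *\<^sub>R q) - h x - s * (q \<bullet> G)\<bar> \<le> s * \<eta>"
        proof -
          have "h (x + s *\<^sub>R q) - h x - s * (q \<bullet> G) = s * ((h (x + s *\<^sub>R q) - h x) / s - q \<bullet> G)"
            using s by (simp add: field_simps)
          then show ?thesis using d(2)[OF s q(1)] s by (simp add: abs_mult)
        qed
        have "\<bar>(q - z) \<bullet> G\<bar> \<le> norm (q - z) * norm G" by (rule Cauchy_Schwarz_ineq2)
        also have "\<dots> \<le> \<eta> * norm G" using q(2) by (intro mult_right_mono) (auto simp: norm_minus_commute)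
        finally have "s * \<bar>(q - z) \<bullet> G\<bar> \<le> s * (\<eta> * norm G)" using s by (intro mult_left_mono) auto
        then have 3: "\<bar>s * (q \<bullet> G) - s * (z \<bullet> G)\<bar> \<le> s * (\<eta> * norm G)"
          using s by (simp add: inner_diff_left right_diff_distrib[symmetric] abs_mult)
        have "\<bar>h (x + y) - h x - y \<bullet> G\<bar> \<le> C * (s * \<eta>) + s * \<eta> + s * (\<eta> * norm G)"
          using 1 2 3 unfolding yz inner_scaleR_left by linarith
        also have "\<dots> = (C + 1 + norm G) * \<eta> * s" by (simp add: algebra_simps)
        also have "\<dots> = e * norm y" using pos by (simp add: \<eta>_def s_def)
        finally show ?thesis .
      qed simp
      with d(1) show ?thesis by blast
    qed
    have "(h has_derivative (\<lambda>y. y \<bullet> G)) (at x)"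
      unfolding has_derivative_at_alt
    proof (intro conjI allI impI)
      show "bounded_linear (\<lambda>y. y \<bullet> G)" by (rule bounded_linear_inner_left)
      fix e :: real assume "0 < e"
      then obtain d where d: "d > 0" "\<And>y. norm y < d \<Longrightarrow> \<bar>h (x + y) - h x - y \<bullet> G\<bar> \<le> e * norm y"
        using main by blast
      show "\<exists>d>0. \<forall>y. norm (y - x) < d \<longrightarrow> norm (h y - h x - (y - x) \<bullet> G) \<le> e * norm (y - x)"
      proof (intro exI[of _ d] conjI allI impI)
        fix y assume "norm (y - x) < d"
        from d(2)[OF this] show "norm (h y - h x - (y - x) \<bullet> G) \<le> e * norm (y - x)" by simp
      qed (rule d(1))
    qed
    then show "GDERIV h x :> (\<Sum>b\<in>Basis. dderiv h b x *\<^sub>R b)"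
      by (simp add: gderiv_def G_def)
  qed
qed

text \<open>The integral of the difference quotient over [0, 1] telescopes to a mean of
  \<open>k\<close> just to the right of 1 minus a mean just to the right of 0. Dominated convergence
  sends the same integral to that of the derivative, which gives the fundamental theorem of calculus
  for \<open>k\<close>.\<close>

lemma lipschitz_increment_le:
  fixes k :: "real \<Rightarrow> real"
  assumes lip: "K-lipschitz_on UNIV k" and le: "AE t in lborel. t \<in> {0..1} \<longrightarrow> dderiv k 1 t \<le> c"
  shows "k 1 - k 0 \<le> c"
proof -
  note [measurable] = quot_measurable[OF lip] dderiv_measurable[OF lip]
  have K: "0 \<le> K" using lip by (rule lipschitz_on_nonneg)
  have cont: "continuous_on S k" for S
    using lipschitz_on_continuous_on[OF lip] continuous_on_subset by blast
  define F where "F s = integral {0..s} k" for s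
  have F_diff: "integral {a..b} k = F b - F a" if "0 \<le> a" "a \<le> b" for a b
    using Henstock_Kurzweil_Integration.integral_combine[OF that, of k] cont by (simp add: F_def integrable_continuous_real)
  have F_lim: "(\<lambda>n. real (Suc n) * (F (a + 1 / real (Suc n)) - F a)) \<longlonglongrightarrow> k a" if "0 \<le> a" for a
  proof -
    have "(F has_real_derivative k a) (at a within {0..a+1})"
      unfolding F_def using that by (intro integral_has_real_derivative[OF cont]) auto
    then have "((\<lambda>x. (F x - F a) / (x - a)) \<longlongrightarrow> k a) (at a within {0..a+1})"
      by (simp add: has_field_derivative_iff)
    moreover have "filterlim (\<lambda>n. a + 1 / real (Suc n)) (at a within {0..a+1}) sequentially"
    proof -
      have "(\<lambda>n. a + 1 / real (Suc n)) \<longlonglongrightarrow> a + 0"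
        by (intro tendsto_intros lim_1_over_n[THEN LIMSEQ_Suc])
      then show ?thesis unfolding filterlim_at using that by (auto intro!: always_eventually)
    qed
    ultimately have "(\<lambda>n. (F (a + 1 / real (Suc n)) - F a) / (a + 1 / real (Suc n) - a)) \<longlonglongrightarrow> k a"
      by (rule filterlim_compose)
    then show ?thesis by (simp add: mult.commute)
  qed
  let ?I = "\<lambda>x::real. indicator {0..1} x :: real"
  have int_c: "integrable lborel (\<lambda>x. ?I x * a)" for a :: real
    by (intro integrable_mult_left) simp
  have 1: "(\<lambda>n. \<integral>x. ?I x * quot k 1 n x \<partial>lborel) \<longlonglongrightarrow> (\<integral>x. ?I x * dderiv k 1 x \<partial>lborel)"
  proof (rule integral_dominated_convergence)
    show "AE x in lborel. (\<lambda>n. ?I x * quot k 1 n x) \<longlonglongrightarrow> ?I x * dderiv k 1 x"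
      using AE_quot_tendsto[OF lip, of 1] by eventually_elim (intro tendsto_intros)
    show "AE x in lborel. norm (?I x * quot k 1 n x) \<le> ?I x * K" for n
      using quot_bound[OF lip, of 1 n] by (intro AE_I2) (auto simp: indicator_def)
  qed (use int_c in auto)
  have 2: "(\<integral>x. ?I x * quot k 1 n x \<partial>lborel) =
      real (Suc n) * (F (1 + 1 / real (Suc n)) - F 1) - real (Suc n) * (F (0 + 1 / real (Suc n)) - F 0)" for n
  proof -
    have cq: "continuous_on {0..1} (quot k 1 n)"
      unfolding quot_def[abs_def] by (intro continuous_intros continuous_on_compose2[OF cont[of UNIV]]) auto
    have "(\<integral>x. ?I x * quot k 1 n x \<partial>lborel) = integral {0..1} (quot k 1 n)"
      using set_borel_integral_eq_integral(2)[OF borel_integrable_atLeastAtMost'[OF cq]]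
      by (simp add: set_lebesgue_integral_def)
    also have "\<dots> = real (Suc n) * (integral {0..1} (\<lambda>t. k (t + 1 / real (Suc n))) - integral {0..1} k)"
      unfolding quot_def
      by (subst integral_mult_right, subst Henstock_Kurzweil_Integration.integral_diff)
        (auto intro!: integrable_continuous_real cont continuous_on_compose2[OF cont[of UNIV]] continuous_intros)
    also have "integral {0..1} (\<lambda>t. k (t + 1 / real (Suc n))) = integral {0 + 1 / real (Suc n)..1 + 1 / real (Suc n)} k"
      using integral_shift[OF cont, where a = 0 and b = 1 and c = "1 / real (Suc n)"] by (simp add: o_def)
    finally show ?thesis by (simp add: F_diff algebra_simps)
  qed
  have "(\<lambda>n. \<integral>x. ?I x * quot k 1 n x \<partial>lborel) \<longlonglongrightarrow> k 1 - k 0"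
    unfolding 2 by (intro tendsto_diff F_lim) auto
  from LIMSEQ_unique[OF this 1] have "k 1 - k 0 = (\<integral>x. ?I x * dderiv k 1 x \<partial>lborel)" .
  also have "\<dots> \<le> (\<integral>x. ?I x * c \<partial>lborel)"
  proof (rule integral_mono_AE[OF _ int_c])
    show "integrable lborel (\<lambda>x. ?I x * dderiv k 1 x)"
    proof (rule Bochner_Integration.integrable_bound[OF int_c])
      show "AE x in lborel. norm (?I x * dderiv k 1 x) \<le> norm (?I x * K)"
        using AE_dderiv_bound[OF lip, of 1] by eventually_elim (use K in \<open>auto simp: indicator_def\<close>)
    qed measurable
    show "AE x in lborel. ?I x * dderiv k 1 x \<le> ?I x * c"
      using le by eventually_elim (auto simp: indicator_def)
  qed
  also have "\<dots> = c" by simp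
  finally show ?thesis .
qed

section \<open>The mean value inequality at points of differentiability\<close>

lemma GDERIV_right_limit:
  assumes "GDERIV f y :> u"
  shows "((\<lambda>s. (f (y + s *\<^sub>R d) - f y) / s) \<longlongrightarrow> u \<bullet> d) (at_right 0)"
proof -
  have "((\<lambda>s. y + s *\<^sub>R d) has_derivative (\<lambda>s. s *\<^sub>R d)) (at 0)"
    by (auto intro!: derivative_eq_intros)
  moreover have "(f has_derivative (\<lambda>h. h \<bullet> u)) (at (y + 0 *\<^sub>R d))"
    using assms by (simp add: gderiv_def)
  ultimately have "((\<lambda>s. f (y + s *\<^sub>R d)) has_derivative (\<lambda>s. (s *\<^sub>R d) \<bullet> u)) (at 0)"
    by (rule has_derivative_compose)
  then have "((\<lambda>s. f (y + s *\<^sub>R d)) has_real_derivative (u \<bullet> d)) (at 0)"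
    by (simp add: has_field_derivative_def inner_commute mult_commute_abs)
  then have "((\<lambda>s. (f (y + s *\<^sub>R d) - f y) / s) \<longlongrightarrow> u \<bullet> d) (at 0)"
    by (simp add: has_field_derivative_iff)
  then show ?thesis by (rule filterlim_mono) (simp_all add: at_le)
qed

text \<open>The segment from x to x + d may lie inside the exceptional null set, so it is moved to a
  parallel segment meeting that set in measure zero. If all slopes available there were too small,
  \<open>lipschitz_increment_le\<close> would contradict the increment. \<open>P\<close> allows the
  point to be a point of differentiability of further functions.\<close>

lemma lipschitz_mean_value:
  fixes h :: "'a::euclidean_space \<Rightarrow> real"
  assumes lip: "C-lipschitz_on UNIV h" and P: "AE u in lborel. P u" and \<delta>: "0 < \<delta>"
  obtains u G where "P u" "GDERIV h u :> G" "dist u x \<le> norm d + \<delta>" "h (x + d) - h x - \<delta> \<le> G \<bullet> d"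
proof -
  define Gr where "Gr u = (\<Sum>b\<in>Basis. dderiv h b u *\<^sub>R b)" for u
  have "AE u in lborel. P u \<and> GDERIV h u :> Gr u"
    using P AE_lipschitz_gradient[OF lip] by (simp add: Gr_def)
  then obtain N where "{u \<in> space lborel. \<not> (P u \<and> GDERIV h u :> Gr u)} \<subseteq> N"
    "emeasure lborel N = 0" "N \<in> sets lborel"
    by (rule AE_E)
  then have N: "{u. \<not> (P u \<and> GDERIV h u :> Gr u)} \<subseteq> N" "N \<in> null_sets lborel"
    by (simp_all add: null_sets_def)
  have N': "N \<in> sets borel" and "AE u in lborel. u \<notin> N" using N(2) by (auto intro: AE_not_in)
  then have lines: "AE y in lborel. AE t in lborel. y + t *\<^sub>R d \<notin> N"
    using AE_lborel_on_lines[OF N'] by blast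
  have C: "0 \<le> C" using lip by (rule lipschitz_on_nonneg)
  \<comment> \<open>Moving the base point by less than r changes each end value by at most C r, and
    2 C r stays below \<delta>.\<close>
  define r where "r = \<delta> / (2 * C + 1)"
  have r: "0 < r" "r \<le> \<delta>" "2 * C * r < \<delta>" using \<delta> C by (auto simp: r_def field_simps)
  have "\<exists>y\<in>ball x r. AE t in lborel. y + t *\<^sub>R d \<notin> N"
  proof (rule ccontr)
    assume neg: "\<not> ?thesis"
    from lines have "AE y in lborel. y \<notin> ball x r"
      by eventually_elim (use neg in blast)
    then have "ball x r \<in> null_sets lborel" by (simp add: AE_iff_null_sets)
    then show False using r(1) by (metis open_ball open_not_negligible ball_eq_empty not_le null_sets_completionI negligible_iff_null_sets)
  qed
  then obtain y where y: "dist x y < r" "AE t in lborel. y + t *\<^sub>R d \<notin> N" by auto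
  define k where "k t = h (y + t *\<^sub>R d)" for t
  have k_lip: "(C * norm d)-lipschitz_on UNIV k"
  proof (rule lipschitz_onI)
    show "dist (k s) (k t) \<le> C * norm d * dist s t" for s t
      using lipschitz_on_UNIV_abs[OF lip, of "y + s *\<^sub>R d" "y + t *\<^sub>R d"]
      by (simp add: k_def dist_real_def mult_ac scaleR_diff_left[symmetric])
  qed (use C in simp)
  have "\<exists>u\<in>- N. dist u x \<le> norm d + \<delta> \<and> h (x + d) - h x - \<delta> \<le> Gr u \<bullet> d"
  proof (rule ccontr)
    assume neg: "\<not> ?thesis"
    have "AE t in lborel. t \<in> {0..1} \<longrightarrow> dderiv k 1 t \<le> h (x + d) - h x - \<delta>"
      using y(2) AE_quot_tendsto[OF k_lip, of 1]
    proof eventually_elim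
      fix t assume t: "y + t *\<^sub>R d \<notin> N" "(\<lambda>n. quot k 1 n t) \<longlonglongrightarrow> dderiv k 1 t"
      show "t \<in> {0..1} \<longrightarrow> dderiv k 1 t \<le> h (x + d) - h x - \<delta>"
      proof
        assume t01: "t \<in> {0..1}"
        let ?u = "y + t *\<^sub>R d"
        have "dist ?u x \<le> norm (t *\<^sub>R d) + dist x y"
          using norm_triangle_ineq[of "t *\<^sub>R d" "y - x"] by (simp add: dist_norm algebra_simps norm_minus_commute)
        also have "\<dots> \<le> norm d + \<delta>" using t01 y(1) r(2) by (intro add_mono) (auto simp: mult_left_le_one_le)
        finally have lt: "Gr ?u \<bullet> d < h (x + d) - h x - \<delta>" using neg t(1) by force
        have "GDERIV h ?u :> Gr ?u" using N(1) t(1) by auto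
        from GDERIV_right_limit[OF this, of d]
        have "((\<lambda>s. (k (t + s *\<^sub>R 1) - k t) / s) \<longlongrightarrow> Gr ?u \<bullet> d) (at_right 0)"
          by (simp add: k_def scaleR_add_left add.assoc)
        with quot_right_limit[OF k_lip t(2)] have "dderiv k 1 t = Gr ?u \<bullet> d"
          by (intro tendsto_unique[of "at_right (0::real)"]) auto
        with lt show "dderiv k 1 t \<le> h (x + d) - h x - \<delta>" by simp
      qed
    qed
    from lipschitz_increment_le[OF k_lip this] have "h (y + d) - h y \<le> h (x + d) - h x - \<delta>"
      by (simp add: k_def)
    moreover have "\<bar>h (y + d) - h (x + d)\<bar> \<le> C * dist x y" "\<bar>h y - h x\<bar> \<le> C * dist x y"
      using lipschitz_on_UNIV_abs[OF lip, of "y + d" "x + d"] lipschitz_on_UNIV_abs[OF lip, of y x]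
      by (simp_all add: dist_norm norm_minus_commute)
    moreover have "C * dist x y \<le> C * r" using y(1) C by (intro mult_left_mono) auto
    ultimately show False using r(3) by linarith
  qed
  then show ?thesis using N(1) by (auto intro!: that)
qed

section \<open>Limits of gradients and normals\<close>

text \<open>The fibre over \<open>x\<close> of the closure of the graph of \<open>R\<close>. In this
  form closed values are immediate and outer semicontinuity is a matter of compactness. Gradients
  and proximal normals are the two instances.\<close>

definition limset :: "('a::topological_space \<Rightarrow> 'b::topological_space \<Rightarrow> bool) \<Rightarrow> 'a \<Rightarrow> 'b set" where
  "limset R x = {v. (x, v) \<in> closure {(y, u). R y u}}"

lemma limset_sequential:
  fixes x :: "'a::euclidean_space" and v :: "'b::euclidean_space"
  shows "v \<in> limset R x \<longleftrightarrow> (\<exists>y u. y \<longlonglongrightarrow> x \<and> (\<forall>i::nat. R (y i) (u i)) \<and> u \<longlonglongrightarrow> v)"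
proof
  assume "v \<in> limset R x"
  then obtain p where p: "\<And>n::nat. p n \<in> {(y, u). R y u}" "p \<longlonglongrightarrow> (x, v)"
    unfolding limset_def closure_sequential by blast
  have "(\<lambda>n. fst (p n)) \<longlonglongrightarrow> x" "(\<lambda>n. snd (p n)) \<longlonglongrightarrow> v"
    using tendsto_fst[OF p(2)] tendsto_snd[OF p(2)] by simp_all
  then show "\<exists>y u. y \<longlonglongrightarrow> x \<and> (\<forall>i::nat. R (y i) (u i)) \<and> u \<longlonglongrightarrow> v"
    using p(1) by (intro exI[of _ "\<lambda>n. fst (p n)"] exI[of _ "\<lambda>n. snd (p n)"]) (auto simp: case_prod_beta)
next
  assume "\<exists>y u. y \<longlonglongrightarrow> x \<and> (\<forall>i::nat. R (y i) (u i)) \<and> u \<longlonglongrightarrow> v"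
  then obtain y u where yu: "y \<longlonglongrightarrow> x" "\<And>i::nat. R (y i) (u i)" "u \<longlonglongrightarrow> v" by blast
  show "v \<in> limset R x"
    unfolding limset_def closure_sequential mem_Collect_eq
    by (rule exI[of _ "\<lambda>i. (y i, u i)"]) (use yu in \<open>auto intro: tendsto_Pair\<close>)
qed

lemma limset_eq:
  fixes x :: "'a::euclidean_space"
  shows "limset R x = {v :: 'b::euclidean_space. \<exists>y u. y \<longlonglongrightarrow> x \<and> (\<forall>i::nat. R (y i) (u i)) \<and> u \<longlonglongrightarrow> v}"
  by (rule set_eqI, unfold mem_Collect_eq, rule limset_sequential)

lemma closed_limset: "closed (limset R x)"
proof -
  have "limset R x = Pair x -` closure {(y, u). R y u}" by (auto simp: limset_def)
  moreover have "continuous_on UNIV (Pair x)" by (intro continuous_intros)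
  ultimately show ?thesis using closed_vimage[OF closed_closure] by metis
qed

text \<open>Violating values along points tending to \<open>x\<close> would cluster, by compactness
  of \<open>B\<close>, at an element of the limit set at \<open>x\<close>. Without the intersection
  with \<open>B\<close> they could escape to infinity.\<close>

lemma limset_outer_semicontinuous:
  fixes x :: "'a::euclidean_space" and B :: "'b::euclidean_space set"
  assumes B: "compact B" and \<eta>: "0 < \<eta>"
  shows "\<exists>\<delta>>0. \<forall>y. dist y x < \<delta> \<longrightarrow> (\<forall>v\<in>limset R y \<inter> B. \<exists>v'\<in>limset R x \<inter> B. dist v v' < \<eta>)"
proof (rule ccontr)
  assume "\<not> ?thesis"
  then have "\<forall>n. \<exists>y v. dist y x < 1 / real (Suc n) \<and> v \<in> limset R y \<inter> B \<and> (\<forall>v'\<in>limset R x \<inter> B. \<not> dist v v' < \<eta>)"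
    by (metis of_nat_0_less_iff zero_less_Suc zero_less_divide_1_iff)
  then obtain y v where yv: "\<And>n::nat. dist (y n) x < 1 / real (Suc n)" "\<And>n. v n \<in> limset R (y n)"
    "\<And>n. v n \<in> B" "\<And>n v'. v' \<in> limset R x \<inter> B \<Longrightarrow> \<not> dist (v n) v' < \<eta>"
    by (metis Int_iff)
  obtain w r where w: "w \<in> B" "strict_mono (r :: nat \<Rightarrow> nat)" "(v \<circ> r) \<longlonglongrightarrow> w"
    using B yv(3) unfolding compact_def by metis
  have y: "y \<longlonglongrightarrow> x"
    using Lim_null_comparison[OF always_eventually lim_1_over_n[THEN LIMSEQ_Suc], of "\<lambda>n. dist (y n) x"] yv(1)
    by (subst tendsto_dist_iff) (auto intro: less_imp_le)
  have lim: "(\<lambda>n. (y (r n), v (r n))) \<longlonglongrightarrow> (x, w)"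
    using LIMSEQ_subseq_LIMSEQ[OF y w(2)] w(3) by (intro tendsto_Pair) (simp_all add: o_def)
  have cl: "(y (r n), v (r n)) \<in> closure {(y, u). R y u}" for n
    using yv(2)[of "r n"] by (simp add: limset_def)
  have "(x, w) \<in> closure {(y, u). R y u}"
    by (rule closed_sequentially[OF closed_closure cl lim])
  then have "w \<in> limset R x \<inter> B"
    using w(1) by (simp add: limset_def)
  moreover obtain n where "dist ((v \<circ> r) n) w < \<eta>"
    using tendstoD[OF w(3) \<eta>] by (auto simp: eventually_sequentially)
  ultimately show False using yv(4) by force
qed

text \<open>The \<eta>-neighbourhood of the convex hull of \<open>T\<close> is convex and contains
  \<open>S\<close>.\<close>

lemma convex_hull_near:
  fixes S T :: "'a::real_normed_vector set"
  assumes near: "\<And>v. v \<in> S \<Longrightarrow> \<exists>v'\<in>T. dist v v' < \<eta>" and v: "v \<in> convex hull S"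
  shows "\<exists>v'\<in>convex hull T. dist v v' < \<eta>"
proof -
  have "convex (convex hull T + ball 0 \<eta>)" by (intro convex_set_plus) auto
  moreover have "S \<subseteq> convex hull T + ball 0 \<eta>"
  proof
    fix v assume "v \<in> S"
    then obtain v' where "v' \<in> T" "dist v v' < \<eta>" using near by blast
    then show "v \<in> convex hull T + ball 0 \<eta>"
      using set_plus_intro[OF hull_inc[of v' T convex], of "v - v'" "ball 0 \<eta>"]
      by (simp add: dist_norm norm_minus_commute)
  qed
  ultimately have "v \<in> convex hull T + ball 0 \<eta>" using v hull_minimal by blast
  then show ?thesis by (force elim!: set_plus_elim simp: dist_norm)
qed

lemma clarke_subdiff_eq: "clarke_subdiff f x = convex hull limset (\<lambda>y u. GDERIV f y :> u) x"
proof -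
  have "(y \<in> {w. f differentiable (at w)} \<and> GDERIV f y :> u) \<longleftrightarrow> GDERIV f y :> u" for y u
    unfolding gderiv_def by (auto intro: differentiableI)
  then show ?thesis unfolding clarke_subdiff_def limset_eq by simp
qed

lemma limiting_normal_cone_eq:
  "limiting_normal_cone X x = limset (\<lambda>y u. y \<in> X \<and> u \<in> proximal_normal_cone X y) x"
  unfolding limiting_normal_cone_def limset_eq by (rule Collect_cong) blast

text \<open>Testing the gradient in its own direction compares the square of its norm with C times
  its norm.\<close>

lemma GDERIV_norm_le:
  assumes G: "GDERIV f y :> u" and lip: "C-lipschitz_on (ball x e) f" and y: "y \<in> ball x e"
  shows "norm u \<le> C"
proof -
  have C: "0 \<le> C" using lip by (rule lipschitz_on_nonneg)
  have "((\<lambda>s. y + s *\<^sub>R u) \<longlongrightarrow> y + 0 *\<^sub>R u) (at_right 0)"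
    by (intro tendsto_intros)
  then have "eventually (\<lambda>s. y + s *\<^sub>R u \<in> ball x e) (at_right 0)"
    using y by (intro topological_tendstoD) auto
  moreover have "eventually (\<lambda>s::real. 0 < s) (at_right 0)" by (simp add: eventually_at_filter)
  ultimately have "eventually (\<lambda>s. (f (y + s *\<^sub>R u) - f y) / s \<le> C * norm u) (at_right 0)"
  proof eventually_elim
    fix s :: real assume s: "y + s *\<^sub>R u \<in> ball x e" "0 < s"
    have "f (y + s *\<^sub>R u) - f y \<le> C * (s * norm u)"
      using lipschitz_onD[OF lip s(1) y] s(2) by (simp add: dist_real_def dist_norm)
    then show "(f (y + s *\<^sub>R u) - f y) / s \<le> C * norm u"
      using s(2) by (simp add: divide_le_eq mult_ac)
  qed
  then have "u \<bullet> u \<le> C * norm u"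
    by (intro tendsto_upperbound[OF GDERIV_right_limit[OF G, of u]]) auto
  then have "norm u * norm u \<le> C * norm u" by (simp add: dot_square_norm power2_eq_square)
  then show ?thesis using C by (cases "norm u = 0") auto
qed

lemma limset_GDERIV_subset:
  fixes f :: "'a::euclidean_space \<Rightarrow> real"
  assumes lip: "C-lipschitz_on (ball x e) f" and y: "y \<in> ball x e"
  shows "limset (\<lambda>y u. GDERIV f y :> u) y \<subseteq> cball 0 C"
proof
  fix v assume "v \<in> limset (\<lambda>y u. GDERIV f y :> u) y"
  then obtain z u where zu: "z \<longlonglongrightarrow> y" "\<And>i::nat. GDERIV f (z i) :> u i" "u \<longlonglongrightarrow> v"
    unfolding limset_sequential by blast
  have "eventually (\<lambda>i. z i \<in> ball x e) sequentially"
    using topological_tendstoD[OF zu(1) open_ball y] .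
  then have "eventually (\<lambda>i. norm (u i) \<le> C) sequentially"
    by eventually_elim (rule GDERIV_norm_le[OF zu(2) lip])
  then have "norm v \<le> C"
    by (intro tendsto_upperbound[OF tendsto_norm[OF zu(3)]]) auto
  then show "v \<in> cball 0 C" by simp
qed

lemma clarke_subdiff_subset:
  fixes f :: "'a::euclidean_space \<Rightarrow> real"
  assumes "C-lipschitz_on (ball x e) f" "y \<in> ball x e"
  shows "clarke_subdiff f y \<subseteq> cball 0 C"
  unfolding clarke_subdiff_eq by (intro hull_minimal limset_GDERIV_subset[OF assms]) auto

lemma locally_lipschitzE:
  assumes "locally_lipschitz f"
  obtains e C where "0 < e" "C-lipschitz_on (ball x e) f"
  using assms unfolding locally_lipschitz_def by blast

lemma compact_limset_GDERIV:
  fixes f :: "'a::euclidean_space \<Rightarrow> real"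
  assumes "locally_lipschitz f"
  shows "compact (limset (\<lambda>y u. GDERIV f y :> u) x)"
proof -
  obtain e C where "0 < e" "C-lipschitz_on (ball x e) f" using locally_lipschitzE[OF assms] .
  then have "limset (\<lambda>y u. GDERIV f y :> u) x \<subseteq> cball 0 C" by (intro limset_GDERIV_subset) auto
  then show ?thesis by (meson bounded_cball bounded_subset closed_limset compact_eq_bounded_closed)
qed

lemma compact_clarke_subdiff:
  fixes f :: "'a::euclidean_space \<Rightarrow> real"
  shows "locally_lipschitz f \<Longrightarrow> compact (clarke_subdiff f x)"
  unfolding clarke_subdiff_eq by (intro compact_convex_hull compact_limset_GDERIV)

text \<open>A local Lipschitz constant bounds all gradients near \<open>x\<close>, so intersecting
  with a compact ball loses nothing, and nearness passes to convex hulls.\<close>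

lemma clarke_subdiff_outer_semicontinuous:
  fixes f :: "'a::euclidean_space \<Rightarrow> real"
  assumes "locally_lipschitz f" "0 < \<eta>"
  shows "\<exists>\<delta>>0. \<forall>y. dist y x < \<delta> \<longrightarrow> (\<forall>v\<in>clarke_subdiff f y. \<exists>v'\<in>clarke_subdiff f x. dist v v' < \<eta>)"
proof -
  let ?R = "\<lambda>y u. GDERIV f y :> u"
  obtain e C where e: "0 < e" "C-lipschitz_on (ball x e) f" using locally_lipschitzE[OF assms(1)] .
  obtain \<delta> where \<delta>: "0 < \<delta>" "\<And>y v. dist y x < \<delta> \<Longrightarrow> v \<in> limset ?R y \<inter> cball 0 C \<Longrightarrow>
      \<exists>v'\<in>limset ?R x \<inter> cball 0 C. dist v v' < \<eta>"
    using limset_outer_semicontinuous[where B = "cball 0 C" and R = ?R and x = x, OF compact_cball assms(2)] by blast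
  show ?thesis
  proof (intro exI[of _ "min \<delta> e"] conjI allI impI ballI)
    fix y v assume y: "dist y x < min \<delta> e" and v: "v \<in> clarke_subdiff f y"
    have "y \<in> ball x e" using y by (simp add: dist_commute)
    then have sub: "limset ?R y \<subseteq> cball 0 C" by (rule limset_GDERIV_subset[OF e(2)])
    have near: "\<exists>v'\<in>limset ?R x. dist u v' < \<eta>" if "u \<in> limset ?R y" for u
    proof -
      have "u \<in> limset ?R y \<inter> cball 0 C" using that sub by blast
      then show ?thesis using \<delta>(2)[of y u] y by auto
    qed
    show "\<exists>v'\<in>clarke_subdiff f x. dist v v' < \<eta>"
      using convex_hull_near[OF near] v unfolding clarke_subdiff_eq by simp
  qed (use \<delta> e in auto)
qed

text \<open>The Clarke normal cone need not be outer semicontinuous, but its part generated by limiting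
  normals of norm at most one is.\<close>

definition unit_normals :: "'a::euclidean_space set \<Rightarrow> 'a \<Rightarrow> 'a set" where
  "unit_normals X x = convex hull (limiting_normal_cone X x \<inter> cball 0 1)"

lemma compact_unit_normals: "compact (unit_normals X x)"
  unfolding unit_normals_def limiting_normal_cone_eq
  by (intro compact_convex_hull closed_Int_compact closed_limset compact_cball)

lemma unit_normals_outer_semicontinuous:
  assumes "0 < \<eta>"
  shows "\<exists>\<delta>>0. \<forall>y. dist y x < \<delta> \<longrightarrow> (\<forall>v\<in>unit_normals X y. \<exists>v'\<in>unit_normals X x. dist v v' < \<eta>)"
proof -
  let ?R = "\<lambda>y u. y \<in> X \<and> u \<in> proximal_normal_cone X y"
  obtain \<delta> where \<delta>: "0 < \<delta>" "\<And>y v. dist y x < \<delta> \<Longrightarrow> v \<in> limset ?R y \<inter> cball 0 1 \<Longrightarrow>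
      \<exists>v'\<in>limset ?R x \<inter> cball 0 1. dist v v' < \<eta>"
    using limset_outer_semicontinuous[where B = "cball 0 1" and R = ?R and x = x, OF compact_cball assms] by blast
  show ?thesis
  proof (intro exI[of _ \<delta>] conjI allI impI ballI)
    fix y v assume y: "dist y x < \<delta>" and v: "v \<in> unit_normals X y"
    show "\<exists>v'\<in>unit_normals X x. dist v v' < \<eta>"
      using v unfolding unit_normals_def limiting_normal_cone_eq
      by (rule convex_hull_near[rotated]) (rule \<delta>(2)[OF y])
  qed (rule \<delta>(1))
qed

lemma proximal_normal_cone_scale:
  "u \<in> proximal_normal_cone X y \<Longrightarrow> 0 \<le> r \<Longrightarrow> r *\<^sub>R u \<in> proximal_normal_cone X y"
proof -
  assume u: "u \<in> proximal_normal_cone X y" and r: "0 \<le> r"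
  obtain c v where cv: "u = c *\<^sub>R v" "y \<in> proj_set X (y + v)" "0 \<le> c"
    using u unfolding proximal_normal_cone_def by blast
  then have "r *\<^sub>R u = (r * c) *\<^sub>R v" "0 \<le> r * c" using r by auto
  with cv(2) show "r *\<^sub>R u \<in> proximal_normal_cone X y"
    unfolding proximal_normal_cone_def by blast
qed

lemma limiting_normal_cone_scale:
  assumes "v \<in> limiting_normal_cone X x" "0 \<le> r"
  shows "r *\<^sub>R v \<in> limiting_normal_cone X x"
proof -
  obtain y u where yu: "\<And>i::nat. y i \<in> X \<and> u i \<in> proximal_normal_cone X (y i)" "y \<longlonglongrightarrow> x" "u \<longlonglongrightarrow> v"
    using assms(1) unfolding limiting_normal_cone_def by blast
  then show ?thesis
    unfolding limiting_normal_cone_def mem_Collect_eq using assms(2)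
    by (intro exI[of _ y] exI[of _ "\<lambda>i. r *\<^sub>R u i"]) (auto intro!: tendsto_intros proximal_normal_cone_scale)
qed

text \<open>This returns the bounded normals of the proximal step to the Clarke normal cone:
  limiting normals may be multiplied by nonnegative numbers.\<close>

lemma scale_unit_normals:
  assumes "n \<in> unit_normals X x" "0 \<le> r"
  shows "r *\<^sub>R n \<in> clarke_normal_cone X x"
proof -
  have "r *\<^sub>R n \<in> (\<lambda>v. r *\<^sub>R v) ` (convex hull (limiting_normal_cone X x \<inter> cball 0 1))"
    using assms(1) by (auto simp: unit_normals_def)
  also have "\<dots> = convex hull ((\<lambda>v. r *\<^sub>R v) ` (limiting_normal_cone X x \<inter> cball 0 1))"
    by (rule convex_hull_scaling[symmetric])
  also have "\<dots> \<subseteq> convex hull limiting_normal_cone X x"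
    using assms(2) by (intro hull_mono) (auto intro: limiting_normal_cone_scale)
  also have "\<dots> \<subseteq> clarke_normal_cone X x" unfolding clarke_normal_cone_def by (rule closure_subset)
  finally show ?thesis .
qed

text \<open>Closedness rests on compactness of the two subdifferentials, as the normal cone is in
  general unbounded. Along limit curves, convexity handles averages and closedness turns distance
  zero into membership.\<close>

lemma composite_subdiff_closed_convex:
  fixes f g :: "'a::euclidean_space \<Rightarrow> real"
  assumes "locally_lipschitz f" "locally_lipschitz g"
  shows "closed (composite_subdiff f g X x)" "convex (composite_subdiff f g X x)"
proof -
  let ?K = "clarke_subdiff f x + clarke_subdiff g x"
  have "?K = {a + b | a b. a \<in> clarke_subdiff f x \<and> b \<in> clarke_subdiff g x}"
    by (auto simp: set_plus_def)
  then have "compact ?K"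
    using compact_sums[OF compact_clarke_subdiff[OF assms(1)] compact_clarke_subdiff[OF assms(2)]] by simp
  moreover have "closed (clarke_normal_cone X x)" by (simp add: clarke_normal_cone_def)
  moreover have "composite_subdiff f g X x = (\<Union>a\<in>?K. \<Union>b\<in>clarke_normal_cone X x. {a + b})"
    by (auto simp: composite_subdiff_def set_plus_def)
  ultimately show "closed (composite_subdiff f g X x)" by (simp add: compact_closed_sums)
  have "convex (clarke_subdiff h x)" for h :: "'a \<Rightarrow> real"
    by (simp add: clarke_subdiff_def)
  moreover have "convex (clarke_normal_cone X x)"
    unfolding clarke_normal_cone_def by (intro convex_closure convex_convex_hull)
  ultimately show "convex (composite_subdiff f g X x)"
    unfolding composite_subdiff_def by (intro convex_set_plus)
qed

section \<open>Optimality in the proximal step\<close>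

lemma infdist_lipschitz: "1-lipschitz_on UNIV (\<lambda>u. infdist u X)"
  by (rule lipschitz_onI) (auto simp: dist_real_def infdist_triangle_abs)

text \<open>In \<open>X\<close> the distance is minimal, and testing along \<open>- G\<close> gives
  G = 0. Outside \<open>X\<close>, moving towards a nearest point \<pi> lowers the distance D at
  unit rate, so G has inner product at least D with u - \<pi>, a vector of norm D. As G has norm at
  most 1, this is the equality case of Cauchy-Schwarz, and
  \<open>D *\<^sub>R G = u - \<pi>\<close>.\<close>

lemma infdist_gradient:
  fixes X :: "'a::euclidean_space set"
  assumes X: "closed X" "X \<noteq> {}" and G: "GDERIV (\<lambda>u. infdist u X) u :> G"
  shows "\<exists>\<pi>\<in>X. G \<in> proximal_normal_cone X \<pi> \<and> norm G \<le> 1 \<and> dist u \<pi> = infdist u X"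
proof -
  obtain \<pi> where \<pi>: "\<pi> \<in> X" "infdist u X = dist u \<pi>" using infdist_attains_inf[OF X] by blast
  have G1: "norm G \<le> 1"
    using GDERIV_norm_le[OF G lipschitz_on_subset[OF infdist_lipschitz], of u 1] by simp
  have "G \<in> proximal_normal_cone X \<pi>"
  proof (cases "u \<in> X")
    case True
    have "eventually (\<lambda>s::real. 0 < s) (at_right 0)" by (simp add: eventually_at_filter)
    then have "eventually (\<lambda>s. 0 \<le> (infdist (u + s *\<^sub>R (- G)) X - infdist u X) / s) (at_right 0)"
      by eventually_elim (use True in \<open>simp add: infdist_nonneg\<close>)
    then have "0 \<le> G \<bullet> (- G)"
      by (intro tendsto_lowerbound[OF GDERIV_right_limit[OF G]]) auto
    then have "G \<bullet> G = 0" using inner_ge_zero[of G] by simp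
    then have "G = 0" by simp
    moreover have "\<pi> \<in> proj_set X (\<pi> + 0)"
      using \<pi>(1) by (simp add: proj_set_def is_arg_min_def not_less)
    ultimately show ?thesis unfolding proximal_normal_cone_def
      by (intro CollectI exI[of _ 0] exI[of _ "0::'a"]) simp
  next
    case False
    define D where "D = infdist u X"
    have D: "0 < D" unfolding D_def using X False by (simp add: infdist_pos_not_in_closed)
    have "eventually (\<lambda>s::real. 0 < s \<and> s < 1) (at_right 0)"
      by (auto simp: eventually_at_right_field intro!: exI[of _ 1])
    then have "eventually (\<lambda>s. (infdist (u + s *\<^sub>R (\<pi> - u)) X - infdist u X) / s \<le> - D) (at_right 0)"
    proof eventually_elim
      fix s :: real assume s: "0 < s \<and> s < 1"
      have "infdist (u + s *\<^sub>R (\<pi> - u)) X \<le> dist (u + s *\<^sub>R (\<pi> - u)) \<pi>"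
        using \<pi>(1) by (rule infdist_le)
      also have "\<dots> = norm ((1 - s) *\<^sub>R (u - \<pi>))" by (simp add: dist_norm algebra_simps)
      also have "\<dots> = (1 - s) * D" using s \<pi>(2) by (simp add: D_def dist_norm)
      finally show "(infdist (u + s *\<^sub>R (\<pi> - u)) X - infdist u X) / s \<le> - D"
        using s by (simp add: D_def[symmetric] divide_le_eq algebra_simps)
    qed
    then have "G \<bullet> (\<pi> - u) \<le> - D"
      by (intro tendsto_upperbound[OF GDERIV_right_limit[OF G]]) auto
    then have le: "D \<le> G \<bullet> (u - \<pi>)" by (simp add: inner_diff_right)
    have n: "norm (u - \<pi>) = D" using \<pi>(2) by (simp add: D_def dist_norm)
    have "(norm (D *\<^sub>R G - v))\<^sup>2 = D\<^sup>2 * (norm G)\<^sup>2 - 2 * D * (G \<bullet> v) + (norm v)\<^sup>2" for v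
      by (simp only: power2_norm_eq_inner)
        (simp add: inner_diff_left inner_diff_right inner_commute power2_eq_square algebra_simps)
    then have "(norm (D *\<^sub>R G - (u - \<pi>)))\<^sup>2 = D\<^sup>2 * (norm G)\<^sup>2 - 2 * D * (G \<bullet> (u - \<pi>)) + D\<^sup>2"
      using n by metis
    also have "\<dots> \<le> D\<^sup>2 * 1 - 2 * D * D + D\<^sup>2"
      using D le G1 by (intro add_mono diff_mono mult_left_mono) (auto simp: power_le_one)
    also have "\<dots> = 0" by (simp add: power2_eq_square)
    finally have "D *\<^sub>R G = u - \<pi>" by simp
    from this[symmetric] have "G = (1 / D) *\<^sub>R (u - \<pi>)" using D by simp
    moreover have "\<pi> \<in> proj_set X (\<pi> + (u - \<pi>))"
    proof -
      have "norm (\<pi> - u) \<le> norm (w - u)" if "w \<in> X" for w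
        using infdist_le[OF that, of u] \<pi>(2) by (simp add: dist_norm norm_minus_commute)
      then show ?thesis using \<pi>(1) by (auto simp: proj_set_def is_arg_min_def not_less)
    qed
    ultimately show ?thesis unfolding proximal_normal_cone_def
      using D by (intro CollectI exI[of _ "1 / D"] exI[of _ "u - \<pi>"]) simp
  qed
  with \<pi> G1 show ?thesis by auto
qed

text \<open>McShane's formula, an infimum of cones of slope C over the values on \<open>S\<close>.
  It makes results on globally Lipschitz functions applicable to locally Lipschitz ones.\<close>

lemma lipschitz_extension:
  fixes g :: "'a::metric_space \<Rightarrow> real"
  assumes lip: "C-lipschitz_on S g" and S: "S \<noteq> {}"
  obtains g' where "C-lipschitz_on UNIV g'" "\<And>x. x \<in> S \<Longrightarrow> g' x = g x"
proof -
  define g' where "g' x = (INF w\<in>S. g w + C * dist w x)" for x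
  have C: "0 \<le> C" using lip by (rule lipschitz_on_nonneg)
  have g: "g x \<le> g w + C * dist w x" if "x \<in> S" "w \<in> S" for x w
    using lipschitz_onD[OF lip that] by (simp add: dist_real_def dist_commute abs_le_iff)
  obtain s where s: "s \<in> S" using S by blast
  have bdd: "bdd_below ((\<lambda>w. g w + C * dist w x) ` S)" for x
  proof (rule bdd_belowI2)
    fix w assume "w \<in> S"
    have "C * dist w s \<le> C * (dist w x + dist x s)"
      using C by (intro mult_left_mono dist_triangle)
    then show "g s - C * dist x s \<le> g w + C * dist w x"
      using g[OF s \<open>w \<in> S\<close>] by (simp add: algebra_simps)
  qed
  have le: "g' x \<le> g' y + C * dist x y" for x y
  proof -
    have "g' x - C * dist x y \<le> g' y"
      unfolding g'_def[of y]
    proof (rule cINF_greatest[OF S])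
      fix w assume w: "w \<in> S"
      have "g' x \<le> g w + C * dist w x" unfolding g'_def by (rule cINF_lower[OF bdd w])
      moreover have "C * dist w x \<le> C * (dist w y + dist y x)"
        using C by (intro mult_left_mono dist_triangle)
      ultimately show "g' x - C * dist x y \<le> g w + C * dist w y"
        by (simp add: algebra_simps dist_commute)
    qed
    then show ?thesis by simp
  qed
  show ?thesis
  proof
    show "C-lipschitz_on UNIV g'"
    proof (rule lipschitz_onI)
      fix x y show "dist (g' x) (g' y) \<le> C * dist x y"
        using le[of x y] le[of y x] by (simp add: dist_real_def dist_commute abs_le_iff)
    qed (rule C)
    fix x assume x: "x \<in> S"
    have "g' x \<le> g x" using cINF_lower[OF bdd x, of x] by (simp add: g'_def)
    moreover have "g x \<le> g' x" unfolding g'_def using g[OF x] by (intro cINF_greatest[OF S]) auto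
    ultimately show "g' x = g x" by simp
  qed
qed

lemma GDERIV_unique: "GDERIV h u :> a \<Longrightarrow> GDERIV h u :> b \<Longrightarrow> a = b"
proof -
  assume a: "GDERIV h u :> a" and b: "GDERIV h u :> b"
  have "a \<bullet> d = b \<bullet> d" for d
    by (rule tendsto_unique[OF _ GDERIV_right_limit[OF a] GDERIV_right_limit[OF b]]) simp
  then show "a = b" by (metis inner_eq_zero_iff inner_diff_left right_minus_eq)
qed

text \<open>The penalty \<open>\<rho>\<close> exceeds a Lipschitz constant of the proximal objective near \<open>z\<close>, so \<open>z\<close> is an
  unconstrained local minimum of the objective plus \<open>\<rho> infdist u X\<close>. The mean value inequality
  gives, in every direction, common points of differentiability with almost nonnegative slope,
  and separation yields the inclusion.\<close>

lemma prox_optimality: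
  fixes X :: "'a::euclidean_space set" and g :: "'a \<Rightarrow> real"
  assumes X: "closed X" and a: "0 < a"
    and min: "is_arg_min (\<lambda>u. g u + 1 / (2 * a) * (norm (u - y))\<^sup>2) (\<lambda>u. u \<in> X) z"
    and e: "0 < e" and lip: "C-lipschitz_on (ball z e) g" and loc: "locally_lipschitz g"
  obtains v n where "v \<in> clarke_subdiff g z" "n \<in> unit_normals X z"
    "(1 / a) *\<^sub>R (y - z) = v + (C + norm (y - z) / a + 1) *\<^sub>R n"
proof -
  define w where "w = (1 / a) *\<^sub>R (y - z)"
  define \<rho> where "\<rho> = C + norm (y - z) / a + 1"
  define q where "q u = 1 / (2 * a) * (norm (u - y))\<^sup>2" for u
  have C: "0 \<le> C" using lip by (rule lipschitz_on_nonneg)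
  have \<rho>: "0 \<le> \<rho>" using C a by (simp add: \<rho>_def)
  have zX: "z \<in> X" and zmin: "\<And>u. u \<in> X \<Longrightarrow> g z + q z \<le> g u + q u"
    using min by (auto simp: is_arg_min_def q_def not_less)
  obtain g' where g': "C-lipschitz_on UNIV g'" "\<And>u. u \<in> ball z e \<Longrightarrow> g' u = g u"
    using lipschitz_extension[OF lip] e by (metis centre_in_ball empty_iff)
  define h where "h u = g' u + \<rho> * infdist u X" for u
  have h_lip: "(C + \<rho>)-lipschitz_on UNIV h"
  proof (rule lipschitz_onI)
    fix u u'
    have "\<bar>g' u - g' u'\<bar> \<le> C * dist u u'" using lipschitz_onD[OF g'(1), of u u'] by (simp add: dist_real_def)
    moreover have "\<bar>\<rho> * infdist u X - \<rho> * infdist u' X\<bar> \<le> \<rho> * dist u u'"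
      using mult_left_mono[OF infdist_triangle_abs \<rho>, of u X u'] \<rho>
      by (simp add: right_diff_distrib[symmetric] abs_mult)
    ultimately show "dist (h u) (h u') \<le> (C + \<rho>) * dist u u'"
      by (simp add: h_def dist_real_def algebra_simps)
  qed (use C \<rho> in simp)
  \<comment> \<open>A point within e' of z has its nearest points of \<open>X\<close> within 2 e' of
    z, hence still in the ball where \<open>g\<close> is Lipschitz; 2 e' <= a enters the estimate of
    the quadratic term.\<close>
  define e' where "e' = min (e / 2) (a / 2)"
  have e': "0 < e'" "2 * e' \<le> e" "2 * e' \<le> a" using e a by (auto simp: e'_def)
  have penalty: "g z + q z \<le> h u + q u" if u: "dist u z < e'" for u
  proof -
    obtain \<pi> where \<pi>: "\<pi> \<in> X" "infdist u X = dist u \<pi>"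
      using infdist_attains_inf[OF X] zX by blast
    have u\<pi>: "dist u \<pi> \<le> dist u z" using infdist_le[OF zX, of u] \<pi>(2) by simp
    have "dist \<pi> z \<le> dist u \<pi> + dist u z" by (metis dist_commute dist_triangle)
    then have \<pi>z: "dist \<pi> z < 2 * e'" using u u\<pi> by simp
    have balls: "u \<in> ball z e" "\<pi> \<in> ball z e" using u \<pi>z e' by (auto simp: dist_commute)
    have 1: "g \<pi> - g' u \<le> C * dist u \<pi>"
      using lipschitz_onD[OF lip balls(2,1)] g'(2)[OF balls(1)] by (simp add: dist_real_def dist_commute abs_le_iff)
    have "(norm (\<pi> - y))\<^sup>2 - (norm (u - y))\<^sup>2 = (norm (\<pi> - y) - norm (u - y)) * (norm (\<pi> - y) + norm (u - y))"
      by (simp add: power2_eq_square algebra_simps)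
    also have "\<dots> \<le> dist u \<pi> * (2 * norm (y - z) + 2 * a)"
    proof (rule mult_mono)
      show "norm (\<pi> - y) - norm (u - y) \<le> dist u \<pi>"
        using norm_triangle_ineq2[of "\<pi> - y" "u - y"] by (simp add: dist_norm norm_minus_commute)
      have "norm (\<pi> - y) \<le> dist \<pi> z + norm (y - z)" "norm (u - y) \<le> dist u z + norm (y - z)"
        using norm_triangle_ineq[of "\<pi> - z" "z - y"] norm_triangle_ineq[of "u - z" "z - y"]
        by (simp_all add: dist_norm norm_minus_commute)
      then show "norm (\<pi> - y) + norm (u - y) \<le> 2 * norm (y - z) + 2 * a"
        using \<pi>z u e' by linarith
    qed auto
    finally have "1 / (2 * a) * ((norm (\<pi> - y))\<^sup>2 - (norm (u - y))\<^sup>2) \<le>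
        1 / (2 * a) * (dist u \<pi> * (2 * norm (y - z) + 2 * a))"
      using a by (intro mult_left_mono) auto
    then have "q \<pi> - q u \<le> 1 / (2 * a) * (dist u \<pi> * (2 * norm (y - z) + 2 * a))"
      by (simp add: q_def right_diff_distrib)
    also have "\<dots> = (norm (y - z) / a + 1) * dist u \<pi>" using a by (simp add: field_simps)
    finally have "g \<pi> + q \<pi> \<le> g' u + q u + \<rho> * dist u \<pi>"
      using 1 by (simp add: \<rho>_def algebra_simps)
    then show ?thesis using zmin[OF \<pi>(1)] by (simp add: h_def \<pi>(2))
  qed
  have hz: "h z = g z" using g'(2)[of z] e zX by (simp add: h_def)
  \<comment> \<open>The quadratic term has gradient - w at z, so minimality forces h to grow along d
    at least at rate w . d, up to second order.\<close>
  have incr: "s * (w \<bullet> d) - s\<^sup>2 * (norm d)\<^sup>2 / (2 * a) \<le> h (z + s *\<^sub>R d) - h z"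
    if s: "0 \<le> s" "s * norm d < e'" for s d
  proof -
    have "(norm (z + s *\<^sub>R d - y))\<^sup>2 = (norm (z - y))\<^sup>2 + 2 * s * ((z - y) \<bullet> d) + s\<^sup>2 * (norm d)\<^sup>2"
    proof -
      have "z + s *\<^sub>R d - y = (z - y) + s *\<^sub>R d" by simp
      then show ?thesis
        unfolding dot_norm[of "z - y" "s *\<^sub>R d", THEN eq_reflection]
        by (simp only: power2_norm_eq_inner) (simp add: inner_add_left inner_add_right inner_commute power2_eq_square algebra_simps)
    qed
    then have "q (z + s *\<^sub>R d) - q z = 1 / (2 * a) * (2 * s * ((z - y) \<bullet> d) + s\<^sup>2 * (norm d)\<^sup>2)"
      by (simp add: q_def add_divide_distrib)
    also have "\<dots> = - (s * (w \<bullet> d)) + s\<^sup>2 * (norm d)\<^sup>2 / (2 * a)"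
      using a by (simp add: w_def inner_diff_left field_simps)
    finally show ?thesis using penalty[of "z + s *\<^sub>R d"] s hz by (simp add: dist_norm)
  qed
  let ?Rg = "\<lambda>y u. GDERIV g y :> u" and ?RX = "\<lambda>y u. y \<in> X \<and> u \<in> proximal_normal_cone X y"
  have dir: "\<exists>p\<in>limset ?Rg z. \<exists>\<nu>\<in>limset ?RX z \<inter> cball 0 1. w \<bullet> d \<le> (p + \<rho> *\<^sub>R \<nu>) \<bullet> d" for d
  proof -
    \<comment> \<open>Collects the errors of order s squared: the second-order part of the quadratic
      term and the tolerance granted to the mean value inequality. After division by s they vanish
      in the limit.\<close>
    define K where "K = (norm d)\<^sup>2 / (2 * a) + 1"
    define s where "s n = e' / (1 + norm d) / real (Suc (Suc n))" for n
    have s: "0 < s n" "s n * norm d < e'" for n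
    proof -
      show "0 < s n" using e' by (simp add: s_def add_pos_nonneg)
      have "s n * norm d \<le> e' / (1 + norm d) / 1 * norm d"
        unfolding s_def using e' by (intro mult_right_mono divide_left_mono) auto
      also have "\<dots> < e'" using e' by (simp add: field_simps add_pos_nonneg)
      finally show "s n * norm d < e'" .
    qed
    have s0: "s \<longlonglongrightarrow> 0"
      unfolding s_def by (intro LIMSEQ_Suc[OF LIMSEQ_Suc[OF lim_const_over_n]])
    have AEd: "AE u in lborel. (\<exists>p. GDERIV g' u :> p) \<and> (\<exists>\<nu>. GDERIV (\<lambda>u. infdist u X) u :> \<nu>)"
      using AE_lipschitz_gradient[OF g'(1)] AE_lipschitz_gradient[OF infdist_lipschitz, of X]
      by eventually_elim blast
    have "\<exists>u p \<nu>. GDERIV g' u :> p \<and> GDERIV (\<lambda>u. infdist u X) u :> \<nu> \<and>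
        dist u z \<le> s n * norm d + (s n)\<^sup>2 \<and> w \<bullet> d - s n * K \<le> (p + \<rho> *\<^sub>R \<nu>) \<bullet> d" for n
    proof -
      obtain u G where u: "(\<exists>p. GDERIV g' u :> p) \<and> (\<exists>\<nu>. GDERIV (\<lambda>u. infdist u X) u :> \<nu>)"
        "GDERIV h u :> G" "dist u z \<le> norm (s n *\<^sub>R d) + (s n)\<^sup>2"
        "h (z + s n *\<^sub>R d) - h z - (s n)\<^sup>2 \<le> G \<bullet> (s n *\<^sub>R d)"
        using lipschitz_mean_value[OF h_lip AEd, of "(s n)\<^sup>2" z "s n *\<^sub>R d"] s(1)[of n] by auto
      then obtain p \<nu> where p: "GDERIV g' u :> p" "GDERIV (\<lambda>u. infdist u X) u :> \<nu>" by blast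
      have "GDERIV h u :> p + (\<rho> *\<^sub>R \<nu> + infdist u X *\<^sub>R 0)"
        unfolding h_def[abs_def] by (intro GDERIV_add GDERIV_mult GDERIV_const p)
      then have G: "G = p + \<rho> *\<^sub>R \<nu>" using GDERIV_unique[OF u(2)] by simp
      have "s n * (w \<bullet> d) - (s n)\<^sup>2 * (norm d)\<^sup>2 / (2 * a) - (s n)\<^sup>2 \<le> s n * (G \<bullet> d)"
        using incr[of "s n" d] s[of n] u(4) by simp
      then have "s n * (w \<bullet> d - s n * K) \<le> s n * (G \<bullet> d)"
        by (simp add: K_def power2_eq_square algebra_simps)
      then have "w \<bullet> d - s n * K \<le> (p + \<rho> *\<^sub>R \<nu>) \<bullet> d" using s(1)[of n] G by simp
      with p u(3) s(1)[of n] show ?thesis by auto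
    qed
    then obtain u p \<nu> where u: "\<And>n. GDERIV g' (u n) :> p n" "\<And>n. GDERIV (\<lambda>u. infdist u X) (u n) :> \<nu> n"
        "\<And>n. dist (u n) z \<le> s n * norm d + (s n)\<^sup>2" "\<And>n. w \<bullet> d - s n * K \<le> (p n + \<rho> *\<^sub>R \<nu> n) \<bullet> d"
      by metis
    have uz: "u \<longlonglongrightarrow> z"
    proof -
      have "(\<lambda>n. s n * norm d + (s n)\<^sup>2) \<longlonglongrightarrow> 0 * norm d + 0\<^sup>2"
        by (intro tendsto_intros s0)
      then have "(\<lambda>n. dist (u n) z) \<longlonglongrightarrow> 0"
        using u(3) by (intro Lim_null_comparison[of "\<lambda>n. dist (u n) z" "\<lambda>n. s n * norm d + (s n)\<^sup>2"]) auto
      then show ?thesis by (subst tendsto_dist_iff)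
    qed
    \<comment> \<open>The gradient of the distance at \<open>u n\<close> is a normal at a nearest
      point, not at \<open>u n\<close> itself. These nearest points also tend to z because z lies in
      \<open>X\<close>.\<close>
    have "\<forall>n. \<exists>\<pi>\<in>X. \<nu> n \<in> proximal_normal_cone X \<pi> \<and> norm (\<nu> n) \<le> 1 \<and> dist (u n) \<pi> = infdist (u n) X"
      using infdist_gradient[OF X _ u(2)] zX by blast
    then obtain \<pi> where \<pi>: "\<And>n. \<pi> n \<in> X" "\<And>n. \<nu> n \<in> proximal_normal_cone X (\<pi> n)" "\<And>n. norm (\<nu> n) \<le> 1"
      "\<And>n. dist (u n) (\<pi> n) = infdist (u n) X" by metis
    have \<pi>z: "\<pi> \<longlonglongrightarrow> z"
    proof -
      have "dist (\<pi> n) z \<le> 2 * dist (u n) z" for n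
        using infdist_le[OF zX, of "u n"] \<pi>(4)[of n] dist_triangle[of "\<pi> n" z "u n"] by (simp add: dist_commute)
      moreover have "(\<lambda>n. 2 * dist (u n) z) \<longlonglongrightarrow> 2 * 0" by (intro tendsto_intros iffD1[OF tendsto_dist_iff uz])
      ultimately have "(\<lambda>n. dist (\<pi> n) z) \<longlonglongrightarrow> 0"
        by (intro Lim_null_comparison[of "\<lambda>n. dist (\<pi> n) z" "\<lambda>n. 2 * dist (u n) z"]) auto
      then show ?thesis by (subst tendsto_dist_iff)
    qed
    have pC: "norm (p n) \<le> C" for n
      using GDERIV_norm_le[OF u(1)[of n] lipschitz_on_subset[OF g'(1)], of "u n" 1] by simp
    have "compact (cball (0::'a) C \<times> cball (0::'a) 1)" by (intro compact_Times compact_cball)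
    then obtain l r where l: "l \<in> cball 0 C \<times> cball 0 1" "strict_mono (r :: nat \<Rightarrow> nat)"
      "((\<lambda>n. (p n, \<nu> n)) \<circ> r) \<longlonglongrightarrow> l"
      using pC \<pi>(3) by (auto simp: compact_def dest!: spec[of _ "\<lambda>n. (p n, \<nu> n)"])
    have pl: "(\<lambda>n. p (r n)) \<longlonglongrightarrow> fst l" and \<nu>l: "(\<lambda>n. \<nu> (r n)) \<longlonglongrightarrow> snd l"
      using tendsto_fst[OF l(3)] tendsto_snd[OF l(3)] by (simp_all add: o_def)
    have ur: "(\<lambda>n. u (r n)) \<longlonglongrightarrow> z" and \<pi>r: "(\<lambda>n. \<pi> (r n)) \<longlonglongrightarrow> z" and sr: "(\<lambda>n. s (r n)) \<longlonglongrightarrow> 0"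
      using LIMSEQ_subseq_LIMSEQ[OF uz l(2)] LIMSEQ_subseq_LIMSEQ[OF \<pi>z l(2)] LIMSEQ_subseq_LIMSEQ[OF s0 l(2)]
      by (simp_all add: o_def)
    have "snd l \<in> limset ?RX z"
      unfolding limset_eq mem_Collect_eq
      by (intro exI[of _ "\<lambda>n. \<pi> (r n)"] exI[of _ "\<lambda>n. \<nu> (r n)"]) (use \<pi>r \<nu>l \<pi>(1,2) in simp)
    moreover have "fst l \<in> limset ?Rg z"
    proof -
      \<comment> \<open>Gradients of g' are gradients of \<open>g\<close> only inside the ball, so a
        tail of the sequence is taken.\<close>
      obtain N where N: "\<And>n. n \<ge> N \<Longrightarrow> u (r n) \<in> ball z e"
        using topological_tendstoD[OF ur open_ball[of z e]] e by (auto simp: eventually_sequentially)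
      have "GDERIV g (u (r (n + N))) :> p (r (n + N))" for n
        unfolding gderiv_def
      proof (rule has_derivative_transform_within_open[OF u(1)[unfolded gderiv_def] open_ball])
        show "u (r (n + N)) \<in> ball z e" by (rule N) simp
      qed (rule g'(2))
      moreover have "(\<lambda>n. u (r (n + N))) \<longlonglongrightarrow> z" "(\<lambda>n. p (r (n + N))) \<longlonglongrightarrow> fst l"
        using LIMSEQ_ignore_initial_segment[OF ur] LIMSEQ_ignore_initial_segment[OF pl] by auto
      ultimately show ?thesis unfolding limset_eq mem_Collect_eq
        by (intro exI[of _ "\<lambda>n. u (r (n + N))"] exI[of _ "\<lambda>n. p (r (n + N))"]) simp
    qed
    moreover have "w \<bullet> d \<le> (fst l + \<rho> *\<^sub>R snd l) \<bullet> d"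
    proof -
      have "(\<lambda>n. w \<bullet> d - s (r n) * K) \<longlonglongrightarrow> w \<bullet> d - 0 * K" by (intro tendsto_intros sr)
      moreover have "(\<lambda>n. (p (r n) + \<rho> *\<^sub>R \<nu> (r n)) \<bullet> d) \<longlonglongrightarrow> (fst l + \<rho> *\<^sub>R snd l) \<bullet> d"
        by (intro tendsto_intros pl \<nu>l)
      ultimately have "w \<bullet> d - 0 * K \<le> (fst l + \<rho> *\<^sub>R snd l) \<bullet> d"
        using u(4) by (intro LIMSEQ_le) auto
      then show ?thesis by simp
    qed
    ultimately show ?thesis using l(1) by (intro bexI[of _ "fst l"] bexI[of _ "snd l"]) auto
  qed
  define S where "S = clarke_subdiff g z + (\<lambda>v. \<rho> *\<^sub>R v) ` unit_normals X z"
  have k: "compact ((\<lambda>v. \<rho> *\<^sub>R v) ` unit_normals X z)" by (intro compact_scaling compact_unit_normals)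
  have "S = {a + b | a b. a \<in> clarke_subdiff g z \<and> b \<in> (\<lambda>v. \<rho> *\<^sub>R v) ` unit_normals X z}"
    by (auto simp: S_def set_plus_def)
  then have "compact S" using compact_sums[OF compact_clarke_subdiff[OF loc] k] by simp
  then have clS: "closed S" by (rule compact_imp_closed)
  have cvS: "convex S"
    unfolding S_def by (intro convex_set_plus convex_scaling) (simp_all add: clarke_subdiff_def unit_normals_def)
  have "w \<in> S"
  proof (rule ccontr)
    assume "w \<notin> S"
    then obtain c b where cb: "c \<bullet> w < b" "\<And>v. v \<in> S \<Longrightarrow> b < c \<bullet> v"
      using separating_hyperplane_closed_point[OF cvS clS] by blast
    \<comment> \<open>The direction opposite to the separating normal: \<open>dir\<close> then
      produces an element of \<open>S\<close> on the same side as w.\<close>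
    obtain p \<nu> where p: "p \<in> limset ?Rg z" "\<nu> \<in> limset ?RX z \<inter> cball 0 1" "w \<bullet> (- c) \<le> (p + \<rho> *\<^sub>R \<nu>) \<bullet> (- c)"
      using dir[of "- c"] by blast
    have "p + \<rho> *\<^sub>R \<nu> \<in> S"
      unfolding S_def clarke_subdiff_eq unit_normals_def limiting_normal_cone_eq
      using p(1,2) by (intro set_plus_intro imageI hull_inc) auto
    with cb(2) have "b < c \<bullet> (p + \<rho> *\<^sub>R \<nu>)" by blast
    moreover have "c \<bullet> (p + \<rho> *\<^sub>R \<nu>) \<le> c \<bullet> w" using p(3) by (simp add: inner_commute)
    ultimately show False using cb(1) by linarith
  qed
  then show ?thesis
    unfolding S_def by (auto elim!: set_plus_elim simp: w_def \<rho>_def intro: that)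
qed

section \<open>Convergence of the noise\<close>

context prob_space
begin

lemma square_integrable_mult:
  fixes f g :: "'a \<Rightarrow> real"
  assumes [measurable]: "f \<in> borel_measurable M" "g \<in> borel_measurable M"
    and "integrable M (\<lambda>s. (f s)\<^sup>2)" "integrable M (\<lambda>s. (g s)\<^sup>2)"
  shows "integrable M (\<lambda>s. f s * g s)"
proof (rule Bochner_Integration.integrable_bound)
  show "integrable M (\<lambda>s. (f s)\<^sup>2 + (g s)\<^sup>2)" using assms(3,4) by simp
  show "AE s in M. norm (f s * g s) \<le> norm ((f s)\<^sup>2 + (g s)\<^sup>2)"
  proof (intro AE_I2)
    fix s
    have "0 \<le> (\<bar>f s\<bar> - \<bar>g s\<bar>)\<^sup>2" "0 \<le> \<bar>f s\<bar> * \<bar>g s\<bar>" by auto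
    then have "\<bar>f s\<bar> * \<bar>g s\<bar> \<le> (f s)\<^sup>2 + (g s)\<^sup>2"
      unfolding power2_diff power2_abs by linarith
    then show "norm (f s * g s) \<le> norm ((f s)\<^sup>2 + (g s)\<^sup>2)"
      by (simp add: abs_mult)
  qed
qed measurable

text \<open>The partial sums stopped on leaving \<open>(-e, e)\<close> are again a martingale, and at time \<open>n\<close> they are still
  outside if the original ones ever were.\<close>

lemma martingale_maximal_inequality:
  fixes D :: "nat \<Rightarrow> 'a \<Rightarrow> real" and F :: "nat \<Rightarrow> 'a measure"
  assumes F: "\<And>n. subalgebra M (F n)" "\<And>n. subalgebra (F (Suc n)) (F n)"
    and D: "\<And>n. D n \<in> borel_measurable (F (Suc n))" "\<And>n. integrable M (\<lambda>s. (D n s)\<^sup>2)"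
    and orth: "\<And>n u. u \<in> borel_measurable (F n) \<Longrightarrow> integrable M (\<lambda>s. u s * D n s) \<Longrightarrow>
      (\<integral>s. u s * D n s \<partial>M) = 0"
    and e: "0 < e"
  shows "prob {s \<in> space M. \<exists>j\<le>n. e \<le> \<bar>\<Sum>k<j. D k s\<bar>} \<le> (\<Sum>k<n. \<integral>s. (D k s)\<^sup>2 \<partial>M) / e\<^sup>2"
proof -
  have F_le: "subalgebra (F n) (F m)" if "m \<le> n" for m n
    using that
  proof (induction rule: dec_induct)
    case base show ?case by (simp add: subalgebra_def)
  next
    case (step n) then show ?case using F(2)[of n] by (auto simp: subalgebra_def)
  qed
  define S where "S j s = (\<Sum>k<j. D k s)" for j s
  \<comment> \<open>The indicator that no partial sum up to n has left the interval. It is known at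
    time n, so multiplying the next difference by it preserves orthogonality, and the second moments
    of the stopped sums add up.\<close>
  define U where "U n s = (if \<forall>i\<in>{..n}. \<bar>S i s\<bar> < e then 1 else 0 :: real)" for n s
  define V where "V n s = (\<Sum>k<n. U k s * D k s)" for n s
  have DF: "D k \<in> borel_measurable (F n)" if "k < n" for k n
    using measurable_from_subalg[OF F_le[of "Suc k" n] D(1)] that by simp
  have SF: "S j \<in> borel_measurable (F n)" if "j \<le> n" for j n
    unfolding S_def using that by (intro borel_measurable_sum DF) auto
  have UF: "U k \<in> borel_measurable (F n)" if "k \<le> n" for k n
  proof -
    have "{s \<in> space (F n). \<bar>S i s\<bar> < e} \<in> sets (F n)" if "i \<le> k" for i
    proof -
      have [measurable]: "S i \<in> borel_measurable (F n)" using that \<open>k \<le> n\<close> by (intro SF) simp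
      show ?thesis by measurable
    qed
    then have "{s \<in> space (F n). \<forall>i\<in>{..k}. \<bar>S i s\<bar> < e} \<in> sets (F n)"
      by (intro sets.sets_Collect_finite_All') auto
    then show ?thesis
      unfolding U_def
      by (rule measurable_If[OF borel_measurable_const borel_measurable_const])
  qed
  have VF: "V n \<in> borel_measurable (F n)" for n
    unfolding V_def by (intro borel_measurable_sum borel_measurable_times UF DF) auto
  have toM: "f \<in> borel_measurable M" if "f \<in> borel_measurable (F n)" for f :: "'a \<Rightarrow> real" and n
    using measurable_from_subalg[OF F(1) that] .
  have UD: "integrable M (\<lambda>s. (U n s * D n s)\<^sup>2)" "(\<integral>s. (U n s * D n s)\<^sup>2 \<partial>M) \<le> (\<integral>s. (D n s)\<^sup>2 \<partial>M)" for n
  proof -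
    have le: "(U n s * D n s)\<^sup>2 \<le> (D n s)\<^sup>2" for s by (auto simp: U_def)
    show "integrable M (\<lambda>s. (U n s * D n s)\<^sup>2)"
      by (rule Bochner_Integration.integrable_bound[OF D(2)[of n]])
        (use toM[OF UF[of n n]] toM[OF DF[of n "Suc n"]] le in auto)
    then show "(\<integral>s. (U n s * D n s)\<^sup>2 \<partial>M) \<le> (\<integral>s. (D n s)\<^sup>2 \<partial>M)"
      using D(2) le by (intro integral_mono) auto
  qed
  have V: "integrable M (\<lambda>s. (V n s)\<^sup>2) \<and> (\<integral>s. (V n s)\<^sup>2 \<partial>M) \<le> (\<Sum>k<n. \<integral>s. (D k s)\<^sup>2 \<partial>M)" for n
  proof (induction n)
    case 0 show ?case by (simp add: V_def)
  next
    case (Suc n)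
    have meas: "V n \<in> borel_measurable M" "U n \<in> borel_measurable M" "D n \<in> borel_measurable M"
      using toM VF UF DF lessI order_refl by blast+
    have i2: "integrable M (\<lambda>s. V n s * (U n s * D n s))"
      using Suc UD(1) meas by (intro square_integrable_mult) auto
    have "(\<integral>s. (V n s * U n s) * D n s \<partial>M) = 0"
      using i2 VF UF[of n n] by (intro orth) (auto simp: mult.assoc)
    then have z: "(\<integral>s. V n s * (U n s * D n s) \<partial>M) = 0" by (simp add: mult.assoc)
    have eq: "(V (Suc n) s)\<^sup>2 = (V n s)\<^sup>2 + (2 * (V n s * (U n s * D n s)) + (U n s * D n s)\<^sup>2)" for s
      by (simp add: V_def power2_sum)
    have i3: "integrable M (\<lambda>s. 2 * (V n s * (U n s * D n s)))" using i2 by simp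
    have "integrable M (\<lambda>s. (V (Suc n) s)\<^sup>2)"
      unfolding eq using Suc i3 UD(1) by (intro Bochner_Integration.integrable_add) auto
    moreover have "(\<integral>s. (V (Suc n) s)\<^sup>2 \<partial>M) = (\<integral>s. (V n s)\<^sup>2 \<partial>M) + (\<integral>s. (U n s * D n s)\<^sup>2 \<partial>M)"
      unfolding eq using Suc i3 UD(1) z
      by (simp add: Bochner_Integration.integral_add Bochner_Integration.integrable_add del: power_mult_distrib)
    ultimately show ?case using Suc UD(2)[of n] by simp
  qed
  have sub: "e \<le> \<bar>V n s\<bar>" if "\<exists>j\<le>n. e \<le> \<bar>S j s\<bar>" for s
  proof -
    define j where "j = (LEAST j. e \<le> \<bar>S j s\<bar>)"
    have j: "e \<le> \<bar>S j s\<bar>" "j \<le> n" "\<And>i. i < j \<Longrightarrow> \<bar>S i s\<bar> < e"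
    proof -
      show "e \<le> \<bar>S j s\<bar>" unfolding j_def using that by (metis LeastI)
      show "j \<le> n" unfolding j_def using that by (metis Least_le order_trans)
      show "\<And>i. i < j \<Longrightarrow> \<bar>S i s\<bar> < e" unfolding j_def using not_less_Least not_le by blast
    qed
    have "V n s = (\<Sum>k<n. if k < j then D k s else 0)"
      unfolding V_def
    proof (rule sum.cong)
      fix k
      show "U k s * D k s = (if k < j then D k s else 0)"
      proof (cases "k < j")
        case True then show ?thesis using j(3) by (simp add: U_def)
      next
        case False
        then have "\<not> (\<forall>i\<in>{..k}. \<bar>S i s\<bar> < e)" using j(1) by (auto simp: not_less intro!: exI[of _ j])
        then have "U k s = 0" unfolding U_def by (rule if_not_P)
        then show ?thesis using False by simp
      qed
    qed simp
    also have "\<dots> = (\<Sum>k\<in>{..<n} \<inter> {k. k < j}. D k s)" by (simp add: sum.If_cases)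
    also have "{..<n} \<inter> {k. k < j} = {..<j}" using j(2) by auto
    finally show ?thesis using j(1) by (simp add: S_def)
  qed
  have mV: "V n \<in> borel_measurable M" by (rule toM[OF VF])
  have "prob {s \<in> space M. \<exists>j\<le>n. e \<le> \<bar>\<Sum>k<j. D k s\<bar>} \<le> prob {s \<in> space M. e\<^sup>2 \<le> (V n s)\<^sup>2}"
  proof (rule finite_measure_mono)
    show "{s \<in> space M. \<exists>j\<le>n. e \<le> \<bar>\<Sum>k<j. D k s\<bar>} \<subseteq> {s \<in> space M. e\<^sup>2 \<le> (V n s)\<^sup>2}"
      using sub e by (auto simp: S_def abs_le_square_iff[symmetric])
    show "{s \<in> space M. e\<^sup>2 \<le> (V n s)\<^sup>2} \<in> events" using mV by measurable
  qed
  also have "\<dots> \<le> (\<integral>s. (V n s)\<^sup>2 \<partial>M) / e\<^sup>2"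
    using V e by (intro integral_Markov_inequality_measure[where A = "space M - {}"]) auto
  also have "\<dots> \<le> (\<Sum>k<n. \<integral>s. (D k s)\<^sup>2 \<partial>M) / e\<^sup>2"
    using V by (intro divide_right_mono) auto
  finally show ?thesis .
qed

text \<open>The maximal inequality from time m on bounds the probability that the partial sums ever
  move by e after m by a tail of the variances. The tails tend to 0, so almost surely the sums are
  Cauchy. \<open>orth\<close> expresses the martingale property without conditional
  expectations.\<close>

lemma martingale_AE_convergent:
  fixes D :: "nat \<Rightarrow> 'a \<Rightarrow> real" and F :: "nat \<Rightarrow> 'a measure"
  assumes F: "\<And>n. subalgebra M (F n)" "\<And>n. subalgebra (F (Suc n)) (F n)"
    and D: "\<And>n. D n \<in> borel_measurable (F (Suc n))" "\<And>n. integrable M (\<lambda>s. (D n s)\<^sup>2)"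
    and orth: "\<And>n u. u \<in> borel_measurable (F n) \<Longrightarrow> integrable M (\<lambda>s. u s * D n s) \<Longrightarrow>
      (\<integral>s. u s * D n s \<partial>M) = 0"
    and sum: "summable (\<lambda>n. \<integral>s. (D n s)\<^sup>2 \<partial>M)"
  shows "AE s in M. summable (\<lambda>n. D n s)"
proof -
  define S where "S n s = (\<Sum>k<n. D k s)" for n s
  define a where "a n = (\<integral>s. (D n s)\<^sup>2 \<partial>M)" for n
  have DM[measurable]: "D n \<in> borel_measurable M" for n by (rule measurable_from_subalg[OF F(1) D(1)])
  have SM[measurable]: "S n \<in> borel_measurable M" for n unfolding S_def by measurable
  have a0: "0 \<le> a n" for n by (simp add: a_def)
  define t where "t m = (\<Sum>n. a (n + m))" for m
  have t0: "t \<longlonglongrightarrow> 0"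
    using suminf_exist_split2[of a] sum unfolding t_def a_def by simp
  define B where "B e m = {s \<in> space M. \<exists>j. e \<le> \<bar>S (m + j) s - S m s\<bar>}" for e m
  have B_sets: "B e m \<in> events" for e m unfolding B_def by measurable
  have B_prob: "prob (B e m) \<le> t m / e\<^sup>2" if e: "0 < e" for e m
  proof -
    define C where "C n = {s \<in> space M. \<exists>j\<le>n. e \<le> \<bar>\<Sum>k<j. D (m + k) s\<bar>}" for n
    have C_sets: "range C \<subseteq> events" unfolding C_def by auto
    have shift: "(\<Sum>k<j. D (m + k) s) = S (m + j) s - S m s" for j s
      unfolding S_def by (induction j) auto
    have "(\<Union>n. C n) = B e m" unfolding C_def B_def shift by auto
    moreover have "incseq C" unfolding C_def incseq_def by (auto intro: order_trans)
    ultimately have lim: "(\<lambda>n. prob (C n)) \<longlonglongrightarrow> prob (B e m)"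
      using finite_Lim_measure_incseq[OF C_sets] by simp
    have "prob (C n) \<le> t m / e\<^sup>2" for n
    proof -
      have "prob (C n) \<le> (\<Sum>k<n. \<integral>s. (D (m + k) s)\<^sup>2 \<partial>M) / e\<^sup>2"
        unfolding C_def
        using F D orth e by (intro martingale_maximal_inequality[where F = "\<lambda>k. F (m + k)"]) auto
      also have "\<dots> \<le> t m / e\<^sup>2"
      proof (rule divide_right_mono)
        have "summable (\<lambda>n. a (n + m))" using sum unfolding a_def by (rule summable_ignore_initial_segment)
        then have "(\<Sum>k<n. a (k + m)) \<le> t m"
          unfolding t_def using a0 by (intro sum_le_suminf) auto
        then show "(\<Sum>k<n. \<integral>s. (D (m + k) s)\<^sup>2 \<partial>M) \<le> t m" by (simp add: a_def add.commute)
      qed simp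
      finally show ?thesis .
    qed
    then show ?thesis by (intro LIMSEQ_le_const2[OF lim]) auto
  qed
  have "AE s in M. s \<notin> (\<Inter>m. B e m)" if e: "0 < e" for e
  proof (rule AE_not_in)
    have "prob (\<Inter>m. B e m) \<le> t m / e\<^sup>2" for m
      using order_trans[OF finite_measure_mono[OF _ B_sets] B_prob[OF e], of "\<Inter>m. B e m" m] by auto
    moreover have "(\<lambda>m. t m / e\<^sup>2) \<longlonglongrightarrow> 0 / e\<^sup>2" using e by (intro tendsto_intros t0) auto
    ultimately have "prob (\<Inter>m. B e m) \<le> 0 / e\<^sup>2" by (intro LIMSEQ_le_const) auto
    then have "prob (\<Inter>m. B e m) = 0" by (simp add: measure_le_0_iff)
    then show "(\<Inter>m. B e m) \<in> null_sets M" using B_sets by (auto simp: null_sets_def emeasure_eq_measure)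
  qed
  then have "AE s in M. \<forall>i. s \<notin> (\<Inter>m. B (1 / real (Suc i)) m)"
    by (simp add: AE_all_countable)
  with AE_space show ?thesis
  proof eventually_elim
    fix s assume s: "s \<in> space M" "\<forall>i. s \<notin> (\<Inter>m. B (1 / real (Suc i)) m)"
    have "Cauchy (\<lambda>n. S n s)"
    proof (rule metric_CauchyI)
      fix e :: real assume "0 < e"
      then obtain i where i: "1 / real (Suc i) < e / 2" by (meson half_gt_zero nat_approx_posE)
      obtain m where m: "s \<notin> B (1 / real (Suc i)) m" using s(2) by blast
      have near: "\<bar>S n s - S m s\<bar> < e / 2" if n: "n \<ge> m" for n
      proof -
        have "\<bar>S (m + (n - m)) s - S m s\<bar> < 1 / real (Suc i)" using m s(1) by (auto simp: B_def not_le)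
        then show ?thesis using i n by simp
      qed
      show "\<exists>M. \<forall>m\<ge>M. \<forall>n\<ge>M. dist (S m s) (S n s) < e"
      proof (intro exI[of _ m] allI impI)
        fix n n' assume "n \<ge> m" "n' \<ge> m"
        then show "dist (S n s) (S n' s) < e"
          using near[of n] near[of n'] by (simp add: dist_real_def abs_if split: if_splits)
      qed
    qed
    then show "summable (\<lambda>n. D n s)"
      by (simp add: summable_iff_convergent S_def Cauchy_convergent_iff)
  qed
qed

text \<open>Independence makes the joint law of (u, Y) and W a product measure, and both identities
  follow by integrating W out first with the past frozen. Bundling \<open>u\<close> with
  \<open>Y\<close> into one vector replaces the usual conditioning.\<close>

lemma indep_orthogonal:
  fixes H :: "'b::euclidean_space \<Rightarrow> 'w \<Rightarrow> real" and u :: "'a \<Rightarrow> real"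
  assumes P: "prob_space P" and F: "subalgebra M F" and W[measurable]: "W \<in> measurable M P" and distr: "distr M P W = P"
    and indep: "indep_set (sets F) (sets (vimage_algebra (space M) W P))"
    and Y: "Y \<in> borel_measurable F"
    and H[measurable]: "(\<lambda>(y, w). H y w) \<in> borel_measurable (borel \<Otimes>\<^sub>M P)"
    and H0: "\<And>y. (\<integral>w. H y w \<partial>P) = 0"
    and u: "u \<in> borel_measurable F" and int: "integrable M (\<lambda>s. u s * H (Y s) (W s))"
  shows "(\<integral>s. u s * H (Y s) (W s) \<partial>M) = 0"
    and "(\<integral>\<^sup>+s. ennreal ((H (Y s) (W s))\<^sup>2) \<partial>M) = (\<integral>\<^sup>+s. (\<integral>\<^sup>+w. ennreal ((H (Y s) w)\<^sup>2) \<partial>P) \<partial>M)"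
proof -
  interpret P: prob_space P by (rule P)
  define V where "V s = (u s, Y s)" for s
  have VF: "V \<in> measurable F (borel \<Otimes>\<^sub>M borel)" unfolding V_def using u Y by measurable
  have VM[measurable]: "V \<in> measurable M (borel \<Otimes>\<^sub>M borel)" by (rule measurable_from_subalg[OF F VF])
  have spF: "space F = space M" using F by (simp add: subalgebra_def)
  define N where "N = distr M (borel \<Otimes>\<^sub>M borel) V"
  interpret N: prob_space N unfolding N_def by (rule prob_space_distr) simp
  interpret NP: pair_prob_space N P ..
  have setsN[measurable_cong]: "sets N = sets (borel \<Otimes>\<^sub>M borel)" by (simp add: N_def)
  have VW[measurable]: "(\<lambda>s. (V s, W s)) \<in> measurable M ((borel \<Otimes>\<^sub>M borel) \<Otimes>\<^sub>M P)" by measurable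
  have eq: "N \<Otimes>\<^sub>M P = distr M ((borel \<Otimes>\<^sub>M borel) \<Otimes>\<^sub>M P) (\<lambda>s. (V s, W s))"
  proof (rule pair_measure_eqI)
    show "sigma_finite_measure N" "sigma_finite_measure P" by unfold_locales
    show "sets (N \<Otimes>\<^sub>M P) = sets (distr M ((borel \<Otimes>\<^sub>M borel) \<Otimes>\<^sub>M P) (\<lambda>s. (V s, W s)))"
      unfolding sets_distr by (rule sets_pair_measure_cong[OF setsN refl])
    fix A B assume "A \<in> sets N" and B: "B \<in> sets P"
    then have A: "A \<in> sets (borel \<Otimes>\<^sub>M borel)" by (simp only: setsN)
    have VA: "V -` A \<inter> space M \<in> sets F" using measurable_sets[OF VF A] unfolding spF .
    have WB: "W -` B \<inter> space M \<in> sets (vimage_algebra (space M) W P)" by (rule in_vimage_algebra[OF B])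
    have "emeasure P B = prob (W -` B \<inter> space M)"
      using emeasure_distr[OF W B] unfolding distr by (simp add: emeasure_eq_measure)
    moreover have "emeasure N A = prob (V -` A \<inter> space M)"
      unfolding N_def emeasure_distr[OF VM A] by (rule emeasure_eq_measure)
    moreover have "emeasure (distr M ((borel \<Otimes>\<^sub>M borel) \<Otimes>\<^sub>M P) (\<lambda>s. (V s, W s))) (A \<times> B) =
        prob ((V -` A \<inter> space M) \<inter> (W -` B \<inter> space M))"
      unfolding emeasure_distr[OF VW pair_measureI[OF A B]] emeasure_eq_measure[symmetric]
      by (intro arg_cong[where f = "emeasure M"]) auto
    moreover have "prob ((V -` A \<inter> space M) \<inter> (W -` B \<inter> space M)) =
        prob (V -` A \<inter> space M) * prob (W -` B \<inter> space M)"
      using indep VA WB unfolding indep_sets2_eq by blast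
    ultimately show "emeasure N A * emeasure P B =
        emeasure (distr M ((borel \<Otimes>\<^sub>M borel) \<Otimes>\<^sub>M P) (\<lambda>s. (V s, W s))) (A \<times> B)"
      by (simp add: ennreal_mult')
  qed
  define \<Phi> where "\<Phi> p = fst (fst p) * (case (snd (fst p), snd p) of (y, w) \<Rightarrow> H y w)" for p :: "(real \<times> 'b) \<times> 'w"
  have \<Phi>m[measurable]: "\<Phi> \<in> borel_measurable ((borel \<Otimes>\<^sub>M borel) \<Otimes>\<^sub>M P)"
    unfolding \<Phi>_def[abs_def] by measurable
  have \<Phi>: "\<Phi> (V s, W s) = u s * H (Y s) (W s)" for s by (simp add: \<Phi>_def V_def)
  have "integrable (N \<Otimes>\<^sub>M P) \<Phi>"
    unfolding eq by (subst integrable_distr_eq[OF VW \<Phi>m]) (simp add: \<Phi> int)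
  then have "(\<integral>v. (\<integral>w. \<Phi> (v, w) \<partial>P) \<partial>N) = (\<integral>p. \<Phi> p \<partial>(N \<Otimes>\<^sub>M P))"
    by (rule NP.integral_fst')
  moreover have "(\<integral>w. \<Phi> (v, w) \<partial>P) = 0" for v by (simp add: \<Phi>_def H0)
  ultimately have "(\<integral>p. \<Phi> p \<partial>(N \<Otimes>\<^sub>M P)) = 0" by simp
  then show "(\<integral>s. u s * H (Y s) (W s) \<partial>M) = 0"
    unfolding eq by (subst (asm) integral_distr[OF VW \<Phi>m]) (simp add: \<Phi>)
  define \<Psi> where "\<Psi> p = ennreal ((case (snd (fst p), snd p) of (y, w) \<Rightarrow> H y w)\<^sup>2)" for p :: "(real \<times> 'b) \<times> 'w"
  have \<Psi>m[measurable]: "\<Psi> \<in> borel_measurable ((borel \<Otimes>\<^sub>M borel) \<Otimes>\<^sub>M P)"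
    unfolding \<Psi>_def[abs_def] by measurable
  have \<Psi>m': "\<Psi> \<in> borel_measurable (N \<Otimes>\<^sub>M P)"
    using \<Psi>m by (simp add: measurable_cong_sets[OF sets_pair_measure_cong[OF setsN refl] refl])
  have "(\<integral>\<^sup>+s. ennreal ((H (Y s) (W s))\<^sup>2) \<partial>M) = (\<integral>\<^sup>+s. \<Psi> (V s, W s) \<partial>M)"
    by (simp add: \<Psi>_def V_def)
  also have "\<dots> = (\<integral>\<^sup>+p. \<Psi> p \<partial>(N \<Otimes>\<^sub>M P))"
    unfolding eq by (subst nn_integral_distr[OF VW]) (use \<Psi>m in simp_all)
  also have "\<dots> = (\<integral>\<^sup>+v. (\<integral>\<^sup>+w. \<Psi> (v, w) \<partial>P) \<partial>N)"
    by (rule P.nn_integral_fst[OF \<Psi>m', symmetric])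
  also have "\<dots> = (\<integral>\<^sup>+s. (\<integral>\<^sup>+w. \<Psi> (V s, w) \<partial>P) \<partial>M)"
    unfolding N_def by (rule nn_integral_distr) measurable
  finally show "(\<integral>\<^sup>+s. ennreal ((H (Y s) (W s))\<^sup>2) \<partial>M) = (\<integral>\<^sup>+s. (\<integral>\<^sup>+w. ennreal ((H (Y s) w)\<^sup>2) \<partial>P) \<partial>M)"
    by (simp add: \<Psi>_def V_def)
qed

end

text \<open>Rectangles over the start and the vector of the first n samples form an
  intersection-stable generator, so independence from the next sample need only be checked on
  them.\<close>

definition past_rectangles ::
  "'m measure \<Rightarrow> 'w measure \<Rightarrow> ('m \<Rightarrow> 'b::topological_space) \<Rightarrow> (nat \<Rightarrow> 'm \<Rightarrow> 'w) \<Rightarrow> nat \<Rightarrow> 'm set set" where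
  "past_rectangles M P x0 \<omega> n = {x0 -` A \<inter> (\<lambda>s. restrict (\<lambda>k. \<omega> k s) {..<n}) -` B \<inter> space M | A B.
     A \<in> sets borel \<and> B \<in> sets (PiM {..<n} (\<lambda>_. P))}"

definition past :: "'m measure \<Rightarrow> 'w measure \<Rightarrow> ('m \<Rightarrow> 'b::topological_space) \<Rightarrow> (nat \<Rightarrow> 'm \<Rightarrow> 'w) \<Rightarrow> nat \<Rightarrow> 'm measure" where
  "past M P x0 \<omega> n = sigma (space M) (past_rectangles M P x0 \<omega> n)"

context prob_space
begin

context
  fixes P :: "'w measure" and x0 :: "'a \<Rightarrow> 'b::euclidean_space" and \<omega> :: "nat \<Rightarrow> 'a \<Rightarrow> 'w"
  assumes \<omega>_meas: "\<And>k. \<omega> k \<in> measurable M P" and x0_meas: "x0 \<in> borel_measurable M"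
begin

lemma past_rectangles_Pow: "past_rectangles M P x0 \<omega> n \<subseteq> Pow (space M)"
  by (auto simp: past_rectangles_def)

lemma space_past: "space (past M P x0 \<omega> n) = space M"
  unfolding past_def by (rule space_measure_of[OF past_rectangles_Pow])

lemma sets_past: "sets (past M P x0 \<omega> n) = sigma_sets (space M) (past_rectangles M P x0 \<omega> n)"
  unfolding past_def by (rule sets_measure_of[OF past_rectangles_Pow])

lemma measurable_restrict_\<omega>:
  assumes "\<And>k. k < n \<Longrightarrow> \<omega> k \<in> measurable N P"
  shows "(\<lambda>s. restrict (\<lambda>k. \<omega> k s) {..<n}) \<in> measurable N (PiM {..<n} (\<lambda>_. P))"
  using assms by (intro measurable_restrict) auto

text \<open>Minimality of the past among the sigma-algebras on the same space for which the start
  and the first n samples are measurable. Both its inclusion in \<open>M\<close> and its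
  monotonicity in n are instances.\<close>

lemma past_le:
  assumes sp: "space N = space M" and x0: "x0 \<in> borel_measurable N" and \<omega>: "\<And>k. k < n \<Longrightarrow> \<omega> k \<in> measurable N P"
  shows "subalgebra N (past M P x0 \<omega> n)"
proof -
  have "past_rectangles M P x0 \<omega> n \<subseteq> sets N"
  proof
    fix E assume "E \<in> past_rectangles M P x0 \<omega> n"
    then obtain A B where E: "E = x0 -` A \<inter> (\<lambda>s. restrict (\<lambda>k. \<omega> k s) {..<n}) -` B \<inter> space M"
      and A: "A \<in> sets borel" and B: "B \<in> sets (PiM {..<n} (\<lambda>_. P))"
      by (auto simp: past_rectangles_def)
    have "E = (x0 -` A \<inter> space N) \<inter> ((\<lambda>s. restrict (\<lambda>k. \<omega> k s) {..<n}) -` B \<inter> space N)"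
      by (auto simp: E sp)
    also have "\<dots> \<in> sets N"
      by (rule sets.Int[OF measurable_sets[OF x0 A] measurable_sets[OF measurable_restrict_\<omega>[OF \<omega>] B]])
    finally show "E \<in> sets N" .
  qed
  then have "sigma_sets (space M) (past_rectangles M P x0 \<omega> n) \<subseteq> sets N"
    unfolding sp[symmetric] by (rule sets.sigma_sets_subset)
  then show ?thesis by (simp add: subalgebra_def space_past sets_past sp)
qed

lemma subalgebra_past: "subalgebra M (past M P x0 \<omega> n)"
  by (rule past_le) (simp_all add: x0_meas \<omega>_meas)

lemma past_rectangles_in_past:
  "A \<in> sets borel \<Longrightarrow> B \<in> sets (PiM {..<n} (\<lambda>_. P)) \<Longrightarrow>
    x0 -` A \<inter> (\<lambda>s. restrict (\<lambda>k. \<omega> k s) {..<n}) -` B \<inter> space M \<in> sets (past M P x0 \<omega> n)"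
  unfolding sets_past past_rectangles_def by (rule sigma_sets.Basic) blast

lemma x0_past: "x0 \<in> borel_measurable (past M P x0 \<omega> n)"
proof (rule measurableI)
  fix A :: "'b set" assume A: "A \<in> sets borel"
  have "(\<lambda>s. restrict (\<lambda>k. \<omega> k s) {..<n}) s \<in> space (PiM {..<n} (\<lambda>_. P))" if "s \<in> space M" for s
    using measurable_space[OF measurable_restrict_\<omega>[of n M, OF \<omega>_meas] that] .
  then have "x0 -` A \<inter> space (past M P x0 \<omega> n) =
      x0 -` A \<inter> (\<lambda>s. restrict (\<lambda>k. \<omega> k s) {..<n}) -` space (PiM {..<n} (\<lambda>_. P)) \<inter> space M"
    by (auto simp: space_past)
  then show "x0 -` A \<inter> space (past M P x0 \<omega> n) \<in> sets (past M P x0 \<omega> n)"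
    using past_rectangles_in_past[OF A sets.top] by simp
qed simp

lemma \<omega>_past:
  assumes k: "k < n"
  shows "\<omega> k \<in> measurable (past M P x0 \<omega> n) P"
proof (rule measurableI)
  fix s assume "s \<in> space (past M P x0 \<omega> n)"
  then show "\<omega> k s \<in> space P" using measurable_space[OF \<omega>_meas] by (simp add: space_past)
next
  fix C assume C: "C \<in> sets P"
  let ?B = "(\<lambda>f. f k) -` C \<inter> space (PiM {..<n} (\<lambda>_. P))"
  have B: "?B \<in> sets (PiM {..<n} (\<lambda>_. P))"
    by (rule measurable_sets[OF measurable_component_singleton[where M = "\<lambda>_. P"] C]) (use k in simp)
  have "(\<lambda>s. restrict (\<lambda>k. \<omega> k s) {..<n}) s \<in> space (PiM {..<n} (\<lambda>_. P))" if "s \<in> space M" for s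
    using measurable_space[OF measurable_restrict_\<omega>[of n M, OF \<omega>_meas] that] .
  then have "\<omega> k -` C \<inter> space (past M P x0 \<omega> n) =
      x0 -` UNIV \<inter> (\<lambda>s. restrict (\<lambda>k. \<omega> k s) {..<n}) -` ?B \<inter> space M"
    using k by (auto simp: space_past)
  also have "\<dots> \<in> sets (past M P x0 \<omega> n)"
    by (rule past_rectangles_in_past[OF _ B]) (metis space_borel sets.top)
  finally show "\<omega> k -` C \<inter> space (past M P x0 \<omega> n) \<in> sets (past M P x0 \<omega> n)" .
qed

lemma past_mono: "subalgebra (past M P x0 \<omega> (Suc n)) (past M P x0 \<omega> n)"
  by (rule past_le) (simp_all add: space_past x0_past \<omega>_past)

text \<open>On a rectangle, independence of the start from the entire sample sequence splits off
  \<open>x0\<close>, both with and without the event of sample n. Independence of the samples then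
  separates sample n from the earlier ones.\<close>

lemma indep_past:
  assumes \<omega>_indep: "indep_vars (\<lambda>_. P) \<omega> UNIV"
    and x0_indep: "indep_set (sets (vimage_algebra (space M) x0 borel))
      (sets (vimage_algebra (space M) (\<lambda>s k. \<omega> k s) (PiM UNIV (\<lambda>_. P))))"
  shows "indep_set (sets (past M P x0 \<omega> n)) (sets (vimage_algebra (space M) (\<omega> n) P))"
proof -
  let ?V = "vimage_algebra (space M) (\<omega> n) P" and ?W = "\<lambda>s. restrict (\<lambda>k. \<omega> k s) {..<n}"
  have Vsets: "sets ?V = {\<omega> n -` C \<inter> space M | C. C \<in> sets P}"
    using measurable_space[OF \<omega>_meas] by (intro sets_vimage_algebra2) auto
  have Vev: "sets ?V \<subseteq> events"
    unfolding Vsets using measurable_sets[OF \<omega>_meas] by auto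
  have ind: "indep_var (PiM {..<n} (\<lambda>_. P)) ?W (PiM {n} (\<lambda>_. P)) (\<lambda>s. restrict (\<lambda>k. \<omega> k s) {n})"
    by (rule indep_var_restrict[OF \<omega>_indep]) auto
  have indep: "indep_set (past_rectangles M P x0 \<omega> n) (sets ?V)"
    unfolding indep_sets2_eq
  proof (intro conjI ballI Vev)
    show ev: "past_rectangles M P x0 \<omega> n \<subseteq> events"
      using subalgebra_past[of n] unfolding subalgebra_def sets_past by (auto intro: sigma_sets.Basic)
    fix E G assume "E \<in> past_rectangles M P x0 \<omega> n" and "G \<in> sets ?V"
    then obtain A B C where E: "E = x0 -` A \<inter> ?W -` B \<inter> space M"
      and A: "A \<in> sets borel" and B: "B \<in> sets (PiM {..<n} (\<lambda>_. P))"
      and G: "G = \<omega> n -` C \<inter> space M" and C: "C \<in> sets P"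
      unfolding Vsets by (auto simp: past_rectangles_def)
    let ?a = "x0 -` A \<inter> space M" and ?b = "?W -` B \<inter> space M"
    define \<Omega> where "\<Omega> = (PiM UNIV (\<lambda>_. P) :: (nat \<Rightarrow> 'w) measure)"
    have \<omega>\<Omega>: "(\<lambda>k. \<omega> k s) \<in> space \<Omega>" if "s \<in> space M" for s
      using measurable_space[OF \<omega>_meas that] by (simp add: \<Omega>_def space_PiM PiE_iff)
    have va: "?a \<in> sets (vimage_algebra (space M) x0 borel)" by (rule in_vimage_algebra[OF A])
    have in_past: "(\<lambda>s k. \<omega> k s) -` K \<inter> space M \<in> sets (vimage_algebra (space M) (\<lambda>s k. \<omega> k s) \<Omega>)"
      if "K \<in> sets \<Omega>" for K
      by (rule in_vimage_algebra[OF that])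
    let ?KB = "(\<lambda>f. restrict f {..<n}) -` B \<inter> space \<Omega>" and ?KC = "(\<lambda>f. f n) -` C \<inter> space \<Omega>"
    have KB: "?KB \<in> sets \<Omega>"
      unfolding \<Omega>_def by (rule measurable_sets[OF measurable_restrict_subset B]) simp
    have KC: "?KC \<in> sets \<Omega>"
      unfolding \<Omega>_def by (rule measurable_sets[OF measurable_component_singleton[where M = "\<lambda>_. P"] C]) simp
    have bK: "?b = (\<lambda>s k. \<omega> k s) -` ?KB \<inter> space M" using \<omega>\<Omega> by auto
    have bGK: "?b \<inter> G = (\<lambda>s k. \<omega> k s) -` (?KB \<inter> ?KC) \<inter> space M" using \<omega>\<Omega> by (auto simp: G)
    have 1: "prob (?a \<inter> ?b) = prob ?a * prob ?b"
      using x0_indep va in_past[OF KB] unfolding indep_sets2_eq bK \<Omega>_def by blast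
    have 2: "prob (?a \<inter> (?b \<inter> G)) = prob ?a * prob (?b \<inter> G)"
      using x0_indep va in_past[OF sets.Int[OF KB KC]] unfolding indep_sets2_eq bGK \<Omega>_def by blast
    have 3: "prob (?b \<inter> G) = prob ?b * prob G"
    proof -
      let ?CC = "(\<lambda>f. f n) -` C \<inter> space (PiM {n} (\<lambda>_. P))"
      have CC: "?CC \<in> sets (PiM {n} (\<lambda>_. P))"
        by (rule measurable_sets[OF measurable_component_singleton[where M = "\<lambda>_. P"] C]) simp
      have "(\<lambda>s. restrict (\<lambda>k. \<omega> k s) {n}) s \<in> space (PiM {n} (\<lambda>_. P))" if "s \<in> space M" for s
        using measurable_space[OF \<omega>_meas that] by (simp add: space_PiM)
      then have G': "G = (\<lambda>s. restrict (\<lambda>k. \<omega> k s) {n}) -` ?CC \<inter> space M" by (auto simp: G)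
      have "?b \<in> sigma_sets (space M) {?W -` A \<inter> space M |A. A \<in> sets (PiM {..<n} (\<lambda>_. P))}"
        using B by (intro sigma_sets.Basic) blast
      moreover have "G \<in> sigma_sets (space M) {(\<lambda>s. restrict (\<lambda>k. \<omega> k s) {n}) -` A \<inter> space M |A. A \<in> sets (PiM {n} (\<lambda>_. P))}"
        unfolding G' using CC by (intro sigma_sets.Basic) blast
      ultimately show ?thesis using ind unfolding indep_var_eq indep_sets2_eq by blast
    qed
    have "E \<inter> G = ?a \<inter> (?b \<inter> G)" "E = ?a \<inter> ?b" by (auto simp: E)
    then show "prob (E \<inter> G) = prob E * prob G" using 1 2 3 by simp
  qed
  have stable: "Int_stable (past_rectangles M P x0 \<omega> n)"
  proof (rule Int_stableI)
    fix E E' assume "E \<in> past_rectangles M P x0 \<omega> n" "E' \<in> past_rectangles M P x0 \<omega> n"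
    then obtain A B A' B' where E: "E = x0 -` A \<inter> ?W -` B \<inter> space M" "E' = x0 -` A' \<inter> ?W -` B' \<inter> space M"
      and A: "A \<in> sets borel" "A' \<in> sets borel"
      and B: "B \<in> sets (PiM {..<n} (\<lambda>_. P))" "B' \<in> sets (PiM {..<n} (\<lambda>_. P))"
      by (auto simp: past_rectangles_def)
    have "E \<inter> E' = x0 -` (A \<inter> A') \<inter> ?W -` (B \<inter> B') \<inter> space M" by (auto simp: E)
    then show "E \<inter> E' \<in> past_rectangles M P x0 \<omega> n"
      unfolding past_rectangles_def using sets.Int[OF A] sets.Int[OF B] by blast
  qed
  have "indep_set (sigma_sets (space M) (past_rectangles M P x0 \<omega> n)) (sigma_sets (space M) (sets ?V))"
    by (rule indep_set_sigma_sets[OF indep stable]) (auto simp: Int_stable_def)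
  moreover have "sigma_sets (space M) (sets ?V) = sets ?V"
    using sets.sigma_sets_eq[of ?V] by simp
  ultimately show ?thesis by (simp add: sets_past)
qed

text \<open>The noise is cut off by indicators evaluated at the current iterate, which belongs to
  the past; the differences stay orthogonal and now have variance at most c times the square of the
  step size, on all paths. On paths that remain in the ball the cutoff is invisible.\<close>

lemma AE_summable_noise:
  fixes Z :: "'b \<Rightarrow> 'w \<Rightarrow> real" and x :: "nat \<Rightarrow> 'a \<Rightarrow> 'b"
  assumes P: "prob_space P" and \<omega>_distr: "\<And>k. distr M P (\<omega> k) = P"
    and \<omega>_indep: "indep_vars (\<lambda>_. P) \<omega> UNIV"
    and x0_indep: "indep_set (sets (vimage_algebra (space M) x0 borel))
      (sets (vimage_algebra (space M) (\<lambda>s k. \<omega> k s) (PiM UNIV (\<lambda>_. P))))"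
    and x: "\<And>n. x n \<in> borel_measurable (past M P x0 \<omega> n)"
    and xX: "\<And>n s. s \<in> space M \<Longrightarrow> x n s \<in> X" and X: "closed X"
    and Z[measurable]: "(\<lambda>(y, w). Z y w) \<in> borel_measurable (borel \<Otimes>\<^sub>M P)"
    and Z0: "\<And>y. (\<integral>w. Z y w \<partial>P) = 0"
    and Z2: "\<And>y. y \<in> X \<Longrightarrow> norm y \<le> R \<Longrightarrow> (\<integral>\<^sup>+w. ennreal ((Z y w)\<^sup>2) \<partial>P) \<le> ennreal c"
    and c: "0 \<le> c" and \<alpha>: "summable (\<lambda>n. (\<alpha> n)\<^sup>2)"
  shows "AE s in M. (\<forall>n. norm (x n s) \<le> R) \<longrightarrow> summable (\<lambda>n. \<alpha> n * Z (x n s) (\<omega> n s))"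
proof -
  interpret P: prob_space P by (rule P)
  have [measurable]: "X \<in> sets borel" "cball (0::'b) R \<in> sets borel" using X by simp_all
  have [measurable]: "(\<lambda>p. Z (fst p) (snd p)) \<in> borel_measurable (borel \<Otimes>\<^sub>M P)"
    using Z by (simp add: case_prod_beta')
  let ?F = "past M P x0 \<omega>"
  define H where "H n y w = \<alpha> n * ((indicator X y * indicator (cball 0 R) y) * Z y w)" for n y w
  have H[measurable]: "(\<lambda>(y, w). H n y w) \<in> borel_measurable (borel \<Otimes>\<^sub>M P)" for n
    unfolding H_def by measurable
  have H0: "(\<integral>w. H n y w \<partial>P) = 0" for n y
    by (simp add: H_def Z0)
  have H2: "(\<integral>\<^sup>+w. ennreal ((H n y w)\<^sup>2) \<partial>P) \<le> ennreal ((\<alpha> n)\<^sup>2 * c)" for n y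
  proof (cases "y \<in> X \<and> norm y \<le> R")
    case True
    have [measurable]: "Z y \<in> borel_measurable P"
      using measurable_Pair2[OF Z, of y] by simp
    have "(\<integral>\<^sup>+w. ennreal ((H n y w)\<^sup>2) \<partial>P) = (\<integral>\<^sup>+w. ennreal ((\<alpha> n)\<^sup>2) * ennreal ((Z y w)\<^sup>2) \<partial>P)"
      using True by (intro nn_integral_cong) (simp add: H_def power_mult_distrib ennreal_mult')
    also have "\<dots> = ennreal ((\<alpha> n)\<^sup>2) * (\<integral>\<^sup>+w. ennreal ((Z y w)\<^sup>2) \<partial>P)"
      by (rule nn_integral_cmult) measurable
    also have "\<dots> \<le> ennreal ((\<alpha> n)\<^sup>2) * ennreal c" using True by (intro mult_left_mono Z2) auto
    also have "\<dots> = ennreal ((\<alpha> n)\<^sup>2 * c)" by (rule ennreal_mult'[symmetric]) simp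
    finally show ?thesis .
  next
    case False
    then have "H n y w = 0" for w by (auto simp: H_def indicator_def)
    then show ?thesis by simp
  qed
  define D where "D n s = H n (x n s) (\<omega> n s)" for n s
  have D_meas: "D n \<in> borel_measurable (?F (Suc n))" for n
  proof -
    have [measurable]: "x n \<in> borel_measurable (?F (Suc n))"
      by (rule measurable_from_subalg[OF past_mono x])
    have [measurable]: "\<omega> n \<in> measurable (?F (Suc n)) P" by (rule \<omega>_past) simp
    have "(\<lambda>s. case (x n s, \<omega> n s) of (y, w) \<Rightarrow> H n y w) \<in> borel_measurable (?F (Suc n))" by measurable
    then show ?thesis by (simp add: D_def[abs_def])
  qed
  note orth = indep_orthogonal[OF P subalgebra_past \<omega>_meas \<omega>_distr indep_past[OF \<omega>_indep x0_indep] x H H0]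
  have DM: "D n \<in> borel_measurable M" for n by (rule measurable_from_subalg[OF subalgebra_past D_meas])
  have nnD: "(\<integral>\<^sup>+s. ennreal ((D n s)\<^sup>2) \<partial>M) \<le> ennreal ((\<alpha> n)\<^sup>2 * c)" for n
  proof -
    have "(\<integral>\<^sup>+s. ennreal ((D n s)\<^sup>2) \<partial>M) = (\<integral>\<^sup>+s. (\<integral>\<^sup>+w. ennreal ((H n (x n s) w)\<^sup>2) \<partial>P) \<partial>M)"
      unfolding D_def by (rule orth(2)[where u = "\<lambda>_. 0"]) simp_all
    also have "\<dots> \<le> (\<integral>\<^sup>+s. ennreal ((\<alpha> n)\<^sup>2 * c) \<partial>M)" by (intro nn_integral_mono H2)
    also have "\<dots> = ennreal ((\<alpha> n)\<^sup>2 * c)" by (simp add: emeasure_space_1)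
    finally show ?thesis .
  qed
  have D2: "integrable M (\<lambda>s. (D n s)\<^sup>2)" for n
  proof (rule integrableI_bounded)
    show "(\<integral>\<^sup>+s. ennreal (norm ((D n s)\<^sup>2)) \<partial>M) < \<infinity>"
      using nnD[of n] by (simp add: less_top[symmetric]) (metis ennreal_neq_top neq_top_trans)
  qed (use DM in measurable)
  have "AE s in M. summable (\<lambda>n. D n s)"
  proof (rule martingale_AE_convergent[where F = ?F, OF subalgebra_past past_mono D_meas D2])
    fix n and u :: "'a \<Rightarrow> real"
    assume "u \<in> borel_measurable (?F n)" "integrable M (\<lambda>s. u s * D n s)"
    then show "(\<integral>s. u s * D n s \<partial>M) = 0" unfolding D_def by (rule orth(1))
  next
    have "(\<integral>s. (D n s)\<^sup>2 \<partial>M) \<le> (\<alpha> n)\<^sup>2 * c" for n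
      using nnD[of n] nn_integral_eq_integral[OF D2[of n]] c by simp
    then show "summable (\<lambda>n. \<integral>s. (D n s)\<^sup>2 \<partial>M)"
      by (intro summable_comparison_test[OF _ summable_mult2[OF \<alpha>, of c]] exI[of _ 0]) simp
  qed
  with AE_space show ?thesis
  proof eventually_elim
    fix s assume s: "s \<in> space M" "summable (\<lambda>n. D n s)"
    show "(\<forall>n. norm (x n s) \<le> R) \<longrightarrow> summable (\<lambda>n. \<alpha> n * Z (x n s) (\<omega> n s))"
    proof
      assume "\<forall>n. norm (x n s) \<le> R"
      then have "D n s = \<alpha> n * Z (x n s) (\<omega> n s)" for n using xX[OF s(1)] by (simp add: D_def H_def)
      with s(2) show "summable (\<lambda>n. \<alpha> n * Z (x n s) (\<omega> n s))" by simp
    qed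
  qed
qed

end

end

section \<open>Limits of the interpolated iterates\<close>

lemma lipschitz_imp_abs_cont_on:
  fixes z :: "real \<Rightarrow> 'a::real_normed_vector"
  assumes lip: "\<And>s t. norm (z s - z t) \<le> K * \<bar>s - t\<bar>"
  shows "abs_cont_on S z"
  unfolding abs_cont_on_def
proof (intro allI impI)
  fix e :: real assume e: "0 < e"
  have K: "0 \<le> K" using order_trans[OF norm_ge_zero lip[of 0 1]] by simp
  show "\<exists>d>0. \<forall>(n::nat) a b. (\<forall>i<n. a i \<le> b i \<and> {a i..b i} \<subseteq> S) \<and>
     disjoint_family_on (\<lambda>i. {a i<..<b i}) {..<n} \<and> (\<Sum>i<n. b i - a i) < d \<longrightarrow>
     (\<Sum>i<n. norm (z (b i) - z (a i))) < e"
  proof (intro exI[of _ "e / (K + 1)"] conjI allI impI)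
    show "0 < e / (K + 1)" using e K by simp
    fix n :: nat and a b :: "nat \<Rightarrow> real"
    assume ab: "(\<forall>i<n. a i \<le> b i \<and> {a i..b i} \<subseteq> S) \<and>
     disjoint_family_on (\<lambda>i. {a i<..<b i}) {..<n} \<and> (\<Sum>i<n. b i - a i) < e / (K + 1)"
    have "(\<Sum>i<n. norm (z (b i) - z (a i))) \<le> (\<Sum>i<n. K * (b i - a i))"
    proof (rule sum_mono)
      fix i assume "i \<in> {..<n}"
      then show "norm (z (b i) - z (a i)) \<le> K * (b i - a i)" using lip[of "b i" "a i"] ab by auto
    qed
    also have "\<dots> = K * (\<Sum>i<n. b i - a i)" by (simp add: sum_distrib_left)
    also have "\<dots> \<le> K * (e / (K + 1))" using ab K by (intro mult_left_mono) auto
    also have "\<dots> < e" using e K by (simp add: field_simps)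
    finally show "(\<Sum>i<n. norm (z (b i) - z (a i))) < e" .
  qed
qed

text \<open>Rademacher's theorem in dimension one, applied to each coordinate.\<close>

lemma AE_lipschitz_vector_derivative:
  fixes z :: "real \<Rightarrow> 'a::euclidean_space"
  assumes lip: "\<And>s t. norm (z s - z t) \<le> K * \<bar>s - t\<bar>"
  shows "AE t in lborel. \<exists>w. (z has_vector_derivative w) (at t)"
proof -
  have K: "0 \<le> K" using order_trans[OF norm_ge_zero lip[of 0 1]] by simp
  have "AE t in lborel. \<forall>b\<in>Basis. \<exists>w. ((\<lambda>s. z s \<bullet> b) has_real_derivative w) (at t)"
  proof (rule AE_finite_allI[OF finite_Basis])
    fix b :: 'a assume b: "b \<in> Basis"
    have "K-lipschitz_on UNIV (\<lambda>s. z s \<bullet> b)"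
    proof (rule lipschitz_onI[OF _ K])
      fix s t
      have "dist (z s \<bullet> b) (z t \<bullet> b) = \<bar>(z s - z t) \<bullet> b\<bar>" by (simp add: dist_real_def inner_diff_left)
      also have "\<dots> \<le> norm (z s - z t)" using b by (rule Basis_le_norm)
      also have "\<dots> \<le> K * dist s t" using lip[of s t] by (simp add: dist_real_def)
      finally show "dist (z s \<bullet> b) (z t \<bullet> b) \<le> K * dist s t" .
    qed
    from AE_lipschitz_gradient[OF this]
    show "AE t in lborel. \<exists>w. ((\<lambda>s. z s \<bullet> b) has_real_derivative w) (at t)"
    proof eventually_elim
      fix t assume "GDERIV (\<lambda>s. z s \<bullet> b) t :> (\<Sum>c\<in>Basis. dderiv (\<lambda>s. z s \<bullet> b) c t *\<^sub>R c)"
      then show "\<exists>w. ((\<lambda>s. z s \<bullet> b) has_real_derivative w) (at t)"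
        by (auto simp: gderiv_def has_field_derivative_def mult.commute[of _ "dderiv _ _ _"] mult_commute_abs
            intro!: exI[of _ "dderiv (\<lambda>s. z s \<bullet> b) 1 t"])
    qed
  qed
  then show ?thesis
  proof eventually_elim
    fix t assume "\<forall>b\<in>Basis. \<exists>w. ((\<lambda>s. z s \<bullet> b) has_real_derivative w) (at t)"
    then obtain w where w: "\<And>b. b \<in> Basis \<Longrightarrow> ((\<lambda>s. z s \<bullet> b) has_real_derivative w b) (at t)" by metis
    have "((\<lambda>s. \<Sum>b\<in>Basis. (z s \<bullet> b) *\<^sub>R b) has_vector_derivative (\<Sum>b\<in>Basis. w b *\<^sub>R b)) (at t)"
      using w by (intro has_vector_derivative_sum) (auto intro!: derivative_eq_intros)
    then show "\<exists>w. (z has_vector_derivative w) (at t)" by (auto simp: euclidean_representation)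
  qed
qed

text \<open>The deterministic content of one sample path. \<open>B\<close> bounds the multiplier
  \<rho>, which may be unbounded, and \<open>c\<close> stands for the conditional mean of
  \<open>B\<close>, so that \<open>B - c\<close> is noise just as \<open>e\<close> is. The
  subgradient of \<open>f\<close> sits at the old iterate, that of \<open>g\<close> and the normal
  at the new one.\<close>

locale inexact_subgradient_iteration =
  fixes f g :: "'a::euclidean_space \<Rightarrow> real" and X :: "'a set"
    and x m v n e :: "nat \<Rightarrow> 'a" and \<alpha> \<rho> B c :: "nat \<Rightarrow> real" and R C1 C2 C0 :: real
  assumes f_lip: "locally_lipschitz f" and g_lip: "locally_lipschitz g" and X: "closed X"
    and xX: "\<And>k. x k \<in> X" and x_bound: "\<And>k. norm (x k) \<le> R"
    and \<alpha>_pos: "\<And>k. 0 < \<alpha> k" and \<alpha>_sum: "filterlim (\<lambda>n. \<Sum>k<n. \<alpha> k) at_top sequentially"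
    and \<alpha>_0: "\<alpha> \<longlonglongrightarrow> 0"
    and m: "\<And>k. m k \<in> clarke_subdiff f (x k)" "\<And>k. norm (m k) \<le> C1"
    and v: "\<And>k. v k \<in> clarke_subdiff g (x (Suc k))" "\<And>k. norm (v k) \<le> C2"
    and n: "\<And>k. n k \<in> unit_normals X (x (Suc k))"
    and \<rho>: "\<And>k. 0 \<le> \<rho> k" "\<And>k. \<rho> k \<le> B k"
    and B: "summable (\<lambda>k. \<alpha> k * (B k - c k))" and c: "\<And>k. c k \<le> C0"
    and e: "summable (\<lambda>k. \<alpha> k *\<^sub>R e k)"
    and iteration: "\<And>k. x (Suc k) = x k - \<alpha> k *\<^sub>R (m k + v k + \<rho> k *\<^sub>R n k + e k)"
begin

definition time :: "nat \<Rightarrow> real" where "time i = (\<Sum>k<i. \<alpha> k)"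

text \<open>Interpolation of the iterates after i by a step function of the elapsed time \<tau>. Its
  values are iterates, hence stay in \<open>X\<close>, which may fail to be convex.\<close>

definition index_after :: "nat \<Rightarrow> real \<Rightarrow> nat" where
  "index_after i \<tau> = (LEAST j. i \<le> j \<and> time i + \<tau> \<le> time j)"

definition K :: real where "K = C1 + C2 + C0"

text \<open>If C0 were negative, \<open>B - c\<close> would be at least - C0 > 0 because
  \<open>B\<close> dominates a nonnegative \<rho>, and its weighted sum would diverge with the sum
  of the step sizes.\<close>

lemma C0_nonneg: "0 \<le> C0"
proof (rule ccontr)
  assume neg: "\<not> 0 \<le> C0"
  have le: "- C0 * (\<Sum>k<i. \<alpha> k) \<le> (\<Sum>k<i. \<alpha> k * (B k - c k))" for i
    unfolding sum_distrib_left
  proof (rule sum_mono)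
    fix k
    have "- C0 \<le> B k - c k" using \<rho>[of k] c[of k] by linarith
    then show "- C0 * \<alpha> k \<le> \<alpha> k * (B k - c k)"
      using mult_left_mono[of "- C0" "B k - c k" "\<alpha> k"] \<alpha>_pos[of k] by (simp add: mult.commute)
  qed
  have "filterlim (\<lambda>i. - C0 * (\<Sum>k<i. \<alpha> k)) at_top sequentially"
    using neg by (intro filterlim_tendsto_pos_mult_at_top[OF tendsto_const _ \<alpha>_sum]) auto
  then have "filterlim (\<lambda>i. \<Sum>k<i. \<alpha> k * (B k - c k)) at_top sequentially"
    by (rule filterlim_at_top_mono) (intro always_eventually allI le)
  moreover have "(\<lambda>i. \<Sum>k<i. \<alpha> k * (B k - c k)) \<longlonglongrightarrow> (\<Sum>k. \<alpha> k * (B k - c k))"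
    using B by (rule summable_LIMSEQ)
  ultimately show False
    using not_tendsto_and_filterlim_at_infinity[OF sequentially_bot _ filterlim_at_top_imp_at_infinity] by blast
qed

lemma K_nonneg: "0 \<le> K"
  using C0_nonneg norm_ge_zero[of "m 0"] m(2)[of 0] norm_ge_zero[of "v 0"] v(2)[of 0]
  unfolding K_def by linarith

lemma time_mono: "i \<le> j \<Longrightarrow> time i \<le> time j"
  unfolding time_def using \<alpha>_pos by (intro sum_mono2) (auto intro: less_imp_le)

lemma time_strict: "i < j \<Longrightarrow> time i < time j"
  unfolding time_def using \<alpha>_pos by (intro sum_strict_mono2[where b = i]) (auto intro: less_imp_le)

lemma time_less_iff: "time i < time j \<longleftrightarrow> i < j"
  by (meson not_le time_mono time_strict)

lemma time_diff: "i \<le> j \<Longrightarrow> time j - time i = (\<Sum>k=i..<j. \<alpha> k)"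
  unfolding time_def lessThan_atLeast0 by (rule sum_diff_nat_ivl) simp_all

lemma norm_n: "norm (n k) \<le> 1"
proof -
  have "unit_normals X (x (Suc k)) \<subseteq> cball 0 1"
    unfolding unit_normals_def by (intro hull_minimal) auto
  then show ?thesis using n[of k] by auto
qed

text \<open>The Cauchy criterion makes both noise series negligible over late windows of any length.
  As c is at most C0, the weighted sum of \<open>B\<close> is then asymptotically at most C0 times
  the length of the window.\<close>

lemma tails:
  assumes "0 < \<epsilon>"
  shows "\<exists>N. \<forall>i\<ge>N. \<forall>j\<ge>i. norm (\<Sum>k=i..<j. \<alpha> k *\<^sub>R e k) \<le> \<epsilon> \<and>
    (\<Sum>k=i..<j. \<alpha> k * B k) \<le> C0 * (time j - time i) + \<epsilon>"
proof -
  obtain N1 where N1: "\<And>i j. i \<ge> N1 \<Longrightarrow> norm (\<Sum>k=i..<j. \<alpha> k *\<^sub>R e k) < \<epsilon>"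
    using e assms unfolding summable_Cauchy by meson
  obtain N2 where N2: "\<And>i j. i \<ge> N2 \<Longrightarrow> norm (\<Sum>k=i..<j. \<alpha> k * (B k - c k)) < \<epsilon>"
    using B assms unfolding summable_Cauchy by meson
  show ?thesis
  proof (intro exI[of _ "max N1 N2"] allI impI conjI)
    fix i j assume i: "max N1 N2 \<le> i" and j: "i \<le> j"
    show "norm (\<Sum>k=i..<j. \<alpha> k *\<^sub>R e k) \<le> \<epsilon>" using N1[of i j] i by simp
    have "(\<Sum>k=i..<j. \<alpha> k * B k) = (\<Sum>k=i..<j. \<alpha> k * (B k - c k)) + (\<Sum>k=i..<j. \<alpha> k * c k)"
      by (simp add: sum.distrib[symmetric] algebra_simps)
    also have "(\<Sum>k=i..<j. \<alpha> k * c k) \<le> (\<Sum>k=i..<j. \<alpha> k * C0)"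
      using c \<alpha>_pos by (intro sum_mono mult_left_mono) (auto intro: less_imp_le)
    also have "(\<Sum>k=i..<j. \<alpha> k * C0) = C0 * (time j - time i)"
      using time_diff[OF j] by (simp add: sum_distrib_left mult.commute)
    finally show "(\<Sum>k=i..<j. \<alpha> k * B k) \<le> C0 * (time j - time i) + \<epsilon>"
      using N2[of i j] i by simp
  qed
qed

lemma increment:
  assumes "i \<le> j"
  shows "x j - x i = - (\<Sum>k=i..<j. \<alpha> k *\<^sub>R (m k + v k + \<rho> k *\<^sub>R n k)) - (\<Sum>k=i..<j. \<alpha> k *\<^sub>R e k)"
  using assms
proof (induction rule: dec_induct)
  case (step j)
  have "x (Suc j) - x i = (x j - x i) - \<alpha> j *\<^sub>R (m j + v j + \<rho> j *\<^sub>R n j) - \<alpha> j *\<^sub>R e j"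
    by (simp add: iteration[of j] scaleR_add_right)
  then show ?case using step by simp
qed simp

lemma increment_bound:
  assumes "0 < \<epsilon>"
  shows "\<exists>N. \<forall>i\<ge>N. \<forall>j\<ge>i. norm (x j - x i) \<le> K * (time j - time i) + \<epsilon>"
proof -
  obtain N where N: "\<And>i j. i \<ge> N \<Longrightarrow> i \<le> j \<Longrightarrow> norm (\<Sum>k=i..<j. \<alpha> k *\<^sub>R e k) \<le> \<epsilon> / 2"
    "\<And>i j. i \<ge> N \<Longrightarrow> i \<le> j \<Longrightarrow> (\<Sum>k=i..<j. \<alpha> k * B k) \<le> C0 * (time j - time i) + \<epsilon> / 2"
    using tails[of "\<epsilon> / 2"] assms by auto
  show ?thesis
  proof (intro exI[of _ N] allI impI)
    fix i j assume i: "N \<le> i" and j: "i \<le> j"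
    have "norm (\<Sum>k=i..<j. \<alpha> k *\<^sub>R (m k + v k + \<rho> k *\<^sub>R n k)) \<le> (\<Sum>k=i..<j. \<alpha> k * (C1 + C2 + B k))"
    proof (rule sum_norm_le)
      fix k
      have "norm (\<rho> k *\<^sub>R n k) \<le> B k * 1"
        unfolding norm_scaleR using \<rho>[of k] norm_n[of k] by (intro mult_mono) auto
      then have "norm (m k + v k + \<rho> k *\<^sub>R n k) \<le> C1 + C2 + B k"
        using m(2)[of k] v(2)[of k] by (intro norm_triangle_le add_mono) auto
      then show "norm (\<alpha> k *\<^sub>R (m k + v k + \<rho> k *\<^sub>R n k)) \<le> \<alpha> k * (C1 + C2 + B k)"
        using \<alpha>_pos[of k] by (simp add: mult_left_mono)
    qed
    also have "\<dots> = (C1 + C2) * (time j - time i) + (\<Sum>k=i..<j. \<alpha> k * B k)"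
      unfolding time_diff[OF j] by (simp add: sum.distrib sum_distrib_left algebra_simps)
    also have "\<dots> \<le> (C1 + C2) * (time j - time i) + (C0 * (time j - time i) + \<epsilon> / 2)"
      using N(2)[OF i j] by simp
    finally have "norm (\<Sum>k=i..<j. \<alpha> k *\<^sub>R (m k + v k + \<rho> k *\<^sub>R n k)) \<le> K * (time j - time i) + \<epsilon> / 2"
      by (simp add: K_def algebra_simps)
    moreover have "norm (x j - x i) \<le> norm (\<Sum>k=i..<j. \<alpha> k *\<^sub>R (m k + v k + \<rho> k *\<^sub>R n k)) + norm (\<Sum>k=i..<j. \<alpha> k *\<^sub>R e k)"
      unfolding increment[OF j] by (rule order_trans[OF norm_triangle_ineq4]) simp
    ultimately show "norm (x j - x i) \<le> K * (time j - time i) + \<epsilon>"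
      using N(1)[OF i j] by linarith
  qed
qed

lemma index_after_ex: "\<exists>j. i \<le> j \<and> time i + \<tau> \<le> time j"
proof -
  have "eventually (\<lambda>j. time i + \<tau> \<le> time j) sequentially"
    using \<alpha>_sum unfolding filterlim_at_top time_def by blast
  then have "eventually (\<lambda>j. i \<le> j \<and> time i + \<tau> \<le> time j) sequentially"
    using eventually_ge_at_top[of i] by eventually_elim simp
  then show ?thesis by (rule eventually_happens'[OF sequentially_bot])
qed

lemma index_after: "i \<le> index_after i \<tau>" "time i + \<tau> \<le> time (index_after i \<tau>)"
  using LeastI_ex[OF index_after_ex, of i \<tau>] unfolding index_after_def by auto

lemma index_after_le: "i \<le> j \<Longrightarrow> time i + \<tau> \<le> time j \<Longrightarrow> index_after i \<tau> \<le> j"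
  unfolding index_after_def by (rule Least_le) simp

lemma index_after_mono: "\<sigma> \<le> \<tau> \<Longrightarrow> index_after i \<sigma> \<le> index_after i \<tau>"
  using index_after[of i \<tau>] by (intro index_after_le) auto

lemma index_after_time_diff: "i \<le> j \<Longrightarrow> index_after i (time j - time i) = j"
  unfolding index_after_def
  by (rule Least_equality) (auto simp: not_less[symmetric] time_less_iff)

lemma index_after_0: "index_after i 0 = i"
  using index_after_time_diff[of i i] by simp

text \<open>The overshoot is at most the last step size, and the step sizes tend to 0.\<close>

lemma index_after_upper:
  assumes "0 < \<epsilon>"
  shows "\<exists>N. \<forall>i\<ge>N. \<forall>\<tau>\<ge>0. time (index_after i \<tau>) \<le> time i + \<tau> + \<epsilon>"
proof -
  obtain N where N: "\<And>k. k \<ge> N \<Longrightarrow> \<alpha> k < \<epsilon>"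
    using order_tendstoD(2)[OF \<alpha>_0 assms] by (auto simp: eventually_sequentially)
  show ?thesis
  proof (intro exI[of _ N] allI impI)
    fix i \<tau> assume i: "N \<le> i" and \<tau>: "(0::real) \<le> \<tau>"
    show "time (index_after i \<tau>) \<le> time i + \<tau> + \<epsilon>"
    proof (cases "index_after i \<tau> = i")
      case False
      then have "i < index_after i \<tau>" using index_after(1)[of i \<tau>] by simp
      then obtain k where k: "index_after i \<tau> = Suc k" "i \<le> k" by (cases "index_after i \<tau>") auto
      have "\<not> time i + \<tau> \<le> time k" using index_after_le[OF k(2), of \<tau>] k(1) by auto
      then show ?thesis using N[of k] i k by (simp add: time_def)
    qed (use \<tau> assms in simp)
  qed
qed

lemma interpolation_equicontinuous:
  assumes \<epsilon>: "0 < \<epsilon>"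
  shows "\<exists>N. \<forall>i\<ge>N. \<forall>\<sigma>\<ge>0. \<forall>\<tau>\<ge>0.
    norm (x (index_after i \<tau>) - x (index_after i \<sigma>)) \<le> K * \<bar>\<tau> - \<sigma>\<bar> + \<epsilon>"
proof -
  define \<epsilon>' where "\<epsilon>' = \<epsilon> / (2 * (K + 1))"
  have \<epsilon>': "0 < \<epsilon>'" "K * \<epsilon>' \<le> \<epsilon> / 2" using \<epsilon> K_nonneg by (auto simp: \<epsilon>'_def field_simps)
  obtain N1 where N1: "\<And>i j. i \<ge> N1 \<Longrightarrow> i \<le> j \<Longrightarrow> norm (x j - x i) \<le> K * (time j - time i) + \<epsilon> / 2"
    using increment_bound[of "\<epsilon> / 2"] \<epsilon> by auto
  obtain N2 where N2: "\<And>i \<tau>. i \<ge> N2 \<Longrightarrow> 0 \<le> \<tau> \<Longrightarrow> time (index_after i \<tau>) \<le> time i + \<tau> + \<epsilon>'"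
    using index_after_upper[OF \<epsilon>'(1)] by auto
  have le: "norm (x (index_after i \<tau>) - x (index_after i \<sigma>)) \<le> K * (\<tau> - \<sigma>) + \<epsilon>"
    if i: "i \<ge> max N1 N2" and \<sigma>: "0 \<le> \<sigma>" "\<sigma> \<le> \<tau>" for i \<sigma> \<tau>
  proof -
    have "norm (x (index_after i \<tau>) - x (index_after i \<sigma>)) \<le>
        K * (time (index_after i \<tau>) - time (index_after i \<sigma>)) + \<epsilon> / 2"
      using i index_after(1)[of i \<sigma>] by (intro N1 index_after_mono \<sigma>) auto
    also have "time (index_after i \<tau>) - time (index_after i \<sigma>) \<le> (\<tau> - \<sigma>) + \<epsilon>'"
      using N2[of i \<tau>] index_after(2)[of i \<sigma>] i \<sigma> by simp
    then have "K * (time (index_after i \<tau>) - time (index_after i \<sigma>)) + \<epsilon> / 2 \<le> K * ((\<tau> - \<sigma>) + \<epsilon>') + \<epsilon> / 2"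
      using K_nonneg by (simp add: mult_left_mono)
    also have "\<dots> \<le> K * (\<tau> - \<sigma>) + \<epsilon>" using \<epsilon>'(2) by (simp add: distrib_left)
    finally show ?thesis .
  qed
  show ?thesis
  proof (intro exI[of _ "max N1 N2"] allI impI)
    fix i \<sigma> \<tau> assume "i \<ge> max N1 N2" "(0::real) \<le> \<sigma>" "(0::real) \<le> \<tau>"
    then show "norm (x (index_after i \<tau>) - x (index_after i \<sigma>)) \<le> K * \<bar>\<tau> - \<sigma>\<bar> + \<epsilon>"
      using le[of i \<sigma> \<tau>] le[of i \<tau> \<sigma>] by (cases "\<sigma> \<le> \<tau>") (auto simp: norm_minus_commute)
  qed
qed

text \<open>An Arzela-Ascoli argument for step functions that are equicontinuous only up to an error
  tending to 0. A diagonal subsequence converges at the nonnegative rationals; the asymptotic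
  Lipschitz bound spreads convergence to all times and makes the limit Lipschitz with constant
  \<open>K\<close>.\<close>

lemma limit_curve:
  assumes \<kappa>: "filterlim \<kappa> at_top sequentially"
  obtains r z where "strict_mono (r :: nat \<Rightarrow> nat)" "\<And>s t. norm (z s - z t) \<le> K * \<bar>s - t\<bar>"
    "\<And>T \<epsilon>. 0 < \<epsilon> \<Longrightarrow> \<exists>N. \<forall>j\<ge>N. \<forall>\<tau>\<in>{0..T}. norm (x (index_after (\<kappa> (r j)) \<tau>) - z \<tau>) \<le> \<epsilon>"
proof -
  define S where "S = \<rat> \<inter> {0::real..}"
  have "countable S" unfolding S_def using countable_rat by (rule countable_Int1)
  then obtain r where r: "strict_mono (r :: nat \<Rightarrow> nat)"
    "\<And>q. q \<in> S \<Longrightarrow> \<exists>l. (\<lambda>j. x (index_after (\<kappa> (r j)) q)) \<longlonglongrightarrow> l"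
    using function_convergent_subsequence[of S "\<lambda>j q. x (index_after (\<kappa> j) q)" R] x_bound by metis
  define u where "u j \<tau> = x (index_after (\<kappa> (r j)) \<tau>)" for j \<tau>
  have \<kappa>r: "filterlim (\<lambda>j. \<kappa> (r j)) at_top sequentially"
    by (rule filterlim_compose[OF \<kappa> filterlim_subseq[OF r(1)]])
  have equi: "\<exists>N. \<forall>j\<ge>N. \<forall>\<sigma>\<ge>0. \<forall>\<tau>\<ge>0. norm (u j \<tau> - u j \<sigma>) \<le> K * \<bar>\<tau> - \<sigma>\<bar> + \<epsilon>" if \<epsilon>: "0 < \<epsilon>" for \<epsilon>
  proof -
    obtain N where N: "\<forall>i\<ge>N. \<forall>\<sigma>\<ge>0. \<forall>\<tau>\<ge>0. norm (x (index_after i \<tau>) - x (index_after i \<sigma>)) \<le> K * \<bar>\<tau> - \<sigma>\<bar> + \<epsilon>"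
      using interpolation_equicontinuous[OF \<epsilon>] by blast
    obtain N' where "\<And>j. j \<ge> N' \<Longrightarrow> \<kappa> (r j) \<ge> N"
      using \<kappa>r unfolding filterlim_at_top eventually_sequentially by blast
    with N show ?thesis unfolding u_def by blast
  qed
  have conv: "convergent (\<lambda>j. u j \<tau>)" if \<tau>: "0 \<le> \<tau>" for \<tau>
    unfolding Cauchy_convergent_iff[symmetric]
  proof (rule metric_CauchyI)
    fix \<epsilon> :: real assume \<epsilon>: "0 < \<epsilon>"
    define h where "h = \<epsilon> / (8 * (K + 1))"
    have h: "0 < h" "K * h \<le> \<epsilon> / 8" using \<epsilon> K_nonneg by (auto simp: h_def field_simps)
    obtain q where q: "q \<in> \<rat>" "\<tau> < q" "q < \<tau> + h" using Rats_dense_in_real[of \<tau> "\<tau> + h"] h by auto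
    then have qS: "q \<in> S" using \<tau> by (simp add: S_def)
    obtain N1 where N1: "\<And>j \<sigma> \<tau>. j \<ge> N1 \<Longrightarrow> 0 \<le> \<sigma> \<Longrightarrow> 0 \<le> \<tau> \<Longrightarrow> norm (u j \<tau> - u j \<sigma>) \<le> K * \<bar>\<tau> - \<sigma>\<bar> + \<epsilon> / 8"
      using equi[of "\<epsilon> / 8"] \<epsilon> by auto
    obtain l where "(\<lambda>j. u j q) \<longlonglongrightarrow> l" using r(2)[OF qS] by (auto simp: u_def)
    from tendstoD[OF this, of "\<epsilon> / 8"] obtain N2 where N2: "\<And>j. j \<ge> N2 \<Longrightarrow> dist (u j q) l < \<epsilon> / 8"
      using \<epsilon> by (auto simp: eventually_sequentially)
    have near: "dist (u j \<tau>) l < \<epsilon> / 2" if j: "j \<ge> max N1 N2" for j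
    proof -
      have "K * \<bar>\<tau> - q\<bar> \<le> K * h" using q K_nonneg by (intro mult_left_mono) auto
      then have "dist (u j \<tau>) (u j q) \<le> \<epsilon> / 8 + \<epsilon> / 8"
        using N1[of j q \<tau>] j \<tau> q h(2) by (simp add: dist_norm)
      then show ?thesis using dist_triangle[of "u j \<tau>" l "u j q"] N2[of j] j \<epsilon> by simp
    qed
    show "\<exists>M. \<forall>i\<ge>M. \<forall>j\<ge>M. dist (u i \<tau>) (u j \<tau>) < \<epsilon>"
    proof (intro exI[of _ "max N1 N2"] allI impI)
      fix i j assume "i \<ge> max N1 N2" "j \<ge> max N1 N2"
      then show "dist (u i \<tau>) (u j \<tau>) < \<epsilon>"
        using near[of i] near[of j] dist_triangle[of "u i \<tau>" "u j \<tau>" l] by (simp add: dist_commute)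
    qed
  qed
  \<comment> \<open>Constant extension to negative times, which makes z Lipschitz on the whole line
    and so differentiable almost everywhere there.\<close>
  define z where "z \<tau> = lim (\<lambda>j. u j (max \<tau> 0))" for \<tau>
  have z_lim: "(\<lambda>j. u j (max \<tau> 0)) \<longlonglongrightarrow> z \<tau>" for \<tau>
    using conv[of "max \<tau> 0"] unfolding z_def by (simp add: convergent_LIMSEQ_iff)
  have z_lip: "norm (z s - z t) \<le> K * \<bar>s - t\<bar>" for s t
  proof (rule field_le_epsilon)
    fix \<epsilon> :: real assume "0 < \<epsilon>"
    then obtain N where N: "\<And>j \<sigma> \<tau>. j \<ge> N \<Longrightarrow> 0 \<le> \<sigma> \<Longrightarrow> 0 \<le> \<tau> \<Longrightarrow> norm (u j \<tau> - u j \<sigma>) \<le> K * \<bar>\<tau> - \<sigma>\<bar> + \<epsilon>"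
      using equi by meson
    have "norm (z s - z t) \<le> K * \<bar>max s 0 - max t 0\<bar> + \<epsilon>"
      by (rule LIMSEQ_le_const2[OF tendsto_norm[OF tendsto_diff[OF z_lim z_lim]]])
        (intro exI[of _ N] allI impI N; simp)
    also have "\<dots> \<le> K * \<bar>s - t\<bar> + \<epsilon>" using K_nonneg by (simp add: mult_left_mono)
    finally show "norm (z s - z t) \<le> K * \<bar>s - t\<bar> + \<epsilon>" .
  qed
  have unif: "\<exists>N. \<forall>j\<ge>N. \<forall>\<tau>\<in>{0..T}. norm (u j \<tau> - z \<tau>) \<le> \<epsilon>" if \<epsilon>: "0 < \<epsilon>" for T \<epsilon>
  proof -
    \<comment> \<open>Mesh of a grid: on its finitely many points convergence is uniform, and
      between them both the iterates and z move little.\<close>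
    define h where "h = \<epsilon> / (4 * (K + 1))"
    have h: "0 < h" "K * h \<le> \<epsilon> / 4" using \<epsilon> K_nonneg by (auto simp: h_def field_simps)
    define I where "I = {..nat \<lfloor>T / h\<rfloor>}"
    obtain N1 where N1: "\<And>j \<sigma> \<tau>. j \<ge> N1 \<Longrightarrow> 0 \<le> \<sigma> \<Longrightarrow> 0 \<le> \<tau> \<Longrightarrow> norm (u j \<tau> - u j \<sigma>) \<le> K * \<bar>\<tau> - \<sigma>\<bar> + \<epsilon> / 4"
      using equi[of "\<epsilon> / 4"] \<epsilon> by auto
    have "eventually (\<lambda>j. \<forall>i\<in>I. dist (u j (real i * h)) (z (real i * h)) < \<epsilon> / 4) sequentially"
    proof (rule eventually_ball_finite)
      show "\<forall>i\<in>I. eventually (\<lambda>j. dist (u j (real i * h)) (z (real i * h)) < \<epsilon> / 4) sequentially"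
      proof
        fix i
        have "max (real i * h) 0 = real i * h" using h(1) by simp
        then show "eventually (\<lambda>j. dist (u j (real i * h)) (z (real i * h)) < \<epsilon> / 4) sequentially"
          using tendstoD[OF z_lim[of "real i * h"], of "\<epsilon> / 4"] \<epsilon> by simp
      qed
    qed (simp add: I_def)
    then obtain N2 where N2: "\<And>j i. j \<ge> N2 \<Longrightarrow> i \<in> I \<Longrightarrow> dist (u j (real i * h)) (z (real i * h)) < \<epsilon> / 4"
      unfolding eventually_sequentially by blast
    show ?thesis
    proof (intro exI[of _ "max N1 N2"] allI impI ballI)
      fix j \<tau> assume j: "max N1 N2 \<le> j" and \<tau>: "\<tau> \<in> {0..T}"
      define i where "i = nat \<lfloor>\<tau> / h\<rfloor>"
      have "\<lfloor>\<tau> / h\<rfloor> \<le> \<lfloor>T / h\<rfloor>" using \<tau> h by (intro floor_mono divide_right_mono) auto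
      then have iI: "i \<in> I" by (simp add: i_def I_def nat_mono)
      have "0 \<le> \<tau> / h" using \<tau> h by simp
      then have "real i \<le> \<tau> / h" "\<tau> / h < real i + 1" unfolding i_def by linarith+
      then have ih: "0 \<le> \<tau> - real i * h" "\<tau> - real i * h \<le> h" using h by (auto simp: field_simps)
      then have Kh: "K * \<bar>\<tau> - real i * h\<bar> \<le> \<epsilon> / 4"
        using h(2) K_nonneg by (intro order_trans[OF mult_left_mono h(2)]) auto
      have "norm (u j \<tau> - u j (real i * h)) \<le> \<epsilon> / 4 + \<epsilon> / 4"
        using N1[of j "real i * h" \<tau>] j \<tau> h Kh by simp
      moreover have "norm (u j (real i * h) - z (real i * h)) < \<epsilon> / 4"
        using N2[OF _ iI, of j] j by (simp add: dist_norm)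
      moreover have "norm (z (real i * h) - z \<tau>) \<le> \<epsilon> / 4"
        using z_lip[of "real i * h" \<tau>] Kh by (simp add: abs_minus_commute)
      moreover have "u j \<tau> - z \<tau> = (u j \<tau> - u j (real i * h)) + ((u j (real i * h) - z (real i * h)) + (z (real i * h) - z \<tau>))"
        by simp
      then have "norm (u j \<tau> - z \<tau>) \<le> norm (u j \<tau> - u j (real i * h)) +
          (norm (u j (real i * h) - z (real i * h)) + norm (z (real i * h) - z \<tau>))"
        by (metis (no_types, lifting) norm_triangle_ineq norm_triangle_le add_left_mono)
      ultimately show "norm (u j \<tau> - z \<tau>) \<le> \<epsilon>" by linarith
    qed
  qed
  show ?thesis using that[OF r(1) z_lip] unif unfolding u_def by blast
qed

end

section \<open>Limit curves are subgradient trajectories\<close>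

context inexact_subgradient_iteration
begin

text \<open>By outer semicontinuity each direction lies within \<eta> (2 + B k) of the set at
  \<open>y\<close>: 2 \<eta> for the two subgradients and \<rho> times \<eta> for the normal.
  Averages with weights proportional to \<alpha> inherit this by convexity. The index j must also be
  close to \<open>y\<close>, because subgradients of \<open>g\<close> and normals sit at the new
  iterate.\<close>

lemma averages_near_subdiff:
  assumes \<eta>: "0 < \<eta>"
  shows "\<exists>\<delta>>0. \<forall>i j. i < j \<longrightarrow> (\<forall>k\<in>{i..j}. dist (x k) y < \<delta>) \<longrightarrow>
    infdist ((1 / (time j - time i)) *\<^sub>R (\<Sum>k=i..<j. \<alpha> k *\<^sub>R (m k + v k + \<rho> k *\<^sub>R n k))) (composite_subdiff f g X y)
      \<le> \<eta> * (2 + (\<Sum>k=i..<j. \<alpha> k * B k) / (time j - time i)) \<and> composite_subdiff f g X y \<noteq> {}"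
proof -
  let ?A = "composite_subdiff f g X y"
  obtain \<delta>1 where \<delta>1: "0 < \<delta>1" "\<And>y' w. dist y' y < \<delta>1 \<Longrightarrow> w \<in> clarke_subdiff f y' \<Longrightarrow> \<exists>w'\<in>clarke_subdiff f y. dist w w' < \<eta>"
    using clarke_subdiff_outer_semicontinuous[OF f_lip \<eta>, of y] by blast
  obtain \<delta>2 where \<delta>2: "0 < \<delta>2" "\<And>y' w. dist y' y < \<delta>2 \<Longrightarrow> w \<in> clarke_subdiff g y' \<Longrightarrow> \<exists>w'\<in>clarke_subdiff g y. dist w w' < \<eta>"
    using clarke_subdiff_outer_semicontinuous[OF g_lip \<eta>, of y] by blast
  obtain \<delta>3 where \<delta>3: "0 < \<delta>3" "\<And>y' w. dist y' y < \<delta>3 \<Longrightarrow> w \<in> unit_normals X y' \<Longrightarrow> \<exists>w'\<in>unit_normals X y. dist w w' < \<eta>"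
    using unit_normals_outer_semicontinuous[OF \<eta>, of y X] by blast
  have cvx: "convex ?A" and cl: "closed ?A" using composite_subdiff_closed_convex[OF f_lip g_lip] by auto
  show ?thesis
  proof (intro exI[of _ "min \<delta>1 (min \<delta>2 \<delta>3)"] conjI allI impI)
    show "0 < min \<delta>1 (min \<delta>2 \<delta>3)" using \<delta>1 \<delta>2 \<delta>3 by simp
    fix i j assume ij: "i < j" and near: "\<forall>k\<in>{i..j}. dist (x k) y < min \<delta>1 (min \<delta>2 \<delta>3)"
    let ?p = "\<lambda>k. m k + v k + \<rho> k *\<^sub>R n k"
    have "\<exists>p'\<in>?A. norm (?p k - p') \<le> \<eta> * (2 + B k)" if k: "k \<in> {i..<j}" for k
    proof -
      have near_k: "dist (x k) y < \<delta>1" "dist (x (Suc k)) y < \<delta>2" "dist (x (Suc k)) y < \<delta>3"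
        using near k by auto
      obtain m' where m': "m' \<in> clarke_subdiff f y" "dist (m k) m' < \<eta>" using \<delta>1(2)[OF near_k(1) m(1)] by blast
      obtain v' where v': "v' \<in> clarke_subdiff g y" "dist (v k) v' < \<eta>" using \<delta>2(2)[OF near_k(2) v(1)] by blast
      obtain n' where n': "n' \<in> unit_normals X y" "dist (n k) n' < \<eta>" using \<delta>3(2)[OF near_k(3) n] by blast
      have "m' + v' + \<rho> k *\<^sub>R n' \<in> ?A"
        unfolding composite_subdiff_def using m'(1) v'(1) n'(1) \<rho>(1)
        by (intro set_plus_intro scale_unit_normals)
      moreover have "norm (?p k - (m' + v' + \<rho> k *\<^sub>R n')) \<le> \<eta> * (2 + B k)"
      proof -
        have "?p k - (m' + v' + \<rho> k *\<^sub>R n') = (m k - m') + (v k - v') + \<rho> k *\<^sub>R (n k - n')"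
          by (simp add: scaleR_diff_right)
        also have "norm \<dots> \<le> \<eta> + \<eta> + B k * \<eta>"
        proof (intro norm_triangle_le add_mono)
          show "norm (m k - m') \<le> \<eta>" "norm (v k - v') \<le> \<eta>" using m' v' by (auto simp: dist_norm)
          show "norm (\<rho> k *\<^sub>R (n k - n')) \<le> B k * \<eta>"
            unfolding norm_scaleR using \<rho>[of k] n'(2) by (intro mult_mono) (auto simp: dist_norm)
        qed
        finally show ?thesis by (simp add: algebra_simps)
      qed
      ultimately show ?thesis by blast
    qed
    then obtain p' where p': "\<And>k. k \<in> {i..<j} \<Longrightarrow> p' k \<in> ?A" "\<And>k. k \<in> {i..<j} \<Longrightarrow> norm (?p k - p' k) \<le> \<eta> * (2 + B k)"
      by metis
    show ne: "?A \<noteq> {}" using p'(1)[of i] ij by auto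
    define T where "T = time j - time i"
    have T: "0 < T" "T = (\<Sum>k=i..<j. \<alpha> k)" using time_strict[OF ij] time_diff[of i j] ij by (auto simp: T_def)
    have "(\<Sum>k=i..<j. (\<alpha> k / T) *\<^sub>R p' k) \<in> ?A"
    proof (rule convex_sum[OF _ cvx])
      show "(\<Sum>k=i..<j. \<alpha> k / T) = 1" using T by (simp add: sum_divide_distrib[symmetric])
    qed (use p'(1) \<alpha>_pos T in \<open>auto intro: less_imp_le\<close>)
    moreover have "(\<Sum>k=i..<j. (\<alpha> k / T) *\<^sub>R p' k) = (1 / T) *\<^sub>R (\<Sum>k=i..<j. \<alpha> k *\<^sub>R p' k)"
      by (simp add: scaleR_sum_right)
    ultimately have "infdist ((1 / T) *\<^sub>R (\<Sum>k=i..<j. \<alpha> k *\<^sub>R ?p k)) ?A \<le>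
        dist ((1 / T) *\<^sub>R (\<Sum>k=i..<j. \<alpha> k *\<^sub>R ?p k)) ((1 / T) *\<^sub>R (\<Sum>k=i..<j. \<alpha> k *\<^sub>R p' k))"
      by (intro infdist_le) simp
    also have "\<dots> = (1 / T) * norm (\<Sum>k=i..<j. \<alpha> k *\<^sub>R (?p k - p' k))"
      using T by (simp add: dist_norm scaleR_diff_right[symmetric] sum_subtractf[symmetric] del: scaleR_right_diff_distrib)
    also have "\<dots> \<le> (1 / T) * (\<Sum>k=i..<j. \<alpha> k * (\<eta> * (2 + B k)))"
    proof (intro mult_left_mono sum_norm_le)
      fix k assume "k \<in> {i..<j}"
      then show "norm (\<alpha> k *\<^sub>R (?p k - p' k)) \<le> \<alpha> k * (\<eta> * (2 + B k))"
        using \<alpha>_pos[of k] p'(2)[of k] by (simp add: mult_left_mono)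
    qed (use T in simp)
    also have "(\<Sum>k=i..<j. \<alpha> k * (\<eta> * (2 + B k))) = \<eta> * (2 * T + (\<Sum>k=i..<j. \<alpha> k * B k))"
      unfolding T(2) by (simp add: sum_distrib_left sum.distrib[symmetric] algebra_simps)
    also have "(1 / T) * (\<eta> * (2 * T + (\<Sum>k=i..<j. \<alpha> k * B k))) = \<eta> * (2 + (\<Sum>k=i..<j. \<alpha> k * B k) / T)"
      using T(1) by (simp add: field_simps)
    finally show "infdist ((1 / (time j - time i)) *\<^sub>R (\<Sum>k=i..<j. \<alpha> k *\<^sub>R ?p k)) ?A
      \<le> \<eta> * (2 + (\<Sum>k=i..<j. \<alpha> k * B k) / (time j - time i))" unfolding T_def .
  qed
qed

text \<open>A difference quotient of the limit curve is the limit of averaged directions over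
  windows whose lengths tend to h; the noise in the window vanishes and the average of
  \<open>B\<close> is asymptotically at most C0. Nonemptiness is carried along because
  \<open>infdist\<close> to the empty set is 0.\<close>

lemma limit_curve_increment:
  assumes \<kappa>: "filterlim \<kappa> at_top sequentially"
    and z: "\<And>\<tau>. 0 \<le> \<tau> \<Longrightarrow> (\<lambda>j. x (index_after (\<kappa> j) \<tau>)) \<longlonglongrightarrow> z \<tau>"
    and \<eta>: "0 < \<eta>" and t: "0 \<le> t"
  shows "\<exists>h0>0. \<forall>h. 0 < h \<longrightarrow> h < h0 \<longrightarrow>
    infdist (- ((1 / h) *\<^sub>R (z (t + h) - z t))) (composite_subdiff f g X (z t)) \<le> \<eta> * (2 + C0) \<and>
    composite_subdiff f g X (z t) \<noteq> {}"
proof -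
  let ?A = "composite_subdiff f g X (z t)"
  obtain \<delta> where \<delta>: "0 < \<delta>" "\<And>i j. i < j \<Longrightarrow> (\<And>k. k \<in> {i..j} \<Longrightarrow> dist (x k) (z t) < \<delta>) \<Longrightarrow>
    infdist ((1 / (time j - time i)) *\<^sub>R (\<Sum>k=i..<j. \<alpha> k *\<^sub>R (m k + v k + \<rho> k *\<^sub>R n k))) ?A
      \<le> \<eta> * (2 + (\<Sum>k=i..<j. \<alpha> k * B k) / (time j - time i)) \<and> ?A \<noteq> {}"
    using averages_near_subdiff[OF \<eta>, of "z t"] by (metis (no_types, lifting))
  \<comment> \<open>Over a window shorter than h0 the iterates drift by at most
    \<open>K * h0\<close> plus a small error, so with the starting error they stay within \<delta>
    of \<open>z t\<close>.\<close>
  define h0 where "h0 = \<delta> / (4 * (K + 1))"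
  have h0: "0 < h0" "K * h0 \<le> \<delta> / 4" using \<delta>(1) K_nonneg by (auto simp: h0_def field_simps)
  have ev: "eventually (\<lambda>j. \<kappa> j \<ge> N) sequentially" for N
    using \<kappa> unfolding filterlim_at_top by blast
  show ?thesis
  proof (intro exI[of _ h0] conjI allI impI h0)
    fix h assume h: "0 < h" "h < h0"
    define a where "a j = index_after (\<kappa> j) t" for j
    define b where "b j = index_after (\<kappa> j) (t + h)" for j
    define T where "T j = time (b j) - time (a j)" for j
    define S where "S j = (\<Sum>k=a j..<b j. \<alpha> k *\<^sub>R (m k + v k + \<rho> k *\<^sub>R n k))" for j
    have T_lim: "T \<longlonglongrightarrow> h"
    proof (rule metric_LIMSEQ_I)
      fix \<epsilon> :: real assume "0 < \<epsilon>"
      then obtain N where N: "\<And>i \<tau>. i \<ge> N \<Longrightarrow> 0 \<le> \<tau> \<Longrightarrow> time (index_after i \<tau>) \<le> time i + \<tau> + \<epsilon> / 2"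
        using index_after_upper[of "\<epsilon> / 2"] by auto
      obtain N' where N': "\<And>j. j \<ge> N' \<Longrightarrow> \<kappa> j \<ge> N" using ev[of N] by (auto simp: eventually_sequentially)
      show "\<exists>no. \<forall>j\<ge>no. dist (T j) h < \<epsilon>"
      proof (intro exI[of _ N'] allI impI)
        fix j assume "j \<ge> N'"
        then have "time (a j) \<le> time (\<kappa> j) + t + \<epsilon> / 2" "time (b j) \<le> time (\<kappa> j) + (t + h) + \<epsilon> / 2"
          unfolding a_def b_def using N'[of j] t h by (auto intro!: N)
        moreover have "time (\<kappa> j) + t \<le> time (a j)" "time (\<kappa> j) + (t + h) \<le> time (b j)"
          unfolding a_def b_def by (rule index_after)+
        ultimately show "dist (T j) h < \<epsilon>" using \<open>0 < \<epsilon>\<close> unfolding T_def dist_real_def by linarith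
      qed
    qed
    have xa: "(\<lambda>j. x (a j)) \<longlonglongrightarrow> z t" and xb: "(\<lambda>j. x (b j)) \<longlonglongrightarrow> z (t + h)"
      unfolding a_def b_def using t h by (auto intro: z)
    have ab: "a j \<le> b j" "\<kappa> j \<le> a j" for j
      unfolding a_def b_def using h index_after(1) by (auto intro: index_after_mono)
    have E_lim: "(\<lambda>j. \<Sum>k=a j..<b j. \<alpha> k *\<^sub>R e k) \<longlonglongrightarrow> 0"
    proof (rule metric_LIMSEQ_I)
      fix \<epsilon> :: real assume "0 < \<epsilon>"
      then obtain N where N: "\<And>i j. i \<ge> N \<Longrightarrow> i \<le> j \<Longrightarrow> norm (\<Sum>k=i..<j. \<alpha> k *\<^sub>R e k) \<le> \<epsilon> / 2"
        using tails[of "\<epsilon> / 2"] by auto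
      obtain N' where N': "\<And>j. j \<ge> N' \<Longrightarrow> \<kappa> j \<ge> N" using ev[of N] by (auto simp: eventually_sequentially)
      show "\<exists>no. \<forall>j\<ge>no. dist (\<Sum>k=a j..<b j. \<alpha> k *\<^sub>R e k) 0 < \<epsilon>"
      proof (intro exI[of _ N'] allI impI)
        fix j assume "j \<ge> N'"
        then have "norm (\<Sum>k=a j..<b j. \<alpha> k *\<^sub>R e k) \<le> \<epsilon> / 2"
          using ab[of j] N'[of j] by (intro N) auto
        then show "dist (\<Sum>k=a j..<b j. \<alpha> k *\<^sub>R e k) 0 < \<epsilon>" using \<open>0 < \<epsilon>\<close> by simp
      qed
    qed
    have "S j = - (x (b j) - x (a j)) - (\<Sum>k=a j..<b j. \<alpha> k *\<^sub>R e k)" for j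
      using increment[OF ab(1)[of j]] by (simp add: S_def algebra_simps)
    then have "S \<longlonglongrightarrow> - (z (t + h) - z t) - 0"
      using tendsto_diff[OF tendsto_minus[OF tendsto_diff[OF xb xa]] E_lim] by presburger
    then have "(\<lambda>j. (1 / T j) *\<^sub>R S j) \<longlonglongrightarrow> (1 / h) *\<^sub>R (- (z (t + h) - z t) - 0)"
      using h by (intro tendsto_intros T_lim) auto
    then have "(\<lambda>j. infdist ((1 / T j) *\<^sub>R S j) ?A) \<longlonglongrightarrow> infdist ((1 / h) *\<^sub>R (- (z (t + h) - z t) - 0)) ?A"
      by (rule tendsto_infdist)
    then have lim: "(\<lambda>j. infdist ((1 / T j) *\<^sub>R S j) ?A) \<longlonglongrightarrow> infdist (- ((1 / h) *\<^sub>R (z (t + h) - z t))) ?A"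
      by (simp only: diff_0_right scaleR_minus_right)
    have "eventually (\<lambda>j. infdist ((1 / T j) *\<^sub>R S j) ?A \<le> \<eta> * (2 + (C0 + \<epsilon> / T j)) \<and> ?A \<noteq> {}) sequentially"
      if \<epsilon>: "0 < \<epsilon>" for \<epsilon>
    proof -
      obtain N1 where N1: "\<And>i j. i \<ge> N1 \<Longrightarrow> i \<le> j \<Longrightarrow> (\<Sum>k=i..<j. \<alpha> k * B k) \<le> C0 * (time j - time i) + \<epsilon>"
        using tails[OF \<epsilon>] by auto
      obtain N2 where N2: "\<And>i j. i \<ge> N2 \<Longrightarrow> i \<le> j \<Longrightarrow> norm (x j - x i) \<le> K * (time j - time i) + \<delta> / 4"
        using increment_bound[of "\<delta> / 4"] \<delta>(1) by auto
      have "eventually (\<lambda>j. 0 < T j) sequentially" using order_tendstoD(1)[OF T_lim h(1)] .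
      moreover have "eventually (\<lambda>j. T j < h0) sequentially" using order_tendstoD(2)[OF T_lim h(2)] .
      moreover have "eventually (\<lambda>j. dist (x (a j)) (z t) < \<delta> / 4) sequentially"
        using tendstoD[OF xa, of "\<delta> / 4"] \<delta>(1) by simp
      ultimately show ?thesis using ev[of "max N1 N2"]
      proof eventually_elim
        fix j assume T: "0 < T j" "T j < h0" and d: "dist (x (a j)) (z t) < \<delta> / 4" and \<kappa>j: "max N1 N2 \<le> \<kappa> j"
        have lt: "a j < b j" using T(1) by (simp add: T_def time_less_iff)
        have near: "dist (x k) (z t) < \<delta>" if k: "k \<in> {a j..b j}" for k
        proof -
          have "norm (x k - x (a j)) \<le> K * (time k - time (a j)) + \<delta> / 4"
            using k \<kappa>j ab[of j] by (intro N2) auto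
          also have "\<dots> \<le> K * h0 + \<delta> / 4"
            using K_nonneg T(2) time_mono[of k "b j"] k by (intro add_right_mono mult_left_mono) (auto simp: T_def)
          finally have "dist (x k) (x (a j)) \<le> \<delta> / 2" using h0(2) by (simp add: dist_norm)
          then show ?thesis using dist_triangle[of "x k" "z t" "x (a j)"] d \<delta>(1) by simp
        qed
        have le: "infdist ((1 / T j) *\<^sub>R S j) ?A \<le> \<eta> * (2 + (\<Sum>k=a j..<b j. \<alpha> k * B k) / T j) \<and> ?A \<noteq> {}"
          unfolding T_def S_def using \<delta>(2)[OF lt near] .
        have "(\<Sum>k=a j..<b j. \<alpha> k * B k) \<le> C0 * T j + \<epsilon>"
          unfolding T_def using \<kappa>j ab[of j] by (intro N1) auto
        then have "(\<Sum>k=a j..<b j. \<alpha> k * B k) / T j \<le> C0 + \<epsilon> / T j"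
          using T(1) by (simp add: field_simps)
        then have "\<eta> * (2 + (\<Sum>k=a j..<b j. \<alpha> k * B k) / T j) \<le> \<eta> * (2 + (C0 + \<epsilon> / T j))"
          using \<eta> by (intro mult_left_mono) auto
        then show "infdist ((1 / T j) *\<^sub>R S j) ?A \<le> \<eta> * (2 + (C0 + \<epsilon> / T j)) \<and> ?A \<noteq> {}"
          using le by linarith
      qed
    qed
    note main = this
    show "?A \<noteq> {}" using eventually_happens'[OF sequentially_bot main[of 1]] by auto
    have "infdist (- ((1 / h) *\<^sub>R (z (t + h) - z t))) ?A \<le> \<eta> * (2 + (C0 + \<epsilon> / h))" if "0 < \<epsilon>" for \<epsilon>
    proof (rule tendsto_le[OF sequentially_bot _ lim])
      show "(\<lambda>j. \<eta> * (2 + (C0 + \<epsilon> / T j))) \<longlonglongrightarrow> \<eta> * (2 + (C0 + \<epsilon> / h))"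
        using h by (intro tendsto_intros T_lim) auto
      show "eventually (\<lambda>j. infdist ((1 / T j) *\<^sub>R S j) ?A \<le> \<eta> * (2 + (C0 + \<epsilon> / T j))) sequentially"
        using main[OF that] by eventually_elim simp
    qed
    moreover have "((\<lambda>\<epsilon>. \<eta> * (2 + (C0 + \<epsilon> / h))) \<longlongrightarrow> \<eta> * (2 + (C0 + 0 / h))) (at_right 0)"
      using h by (intro tendsto_intros) auto
    ultimately have "infdist (- ((1 / h) *\<^sub>R (z (t + h) - z t))) ?A \<le> \<eta> * (2 + (C0 + 0 / h))"
      by (intro tendsto_lowerbound[where F = "at_right 0" and f = "\<lambda>\<epsilon>. \<eta> * (2 + (C0 + \<epsilon> / h))"])
        (auto simp: eventually_at_filter)
    then show "infdist (- ((1 / h) *\<^sub>R (z (t + h) - z t))) ?A \<le> \<eta> * (2 + C0)" by simp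
  qed
qed

text \<open>Where the derivative w exists, - w is a limit of the quotients of
  \<open>limit_curve_increment\<close>, so its distance to the composite subdifferential is at most
  \<eta> (2 + C0) for every \<eta> > 0; closedness gives membership.\<close>

lemma limit_curve_trajectory:
  assumes \<kappa>: "filterlim \<kappa> at_top sequentially"
    and z: "\<And>\<tau>. 0 \<le> \<tau> \<Longrightarrow> (\<lambda>j. x (index_after (\<kappa> j) \<tau>)) \<longlonglongrightarrow> z \<tau>"
    and lip: "\<And>s t. norm (z s - z t) \<le> K * \<bar>s - t\<bar>"
  shows "subgradient_trajectory f g X z"
  unfolding subgradient_trajectory_def abs_cont_curve_def
proof (intro conjI allI impI)
  show "z t \<in> X" if "0 \<le> t" for t
    using closed_sequentially[OF X _ z[OF that]] xX by blast
  show "abs_cont_on {0..b} z" if "0 < b" for b by (rule lipschitz_imp_abs_cont_on[OF lip])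
  show "AE t in lborel. 0 \<le> t \<longrightarrow> (\<exists>w. (z has_vector_derivative w) (at t) \<and> w \<in> uminus ` composite_subdiff f g X (z t))"
    using AE_lipschitz_vector_derivative[of z K, OF lip]
  proof eventually_elim
    fix t assume "\<exists>w. (z has_vector_derivative w) (at t)"
    then obtain w where w: "(z has_vector_derivative w) (at t)" by blast
    show "0 \<le> t \<longrightarrow> (\<exists>w. (z has_vector_derivative w) (at t) \<and> w \<in> uminus ` composite_subdiff f g X (z t))"
    proof
      assume t: "0 \<le> t"
      let ?A = "composite_subdiff f g X (z t)"
      have nlim: "((\<lambda>h. norm (z (t + h) - z t - h *\<^sub>R w) / norm h) \<longlongrightarrow> 0) (at 0)"
        using w unfolding has_vector_derivative_def has_derivative_at by blast
      moreover have "eventually (\<lambda>h. norm (z (t + h) - z t - h *\<^sub>R w) / norm h =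
          norm ((1 / h) *\<^sub>R (z (t + h) - z t) - w)) (at 0)"
        unfolding eventually_at_filter
      proof (intro always_eventually allI impI)
        fix h :: real assume "h \<noteq> 0"
        then have "(1 / h) *\<^sub>R (z (t + h) - z t) - w = (1 / h) *\<^sub>R (z (t + h) - z t - h *\<^sub>R w)"
          by (simp add: scaleR_diff_right)
        then show "norm (z (t + h) - z t - h *\<^sub>R w) / norm h = norm ((1 / h) *\<^sub>R (z (t + h) - z t) - w)"
          by (simp add: divide_inverse_commute)
      qed
      ultimately have "((\<lambda>h. norm ((1 / h) *\<^sub>R (z (t + h) - z t) - w)) \<longlongrightarrow> 0) (at 0)"
        by (rule Lim_transform_eventually)
      then have "((\<lambda>h. (1 / h) *\<^sub>R (z (t + h) - z t)) \<longlongrightarrow> w) (at 0)"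
        using Lim_null tendsto_norm_zero_iff by blast
      then have "((\<lambda>h. (1 / h) *\<^sub>R (z (t + h) - z t)) \<longlongrightarrow> w) (at_right 0)"
        by (rule filterlim_mono) (simp_all add: at_le)
      then have lim: "((\<lambda>h. infdist (- ((1 / h) *\<^sub>R (z (t + h) - z t))) ?A) \<longlongrightarrow> infdist (- w) ?A) (at_right 0)"
        by (intro tendsto_infdist tendsto_minus)
      have bound: "infdist (- w) ?A \<le> \<eta> * (2 + C0)" if \<eta>: "0 < \<eta>" for \<eta>
      proof (rule tendsto_upperbound[OF lim])
        obtain h0 where "h0 > 0" "\<And>h. 0 < h \<Longrightarrow> h < h0 \<Longrightarrow>
            infdist (- ((1 / h) *\<^sub>R (z (t + h) - z t))) ?A \<le> \<eta> * (2 + C0)"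
          using limit_curve_increment[OF \<kappa> z \<eta> t] by blast
        then show "eventually (\<lambda>h. infdist (- ((1 / h) *\<^sub>R (z (t + h) - z t))) ?A \<le> \<eta> * (2 + C0)) (at_right 0)"
          unfolding eventually_at_right_field by blast
      qed simp
      have "((\<lambda>\<eta>. \<eta> * (2 + C0)) \<longlongrightarrow> 0 * (2 + C0)) (at_right 0)" by (intro tendsto_intros)
      then have "infdist (- w) ?A \<le> 0 * (2 + C0)"
        using bound by (intro tendsto_lowerbound[where F = "at_right 0" and f = "\<lambda>\<eta>. \<eta> * (2 + C0)"])
          (auto simp: eventually_at_filter)
      then have "infdist (- w) ?A = 0" using infdist_nonneg[of "- w" ?A] by simp
      moreover have "?A \<noteq> {}"
        using limit_curve_increment[OF \<kappa> z zero_less_one t] dense by blast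
      ultimately have "- w \<in> ?A"
        using composite_subdiff_closed_convex(1)[OF f_lip g_lip] by (simp add: in_closed_iff_infdist_zero)
      then show "\<exists>w. (z has_vector_derivative w) (at t) \<and> w \<in> uminus ` ?A"
        using w by (intro exI[of _ w] conjI) (auto intro: image_eqI[of _ _ "- w"])
    qed
  qed
qed

lemma limit_trajectory:
  assumes \<kappa>: "filterlim \<kappa> at_top sequentially"
  obtains r z where "strict_mono (r :: nat \<Rightarrow> nat)" "subgradient_trajectory f g X z"
    "continuous_on UNIV z"
    "\<And>T \<epsilon>. 0 < \<epsilon> \<Longrightarrow> \<exists>N. \<forall>j\<ge>N. \<forall>\<tau>\<in>{0..T}. norm (x (index_after (\<kappa> (r j)) \<tau>) - z \<tau>) \<le> \<epsilon>"
    "\<And>\<tau>. 0 \<le> \<tau> \<Longrightarrow> (\<lambda>j. x (index_after (\<kappa> (r j)) \<tau>)) \<longlonglongrightarrow> z \<tau>"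
proof (rule limit_curve[OF \<kappa>])
  fix r :: "nat \<Rightarrow> nat" and z
  assume r: "strict_mono r" and lip: "\<And>s t. norm (z s - z t) \<le> K * \<bar>s - t\<bar>"
    and unif: "\<And>T \<epsilon>. 0 < \<epsilon> \<Longrightarrow> \<exists>N. \<forall>j\<ge>N. \<forall>\<tau>\<in>{0..T}. norm (x (index_after (\<kappa> (r j)) \<tau>) - z \<tau>) \<le> \<epsilon>"
  have lim: "(\<lambda>j. x (index_after (\<kappa> (r j)) \<tau>)) \<longlonglongrightarrow> z \<tau>" if "0 \<le> \<tau>" for \<tau>
  proof (rule metric_LIMSEQ_I)
    fix \<epsilon> :: real assume "0 < \<epsilon>"
    then obtain N where "\<forall>j\<ge>N. \<forall>\<sigma>\<in>{0..\<tau>}. norm (x (index_after (\<kappa> (r j)) \<sigma>) - z \<sigma>) \<le> \<epsilon> / 2"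
      using unif[of "\<epsilon> / 2" \<tau>] by auto
    then show "\<exists>no. \<forall>j\<ge>no. dist (x (index_after (\<kappa> (r j)) \<tau>)) (z \<tau>) < \<epsilon>"
      using that \<open>0 < \<epsilon>\<close> by (force simp: dist_norm)
  qed
  have traj: "subgradient_trajectory f g X z"
    by (rule limit_curve_trajectory[OF filterlim_compose[OF \<kappa> filterlim_subseq[OF r]] lim lip])
  have "K-lipschitz_on UNIV z"
    using lip K_nonneg by (intro lipschitz_onI) (auto simp: dist_norm)
  then have "continuous_on UNIV z" by (rule lipschitz_on_continuous_on)
  from that[OF r traj this unif lim] show thesis .
qed

end

section \<open>Convergence of the values and criticality of limit points\<close>

lemma locally_lipschitz_continuous:
  assumes "locally_lipschitz f"
  shows "continuous_on UNIV f"
proof -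
  have "isCont f x" for x
  proof -
    obtain e C where e: "0 < e" "C-lipschitz_on (ball x e) f" using locally_lipschitzE[OF assms] .
    from lipschitz_on_continuous_on[OF e(2)] show ?thesis
      using e(1) by (simp add: continuous_on_eq_continuous_at)
  qed
  then show ?thesis by (simp add: continuous_at_imp_continuous_on)
qed

lemma bounded_continuous_uniform:
  fixes \<phi> :: "'a::euclidean_space \<Rightarrow> real" and R :: real
  assumes "continuous_on UNIV \<phi>" "0 < \<epsilon>"
  shows "\<exists>\<delta>>0. \<forall>y\<in>cball 0 R. \<forall>y'\<in>cball 0 R. norm (y - y') \<le> \<delta> \<longrightarrow> \<bar>\<phi> y - \<phi> y'\<bar> < \<epsilon>"
proof -
  have "uniformly_continuous_on (cball 0 R) \<phi>"
    using assms(1) by (intro compact_uniformly_continuous) (auto intro: continuous_on_subset)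
  then obtain d where "d > 0" "\<And>y y'. y \<in> cball 0 R \<Longrightarrow> y' \<in> cball 0 R \<Longrightarrow> dist y' y < d \<Longrightarrow> dist (\<phi> y') (\<phi> y) < \<epsilon>"
    unfolding uniformly_continuous_on_def using assms(2) by metis
  then show ?thesis
    by (intro exI[of _ "d / 2"]) (auto simp: dist_norm dist_real_def)
qed

lemma last_crossing:
  fixes \<phi> :: "nat \<Rightarrow> real"
  assumes "\<phi> i0 \<le> r" "i0 \<le> l" "r < \<phi> l"
  obtains i where "i0 \<le> i" "i < l" "\<phi> i \<le> r" "\<And>k. i < k \<Longrightarrow> k \<le> l \<Longrightarrow> r < \<phi> k"
proof -
  define i where "i = Max {k. k \<le> l \<and> \<phi> k \<le> r}"
  have fin: "finite {k. k \<le> l \<and> \<phi> k \<le> r}" by simp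
  have "i \<in> {k. k \<le> l \<and> \<phi> k \<le> r}" unfolding i_def using assms by (intro Max_in[OF fin]) auto
  moreover have "i0 \<le> i" unfolding i_def using assms by (intro Max_ge[OF fin]) auto
  moreover have "r < \<phi> k" if "i < k" "k \<le> l" for k
  proof (rule ccontr)
    assume "\<not> r < \<phi> k"
    then have "k \<le> i" unfolding i_def using that by (intro Max_ge[OF fin]) auto
    with that show False by simp
  qed
  ultimately show ?thesis using that[of i] assms(3) by (cases "i = l") auto
qed

context inexact_subgradient_iteration
begin

theorem convergence:
  assumes weak_Sard: "closure {r. \<not> composite_critical_value f g X r} = UNIV"
    and descent: "\<And>z. subgradient_trajectory f g X z \<Longrightarrow> \<not> composite_critical f g X (z 0) \<Longrightarrow>
      \<exists>\<tau>>0. f (z \<tau>) + g (z \<tau>) < (SUP t\<in>{0..\<tau>}. f (z t) + g (z t)) \<and>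
             (SUP t\<in>{0..\<tau>}. f (z t) + g (z t)) \<le> f (z 0) + g (z 0)"
  shows "convergent (\<lambda>k. f (x k) + g (x k))" and "limit_point x y \<Longrightarrow> composite_critical f g X y"
proof -
  define \<phi> where "\<phi> y = f y + g y" for y
  have \<phi>_cont: "continuous_on UNIV \<phi>"
    unfolding \<phi>_def using f_lip g_lip by (intro continuous_intros locally_lipschitz_continuous)
  have \<phi>_lim: "(\<lambda>j. \<phi> (y j)) \<longlonglongrightarrow> \<phi> l" if "y \<longlonglongrightarrow> l" for y :: "nat \<Rightarrow> 'a" and l
    using continuous_on_tendsto_compose[OF \<phi>_cont that] by simp
  \<comment> \<open>The values along a continuous curve are bounded on [0, \<tau>], so the real
    supremum in the descent property is a genuine one and dominates each value.\<close>
  have descent': "\<exists>\<tau>>0. \<phi> (z \<tau>) < \<phi> (z 0) \<and> (\<forall>t\<in>{0..\<tau>}. \<phi> (z t) \<le> \<phi> (z 0))"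
    if z: "subgradient_trajectory f g X z" "continuous_on UNIV z" "\<not> composite_critical f g X (z 0)" for z
  proof -
    obtain \<tau> where \<tau>: "0 < \<tau>" "\<phi> (z \<tau>) < (SUP t\<in>{0..\<tau>}. \<phi> (z t))" "(SUP t\<in>{0..\<tau>}. \<phi> (z t)) \<le> \<phi> (z 0)"
      using descent[OF z(1,3)] unfolding \<phi>_def by blast
    have "continuous_on {0..\<tau>} (\<lambda>t. \<phi> (z t))"
      by (rule continuous_on_compose2[OF \<phi>_cont continuous_on_subset[OF z(2)]]) auto
    then have "bdd_above ((\<lambda>t. \<phi> (z t)) ` {0..\<tau>})"
      by (intro bounded_imp_bdd_above compact_imp_bounded compact_continuous_image) auto
    then have "\<phi> (z t) \<le> (SUP t\<in>{0..\<tau>}. \<phi> (z t))" if "t \<in> {0..\<tau>}" for t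
      using that by (rule cSUP_upper[rotated])
    with \<tau> show ?thesis by (intro exI[of _ \<tau>]) force
  qed
  have z_R: "z \<tau> \<in> cball 0 R" if "(\<lambda>j. x (index_after (\<kappa> j) \<tau>)) \<longlonglongrightarrow> z \<tau>" for z \<kappa> \<tau>
    by (rule closed_sequentially[OF closed_cball _ that]) (simp add: x_bound)
  have R: "x k \<in> cball 0 R" for k by (simp add: x_bound)
  show conv: "convergent (\<lambda>k. f (x k) + g (x k))"
  proof -
    have "bounded (\<phi> ` cball 0 R)"
      using \<phi>_cont by (intro compact_imp_bounded compact_continuous_image) (auto intro: continuous_on_subset)
    then obtain A where A': "\<forall>w\<in>\<phi> ` cball 0 R. norm w \<le> A" unfolding bounded_iff by blast
    have A: "\<bar>\<phi> y\<bar> \<le> A" if "y \<in> cball 0 R" for y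
      using bspec[OF A' imageI[OF that]] by simp
    \<comment> \<open>The shift by a bound A makes the values nonnegative, as the oscillation
      criterion asks.\<close>
    have "convergent (\<lambda>k. \<phi> (x k) + A)"
    proof (rule convergent_if_no_oscillation)
      show "0 \<le> \<phi> (x k) + A" "\<phi> (x k) + A \<le> 2 * A" for k using A[OF R[of k]] by (auto simp: abs_le_iff)
      fix p q :: real assume "p < q"
      show "\<not> ((\<forall>m. \<exists>n\<ge>m. \<phi> (x n) + A < p) \<and> (\<forall>m. \<exists>n\<ge>m. q < \<phi> (x n) + A))"
      proof
        assume osc: "(\<forall>m. \<exists>n\<ge>m. \<phi> (x n) + A < p) \<and> (\<forall>m. \<exists>n\<ge>m. q < \<phi> (x n) + A)"
        obtain r where r: "p - A < r" "r < q - A" "\<not> composite_critical_value f g X r"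
        proof -
          have "{p - A<..<q - A} \<inter> {r. \<not> composite_critical_value f g X r} \<noteq> {}"
            using weak_Sard \<open>p < q\<close> open_Int_closure_eq_empty[of "{p - A<..<q - A}" "{r. \<not> composite_critical_value f g X r}"]
            by (auto simp: greaterThanLessThan_empty_iff)
          then show ?thesis using that by auto
        qed
        \<comment> \<open>Each upcrossing supplies its last index i with value at most r and an
          index l above q - A. The demand j <= i makes these exits tend to infinity.\<close>
        have "\<exists>i l. j \<le> i \<and> i < l \<and> \<phi> (x i) \<le> r \<and> (\<forall>k. i < k \<longrightarrow> k \<le> l \<longrightarrow> r < \<phi> (x k)) \<and> q - A < \<phi> (x l)" for j
        proof -
          obtain i0 where i0: "i0 \<ge> j" "\<phi> (x i0) + A < p" using osc by blast
          obtain l where l: "l \<ge> i0" "q < \<phi> (x l) + A" using osc by blast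
          obtain i where "i0 \<le> i" "i < l" "\<phi> (x i) \<le> r" "\<And>k. i < k \<Longrightarrow> k \<le> l \<Longrightarrow> r < \<phi> (x k)"
            using last_crossing[of "\<lambda>k. \<phi> (x k)" i0 r l] i0 l r by auto
          with i0 l show ?thesis by (intro exI[of _ i] exI[of _ l]) auto
        qed
        then obtain \<kappa> l where \<kappa>: "\<And>j. j \<le> \<kappa> j" "\<And>j. \<kappa> j < l j" "\<And>j. \<phi> (x (\<kappa> j)) \<le> r"
          "\<And>j k. \<kappa> j < k \<Longrightarrow> k \<le> l j \<Longrightarrow> r < \<phi> (x k)" "\<And>j. q - A < \<phi> (x (l j))"
          by metis
        have \<kappa>_top: "filterlim \<kappa> at_top sequentially"
          using \<kappa>(1) by (intro filterlim_at_top_mono[OF filterlim_ident]) (auto intro: always_eventually)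
        obtain s z where s: "strict_mono s" and z: "subgradient_trajectory f g X z" "continuous_on UNIV z"
          and unif: "\<And>T \<epsilon>. 0 < \<epsilon> \<Longrightarrow> \<exists>N. \<forall>j\<ge>N. \<forall>\<tau>\<in>{0..T}. norm (x (index_after (\<kappa> (s j)) \<tau>) - z \<tau>) \<le> \<epsilon>"
          and lim: "\<And>\<tau>. 0 \<le> \<tau> \<Longrightarrow> (\<lambda>j. x (index_after (\<kappa> (s j)) \<tau>)) \<longlonglongrightarrow> z \<tau>"
          using limit_trajectory[OF \<kappa>_top] by blast
        have \<kappa>s: "filterlim (\<lambda>j. \<kappa> (s j)) at_top sequentially"
          by (rule filterlim_compose[OF \<kappa>_top filterlim_subseq[OF s]])
        have x0: "(\<lambda>j. x (\<kappa> (s j))) \<longlonglongrightarrow> z 0" using lim[of 0] by (simp add: index_after_0)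
        \<comment> \<open>The iterates right after the exits have values above r and, since
          consecutive iterates merge, the same limit z 0. Together with the exits themselves this
          pins the value at z 0 to r.\<close>
        have x1: "(\<lambda>j. x (Suc (\<kappa> (s j)))) \<longlonglongrightarrow> z 0"
        proof -
          have "(\<lambda>i. x (Suc i) - x i) \<longlonglongrightarrow> 0"
          proof (rule metric_LIMSEQ_I)
            fix \<epsilon> :: real assume \<epsilon>: "0 < \<epsilon>"
            obtain N1 where N1: "\<And>i j. i \<ge> N1 \<Longrightarrow> i \<le> j \<Longrightarrow> norm (x j - x i) \<le> K * (time j - time i) + \<epsilon> / 2"
              using increment_bound[of "\<epsilon> / 2"] \<epsilon> by auto
            have "(\<lambda>i. K * \<alpha> i) \<longlonglongrightarrow> K * 0" by (intro tendsto_intros \<alpha>_0)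
            then obtain N2 where N2: "\<And>i. i \<ge> N2 \<Longrightarrow> K * \<alpha> i < \<epsilon> / 2"
              using order_tendstoD(2)[of _ "K * 0" sequentially "\<epsilon> / 2"] \<epsilon> by (auto simp: eventually_sequentially)
            show "\<exists>no. \<forall>i\<ge>no. dist (x (Suc i) - x i) 0 < \<epsilon>"
            proof (intro exI[of _ "max N1 N2"] allI impI)
              fix i assume "i \<ge> max N1 N2"
              then show "dist (x (Suc i) - x i) 0 < \<epsilon>" using N1[of i "Suc i"] N2[of i] by (simp add: time_def)
            qed
          qed
          from filterlim_compose[OF this \<kappa>s] tendsto_add[OF _ x0, of "\<lambda>j. x (Suc (\<kappa> (s j))) - x (\<kappa> (s j))" 0]
          show ?thesis by simp
        qed
        have "\<phi> (z 0) \<le> r" using \<kappa>(3) by (intro LIMSEQ_le_const2[OF \<phi>_lim[OF x0]]) auto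
        moreover have "r \<le> \<phi> (x (Suc (\<kappa> (s j))))" for j
          using \<kappa>(4)[of "s j" "Suc (\<kappa> (s j))"] \<kappa>(2)[of "s j"] by simp
        then have "r \<le> \<phi> (z 0)" by (intro LIMSEQ_le_const[OF \<phi>_lim[OF x1]]) auto
        ultimately have z0: "\<phi> (z 0) = r" by simp
        then have "\<not> composite_critical f g X (z 0)"
          using r(3) by (auto simp: composite_critical_value_def \<phi>_def)
        then obtain \<tau> where \<tau>: "0 < \<tau>" "\<phi> (z \<tau>) < r" "\<And>t. t \<in> {0..\<tau>} \<Longrightarrow> \<phi> (z t) \<le> r"
          using descent'[OF z] z0 by auto
        \<comment> \<open>Two margins: the first keeps iterates that follow the curve up to time
          \<tau> below q - A, the second puts the iterate at time \<tau> below r.\<close>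
        obtain \<delta> where \<delta>: "0 < \<delta>" "\<And>y y'. y \<in> cball 0 R \<Longrightarrow> y' \<in> cball 0 R \<Longrightarrow> norm (y - y') \<le> \<delta> \<Longrightarrow>
            \<bar>\<phi> y - \<phi> y'\<bar> < min (q - A - r) (r - \<phi> (z \<tau>))"
          using bounded_continuous_uniform[OF \<phi>_cont, where R = R and \<epsilon> = "min (q - A - r) (r - \<phi> (z \<tau>))"] r(2) \<tau>(2) by auto
        obtain j where j: "\<And>t. t \<in> {0..\<tau>} \<Longrightarrow> norm (x (index_after (\<kappa> (s j)) t) - z t) \<le> \<delta>"
          using unif[OF \<delta>(1), of \<tau>] by blast
        let ?i = "\<kappa> (s j)" and ?l = "l (s j)"
        have near: "\<bar>\<phi> (x (index_after ?i t)) - \<phi> (z t)\<bar> < min (q - A - r) (r - \<phi> (z \<tau>))" if "t \<in> {0..\<tau>}" for t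
          using j[OF that] that z_R[where z = z and \<tau> = t and \<kappa> = "\<lambda>j. \<kappa> (s j)", OF lim] by (intro \<delta>(2) R) auto
        \<comment> \<open>Before time \<tau> the level q - A cannot be reached. So time \<tau> falls
          between exit and upcrossing, where all values exceed r, although the curve has already
          descended below r.\<close>
        have "\<not> time ?l - time ?i \<le> \<tau>"
        proof
          assume le: "time ?l - time ?i \<le> \<tau>"
          have t: "time ?l - time ?i \<in> {0..\<tau>}" using le time_mono[of ?i ?l] \<kappa>(2)[of "s j"] by simp
          have eq: "index_after ?i (time ?l - time ?i) = ?l" using \<kappa>(2)[of "s j"] by (intro index_after_time_diff) simp
          have "\<phi> (x ?l) < q - A"
            using near[OF t] \<tau>(3)[OF t] unfolding eq min_less_iff_conj by linarith
          then show False using \<kappa>(5)[of "s j"] by simp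
        qed
        then have "index_after ?i \<tau> \<le> ?l" using \<kappa>(2)[of "s j"] by (intro index_after_le) auto
        moreover have "?i < index_after ?i \<tau>"
          using index_after(2)[of ?i \<tau>] \<tau>(1) time_less_iff[of ?i "index_after ?i \<tau>"] by simp
        ultimately have "r < \<phi> (x (index_after ?i \<tau>))" by (intro \<kappa>(4)[of "s j"])
        moreover have "\<tau> \<in> {0..\<tau>}" using \<tau>(1) by simp
        note near[OF this]
        ultimately show False unfolding min_less_iff_conj by linarith
      qed
    qed
    then have "convergent (\<lambda>k. (\<phi> (x k) + A) + (- A))" by (rule convergent_add[OF _ convergent_const])
    moreover have "(\<phi> (x k) + A) + (- A) = f (x k) + g (x k)" for k by (simp add: \<phi>_def)
    ultimately show ?thesis by (simp only:)
  qed
  show "composite_critical f g X y" if y: "limit_point x y"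
  proof (rule ccontr)
    assume nc: "\<not> composite_critical f g X y"
    obtain \<kappa> where \<kappa>: "strict_mono \<kappa>" "(x \<circ> \<kappa>) \<longlonglongrightarrow> y" using y unfolding limit_point_def by blast
    have \<kappa>_top: "filterlim \<kappa> at_top sequentially" by (rule filterlim_subseq[OF \<kappa>(1)])
    obtain s z where s: "strict_mono s" and z: "subgradient_trajectory f g X z" "continuous_on UNIV z"
      and "\<And>T \<epsilon>. 0 < \<epsilon> \<Longrightarrow> \<exists>N. \<forall>j\<ge>N. \<forall>\<tau>\<in>{0..T}. norm (x (index_after (\<kappa> (s j)) \<tau>) - z \<tau>) \<le> \<epsilon>"
      and lim: "\<And>\<tau>. 0 \<le> \<tau> \<Longrightarrow> (\<lambda>j. x (index_after (\<kappa> (s j)) \<tau>)) \<longlonglongrightarrow> z \<tau>"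
      using limit_trajectory[OF \<kappa>_top] by blast
    have "(\<lambda>j. x (\<kappa> (s j))) \<longlonglongrightarrow> y" using LIMSEQ_subseq_LIMSEQ[OF \<kappa>(2) s] by (simp add: o_def)
    then have z0: "z 0 = y" using LIMSEQ_unique[OF lim[of 0]] by (simp add: index_after_0)
    obtain \<phi>0 where \<phi>0: "(\<lambda>k. \<phi> (x k)) \<longlonglongrightarrow> \<phi>0" using conv unfolding convergent_def \<phi>_def by blast
    \<comment> \<open>Every value along the curve is a limit of objective values of iterates with
      indices tending to infinity, and these values converge.\<close>
    have const: "\<phi> (z \<tau>) = \<phi>0" if "0 \<le> \<tau>" for \<tau>
    proof -
      have "filterlim (\<lambda>j. index_after (\<kappa> (s j)) \<tau>) at_top sequentially"
        by (rule filterlim_at_top_mono[OF filterlim_compose[OF \<kappa>_top filterlim_subseq[OF s]]])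
          (simp add: index_after(1))
      from LIMSEQ_unique[OF \<phi>_lim[OF lim[OF that]] filterlim_compose[OF \<phi>0 this]] show ?thesis .
    qed
    obtain \<tau> where "0 < \<tau>" "\<phi> (z \<tau>) < \<phi> (z 0)"
      using descent'[OF z] nc z0 by auto
    with const[of \<tau>] const[of 0] show False by simp
  qed
qed

end

section \<open>The proximal stochastic subgradient method\<close>

text \<open>The constant is uniform over the ball while the radii are not. The sum of the constants
  of a finite subcover serves as a common bound, all of them being nonnegative.\<close>

lemma locally_lipschitz_uniform:
  fixes f :: "'a::euclidean_space \<Rightarrow> real"
  assumes "locally_lipschitz f"
  obtains C where "\<And>y. y \<in> cball 0 R \<Longrightarrow> \<exists>e>0. C-lipschitz_on (ball y e) f"
proof -
  have "\<forall>x. \<exists>e C. 0 < e \<and> C-lipschitz_on (ball x e) f"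
    using assms unfolding locally_lipschitz_def by blast
  then obtain e C where eC: "\<And>x. 0 < e x" "\<And>x. (C x)-lipschitz_on (ball x (e x)) f" by metis
  obtain D where D: "finite D" "cball 0 R \<subseteq> (\<Union>x\<in>D. ball x (e x))"
    using compactE_image[of "cball 0 R" "cball 0 R" "\<lambda>x. ball x (e x)"] eC(1) by (metis (no_types, lifting) UN_iff centre_in_ball compact_cball open_ball subsetI)
  define C' where "C' = (\<Sum>x\<in>D. C x)"
  show ?thesis
  proof (rule that[of C'])
    fix y :: 'a assume "y \<in> cball 0 R"
    then obtain x where x: "x \<in> D" "y \<in> ball x (e x)" using D(2) by blast
    obtain e' where e': "0 < e'" "ball y e' \<subseteq> ball x (e x)" by (rule openE[OF open_ball x(2)])
    have "C x \<le> C'"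
      unfolding C'_def using lipschitz_on_nonneg[OF eC(2)] by (intro member_le_sum x D) auto
    with eC(2)[of x] e'(2) have "C'-lipschitz_on (ball y e') f" by (rule lipschitz_on_mono)
    with e'(1) show "\<exists>e>0. C'-lipschitz_on (ball y e) f" by blast
  qed
qed

text \<open>Comparing the minimizer z with the competitor x, at distance d, gives d * d <= 2 a (g x
  - g z) + 2 a (x - z) . \<zeta>. The slope bound makes g x - g z at most L0 d even if z is far from
  x, where a local Lipschitz constant gives nothing; it remains to divide by d.\<close>

lemma prox_step_bound:
  fixes z x \<zeta> :: "'a::euclidean_space" and g :: "'a \<Rightarrow> real"
  assumes a: "0 < a" and xX: "x \<in> X"
    and min: "is_arg_min (\<lambda>u. g u + 1 / (2 * a) * (norm (u - (x - a *\<^sub>R \<zeta>)))\<^sup>2) (\<lambda>u. u \<in> X) z"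
    and slope: "(SUP z\<in>{z. z \<noteq> x \<and> g z \<le> g x}. ereal ((g x - g z) / norm (x - z))) \<le> ereal L"
    and L: "L \<le> L0" "0 \<le> L0"
  shows "norm (x - z) \<le> 2 * a * (L0 + norm \<zeta>)"
proof (cases "z = x")
  case False
  define d where "d = norm (x - z)"
  have d: "0 < d" using False by (simp add: d_def)
  have "g x - g z \<le> L0 * d"
  proof (cases "g z \<le> g x")
    case True
    have "ereal ((g x - g z) / norm (x - z)) \<le> ereal L"
      using False True by (intro order_trans[OF SUP_upper slope]) simp
    then have "g x - g z \<le> L * d" using d by (simp add: d_def divide_le_eq)
    also have "\<dots> \<le> L0 * d" using L d by (intro mult_right_mono) auto
    finally show ?thesis .
  next
    case False
    then show ?thesis using L(2) d by (smt (verit) mult_nonneg_nonneg)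
  qed
  then have gd: "2 * a * (g x - g z) \<le> 2 * a * (L0 * d)" using a by simp
  have "g z + 1 / (2 * a) * (norm (z - (x - a *\<^sub>R \<zeta>)))\<^sup>2 \<le> g x + 1 / (2 * a) * (norm (x - (x - a *\<^sub>R \<zeta>)))\<^sup>2"
    using min xX by (auto simp: is_arg_min_def not_less)
  then have "2 * a * (g z + 1 / (2 * a) * (norm (z - (x - a *\<^sub>R \<zeta>)))\<^sup>2) \<le>
      2 * a * (g x + 1 / (2 * a) * (norm (x - (x - a *\<^sub>R \<zeta>)))\<^sup>2)"
    using a by (intro mult_left_mono) auto
  then have "(norm (z - (x - a *\<^sub>R \<zeta>)))\<^sup>2 \<le> 2 * a * (g x - g z) + (norm (a *\<^sub>R \<zeta>))\<^sup>2"
    using a by (simp add: algebra_simps)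
  moreover have "(norm (z - (x - a *\<^sub>R \<zeta>)))\<^sup>2 = d\<^sup>2 - 2 * a * ((x - z) \<bullet> \<zeta>) + (norm (a *\<^sub>R \<zeta>))\<^sup>2"
  proof -
    have "z - (x - a *\<^sub>R \<zeta>) = a *\<^sub>R \<zeta> - (x - z)" by simp
    then show ?thesis
      unfolding d_def by (simp only: power2_norm_eq_inner)
        (simp add: inner_diff_left inner_diff_right inner_commute algebra_simps)
  qed
  moreover have "2 * a * ((x - z) \<bullet> \<zeta>) \<le> 2 * a * (d * norm \<zeta>)"
    unfolding d_def using a norm_cauchy_schwarz[of "x - z" \<zeta>] by (intro mult_left_mono) auto
  ultimately have "d\<^sup>2 \<le> 2 * a * (L0 * d) + 2 * a * (d * norm \<zeta>)" using gd by linarith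
  then have "d * d \<le> d * (2 * a * (L0 + norm \<zeta>))" by (simp add: power2_eq_square algebra_simps)
  then show ?thesis using d by (simp add: d_def)
qed (use a L in \<open>simp add: add_nonneg_nonneg\<close>)

lemma proximal_path_convergence:
  fixes f g :: "'a::euclidean_space \<Rightarrow> real" and x \<zeta> \<mu> :: "nat \<Rightarrow> 'a"
  assumes X: "closed X" and f_lip: "locally_lipschitz f" and g_lip: "locally_lipschitz g"
    and L_bounded: "bounded_on_bounded_sets L"
    and slope: "\<And>y. (SUP z\<in>{z. z \<noteq> y \<and> g z \<le> g y}. ereal ((g y - g z) / norm (y - z))) \<le> ereal (L y)"
    and weak_Sard: "closure {r. \<not> composite_critical_value f g X r} = UNIV"
    and descent: "\<And>z. subgradient_trajectory f g X z \<Longrightarrow> \<not> composite_critical f g X (z 0) \<Longrightarrow>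
      \<exists>\<tau>>0. f (z \<tau>) + g (z \<tau>) < (SUP t\<in>{0..\<tau>}. f (z t) + g (z t)) \<and>
             (SUP t\<in>{0..\<tau>}. f (z t) + g (z t)) \<le> f (z 0) + g (z 0)"
    and \<alpha>: "\<And>k. 0 < \<alpha> k" "filterlim (\<lambda>n. \<Sum>k<n. \<alpha> k) at_top sequentially" "summable (\<lambda>k. (\<alpha> k)\<^sup>2)"
    and x: "\<And>k. x k \<in> X" "\<And>k. norm (x k) \<le> R"
    and min: "\<And>k. is_arg_min (\<lambda>u. g u + 1 / (2 * \<alpha> k) * (norm (u - (x k - \<alpha> k *\<^sub>R \<zeta> k)))\<^sup>2) (\<lambda>u. u \<in> X) (x (Suc k))"
    and \<mu>: "\<And>k. \<mu> k \<in> clarke_subdiff f (x k)"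
    and noise: "summable (\<lambda>k. \<alpha> k *\<^sub>R (\<zeta> k - \<mu> k))"
    and noise_norm: "summable (\<lambda>k. \<alpha> k * (norm (\<zeta> k) - c k))" and c: "\<And>k. c k \<le> C"
  shows "convergent (\<lambda>k. f (x k) + g (x k))" and "limit_point x y \<Longrightarrow> composite_critical f g X y"
proof -
  obtain Cf where Cf: "\<And>y. y \<in> cball 0 R \<Longrightarrow> \<exists>e>0. Cf-lipschitz_on (ball y e) f"
    using locally_lipschitz_uniform[OF f_lip, where R = R] by blast
  obtain Cg where Cg: "\<And>y. y \<in> cball 0 R \<Longrightarrow> \<exists>e>0. Cg-lipschitz_on (ball y e) g"
    using locally_lipschitz_uniform[OF g_lip, where R = R] by blast
  have xR: "x k \<in> cball 0 R" for k using x(2) by simp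
  have subdiff_bound: "norm w \<le> C" if lip: "\<exists>e>0. C-lipschitz_on (ball y e) h" and w: "w \<in> clarke_subdiff h y"
    for w y :: 'a and C and h :: "'a \<Rightarrow> real"
  proof -
    obtain e where "e > 0" "C-lipschitz_on (ball y e) h" using lip by blast
    then have "clarke_subdiff h y \<subseteq> cball 0 C" by (intro clarke_subdiff_subset) auto
    then show ?thesis using w by auto
  qed
  have "bounded (L ` cball 0 R)" using L_bounded unfolding bounded_on_bounded_sets_def by blast
  then obtain L1 where L1: "\<forall>w\<in>L ` cball 0 R. norm w \<le> L1" unfolding bounded_iff by blast
  define L0 where "L0 = \<bar>L1\<bar>"
  have L0: "0 \<le> L0" "L (x k) \<le> L0" for k
    using bspec[OF L1 imageI[OF xR[of k]]] by (auto simp: L0_def)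
  define y where "y k = x k - \<alpha> k *\<^sub>R \<zeta> k" for k
  define \<rho> where "\<rho> k = Cg + norm (y k - x (Suc k)) / \<alpha> k + 1" for k
  have "\<exists>v n. v \<in> clarke_subdiff g (x (Suc k)) \<and> n \<in> unit_normals X (x (Suc k)) \<and>
      (1 / \<alpha> k) *\<^sub>R (y k - x (Suc k)) = v + \<rho> k *\<^sub>R n" for k
  proof -
    obtain e where e: "e > 0" "Cg-lipschitz_on (ball (x (Suc k)) e) g" using Cg[OF xR] by blast
    show ?thesis
      using prox_optimality[OF X \<alpha>(1) min[of k, folded y_def] e g_lip] unfolding \<rho>_def by metis
  qed
  then obtain v n where vn: "\<And>k. v k \<in> clarke_subdiff g (x (Suc k))" "\<And>k. n k \<in> unit_normals X (x (Suc k))"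
    "\<And>k. (1 / \<alpha> k) *\<^sub>R (y k - x (Suc k)) = v k + \<rho> k *\<^sub>R n k" by metis
  \<comment> \<open>The proximal step contributes 2 (L0 + norm \<zeta>) per unit step size and the
    oracle displacement one more norm \<zeta>; Cg + 1 is the constant part of the penalty.\<close>
  define B where "B k = Cg + 1 + 2 * L0 + 3 * norm (\<zeta> k)" for k
  interpret inexact_subgradient_iteration f g X x \<mu> v n "\<lambda>k. \<zeta> k - \<mu> k" \<alpha> \<rho> B
    "\<lambda>k. Cg + 1 + 2 * L0 + 3 * c k" R Cf Cg "Cg + 1 + 2 * L0 + 3 * C"
  proof
    have Cg0: "0 \<le> Cg" using Cg[OF xR[of 0]] lipschitz_on_nonneg by blast
    show "\<alpha> \<longlonglongrightarrow> 0"
      using tendsto_real_sqrt[OF summable_LIMSEQ_zero[OF \<alpha>(3)]] \<alpha>(1) by (simp add: less_imp_le)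
    show "norm (\<mu> k) \<le> Cf" for k using subdiff_bound[OF Cf[OF xR] \<mu>] .
    show "norm (v k) \<le> Cg" for k using subdiff_bound[OF Cg[OF xR] vn(1)] .
    show "0 \<le> \<rho> k" for k using Cg0 \<alpha>(1)[of k] by (simp add: \<rho>_def)
    show "\<rho> k \<le> B k" for k
    proof -
      have "norm (y k - x (Suc k)) \<le> norm (x k - x (Suc k)) + \<alpha> k * norm (\<zeta> k)"
        using norm_triangle_ineq4[of "x k - x (Suc k)" "\<alpha> k *\<^sub>R \<zeta> k"] \<alpha>(1)[of k]
        by (simp add: y_def algebra_simps)
      also have "\<dots> \<le> 2 * \<alpha> k * (L0 + norm (\<zeta> k)) + \<alpha> k * norm (\<zeta> k)"
        using prox_step_bound[OF \<alpha>(1) x(1) min slope L0(2,1)] by simp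
      also have "\<dots> = \<alpha> k * (2 * L0 + 3 * norm (\<zeta> k))" by (simp add: algebra_simps)
      finally have "norm (y k - x (Suc k)) / \<alpha> k \<le> 2 * L0 + 3 * norm (\<zeta> k)"
        using \<alpha>(1)[of k] by (simp add: divide_le_eq mult.commute)
      then show ?thesis by (simp add: \<rho>_def B_def)
    qed
    have eq: "\<alpha> k * (B k - (Cg + 1 + 2 * L0 + 3 * c k)) = 3 * (\<alpha> k * (norm (\<zeta> k) - c k))" for k
      by (simp add: B_def algebra_simps)
    show "summable (\<lambda>k. \<alpha> k * (B k - (Cg + 1 + 2 * L0 + 3 * c k)))"
      unfolding eq by (rule summable_mult[OF noise_norm])
    show "x (Suc k) = x k - \<alpha> k *\<^sub>R (\<mu> k + v k + \<rho> k *\<^sub>R n k + (\<zeta> k - \<mu> k))" for k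
    proof -
      have "\<alpha> k *\<^sub>R (v k + \<rho> k *\<^sub>R n k) = y k - x (Suc k)"
        using \<alpha>(1)[of k] by (simp add: vn(3)[symmetric])
      then have "x (Suc k) = y k - \<alpha> k *\<^sub>R (v k + \<rho> k *\<^sub>R n k)" by simp
      then show ?thesis by (simp add: y_def algebra_simps)
    qed
  qed (use assms vn in simp_all)
  show "convergent (\<lambda>k. f (x k) + g (x k))" by (rule convergence(1)[OF weak_Sard descent])
  show "limit_point x y \<Longrightarrow> composite_critical f g X y" for y by (rule convergence(2)[OF weak_Sard descent])
qed

text \<open>Centring lowers the second moment, and |t| <= 1 + t * t bounds the mean. The third
  conclusion makes the means of the oracle norms uniformly bounded along a bounded path.\<close>

lemma (in prob_space) centered_second_moment:
  fixes h :: "'a \<Rightarrow> real"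
  assumes h[measurable]: "h \<in> borel_measurable M" and c: "0 \<le> c"
    and le: "(\<integral>\<^sup>+s. ennreal ((h s)\<^sup>2) \<partial>M) \<le> ennreal c"
  shows "integrable M h" "(\<integral>\<^sup>+s. ennreal ((h s - expectation h)\<^sup>2) \<partial>M) \<le> ennreal c" "expectation h \<le> 1 + c"
proof -
  have h2: "integrable M (\<lambda>s. (h s)\<^sup>2)"
    by (rule integrableI_bounded) (use le in \<open>auto simp: less_top[symmetric] top_unique\<close>)
  then have Eh2: "expectation (\<lambda>s. (h s)\<^sup>2) \<le> c"
    using le c nn_integral_eq_integral[OF h2] by simp
  have le1: "\<bar>t\<bar> \<le> 1 + t\<^sup>2" for t :: real
  proof (cases "\<bar>t\<bar> \<le> 1")
    case False
    then have "\<bar>t\<bar> * 1 \<le> \<bar>t\<bar> * \<bar>t\<bar>" by (intro mult_left_mono) auto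
    then show ?thesis by (simp add: power2_eq_square)
  qed (simp add: add_increasing2)
  show hi: "integrable M h"
    by (rule Bochner_Integration.integrable_bound[of M "\<lambda>s. 1 + (h s)\<^sup>2"]) (use h2 le1 in \<open>auto simp: abs_of_nonneg\<close>)
  have "expectation h \<le> expectation (\<lambda>s. 1 + (h s)\<^sup>2)"
    using le1 abs_le_D1 by (intro integral_mono hi) (auto simp: h2)
  also have "\<dots> \<le> 1 + c" using h2 Eh2 by (simp add: prob_space)
  finally show "expectation h \<le> 1 + c" .
  have eq: "(h s - expectation h)\<^sup>2 = (h s)\<^sup>2 - 2 * expectation h * h s + (expectation h)\<^sup>2" for s
    by (simp add: power2_diff algebra_simps)
  have hc: "integrable M (\<lambda>s. (h s - expectation h)\<^sup>2)"
    unfolding eq using h2 hi by simp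
  have "variance h = expectation (\<lambda>s. (h s)\<^sup>2) - (expectation h)\<^sup>2" using hi h2 by (rule variance_eq)
  then have "variance h \<le> c" using Eh2 by (smt (verit) zero_le_power2)
  then show "(\<integral>\<^sup>+s. ennreal ((h s - expectation h)\<^sup>2) \<partial>M) \<le> ennreal c"
    using nn_integral_eq_integral[OF hc] by (simp add: ennreal_leI)
qed

text \<open>Iterates are indexed from 0, and the start may be random as long as it is independent of
  the samples. Slopes are compared in \<open>ereal\<close>, so that an infinite supremum is excluded
  and an empty set of competitors imposes nothing.\<close>

theorem theorem6p2:
  fixes f g :: "'a::euclidean_space \<Rightarrow> real"
    and X :: "'a set"
    and P :: "'w measure" and \<zeta> :: "'a \<Rightarrow> 'w \<Rightarrow> 'a"
    and T :: "real \<Rightarrow> 'a \<Rightarrow> 'a"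
    and M :: "'m measure" and \<omega> :: "nat \<Rightarrow> 'm \<Rightarrow> 'w"
    and \<alpha> :: "nat \<Rightarrow> real" and x :: "nat \<Rightarrow> 'm \<Rightarrow> 'a"
  assumes P_prob: "prob_space P"
    and \<zeta>_measurable: "(\<lambda>(y, w). \<zeta> y w) \<in> borel_measurable (borel \<Otimes>\<^sub>M P)"
    and \<zeta>_oracle: "\<forall>y. integrable P (\<zeta> y) \<and> (\<integral>w. \<zeta> y w \<partial>P) \<in> clarke_subdiff f y"
    and T_measurable: "(\<lambda>(a, y). T a y) \<in> borel_measurable (restrict_space borel ({0<..} \<times> UNIV))"
    and T_argmin: "\<forall>a>0. \<forall>y.
      is_arg_min (\<lambda>u. g u + 1 / (2 * a) * (norm (u - y))\<^sup>2) (\<lambda>u. u \<in> X) (T a y)"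
    and M_prob: "prob_space M"
    and \<omega>_distr: "\<forall>k. \<omega> k \<in> measurable M P \<and> distr M P (\<omega> k) = P"
    and \<omega>_indep: "prob_space.indep_vars M (\<lambda>_. P) \<omega> UNIV"
    and x0_measurable: "x 0 \<in> borel_measurable M"
    and x0_indep: "prob_space.indep_set M
      (sets (vimage_algebra (space M) (x 0) borel))
      (sets (vimage_algebra (space M) (\<lambda>s k. \<omega> k s) (PiM UNIV (\<lambda>_. P))))"
    and x_in_X: "\<forall>k. \<forall>s\<in>space M. x k s \<in> X"
    and \<alpha>_pos: "\<forall>k. \<alpha> k > 0"
    and x_step: "\<forall>k. \<forall>s\<in>space M.
      x (Suc k) s = T (\<alpha> k) (x k s - \<alpha> k *\<^sub>R \<zeta> (x k s) (\<omega> k s))"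
    and X_closed: "closed X"
    and f_lip: "locally_lipschitz f" and g_lip: "locally_lipschitz g"
    and g_below: "bdd_below (g ` X)"
    and slope: "\<exists>L :: 'a \<Rightarrow> real. bounded_on_bounded_sets L \<and>
      (\<forall>y. (SUP z\<in>{z. z \<noteq> y \<and> g z \<le> g y}. ereal ((g y - g z) / norm (y - z))) \<le> ereal (L y))"
    and \<alpha>_sum: "filterlim (\<lambda>n. \<Sum>k<n. \<alpha> k) at_top sequentially"
    and \<alpha>_square_sum: "summable (\<lambda>k. (\<alpha> k)\<^sup>2)"
    and x_bounded: "AE s in M. bdd_above (range (\<lambda>k. norm (x k s)))"
    and second_moment: "\<exists>p :: 'a \<Rightarrow> real. (\<forall>y. p y \<ge> 0) \<and> bounded_on_bounded_sets p \<and>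
      (\<forall>y\<in>X. (\<integral>w. \<zeta> y w \<partial>P) \<in> clarke_subdiff f y \<and>
        (\<integral>\<^sup>+ w. ennreal ((norm (\<zeta> y w))\<^sup>2) \<partial>P) \<le> ennreal (p y))"
    and sup_moment: "\<forall>z :: nat \<Rightarrow> 'a. convergent z \<longrightarrow>
      (\<integral>\<^sup>+ w. (SUP k. ennreal (norm (\<zeta> (z k) w))) \<partial>P) < \<infinity>"
    and weak_Sard: "closure {r. \<not> composite_critical_value f g X r} = UNIV"
    and descent: "\<forall>z. subgradient_trajectory f g X z \<and> \<not> composite_critical f g X (z 0) \<longrightarrow>
      (\<exists>\<tau>>0. f (z \<tau>) + g (z \<tau>) < (SUP t\<in>{0..\<tau>}. f (z t) + g (z t)) \<and>
             (SUP t\<in>{0..\<tau>}. f (z t) + g (z t)) \<le> f (z 0) + g (z 0))"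
  shows "AE s in M. (\<forall>c. limit_point (\<lambda>k. x k s) c \<longrightarrow> composite_critical f g X c) \<and>
    convergent (\<lambda>k. f (x k s) + g (x k s))"
proof -
  interpret P: prob_space P by (rule P_prob)
  interpret M: prob_space M by (rule M_prob)
  obtain L where L: "bounded_on_bounded_sets L"
    "\<And>y. (SUP z\<in>{z. z \<noteq> y \<and> g z \<le> g y}. ereal ((g y - g z) / norm (y - z))) \<le> ereal (L y)"
    using slope by blast
  obtain p :: "'a \<Rightarrow> real" where p: "bounded_on_bounded_sets p"
    "\<And>y. y \<in> X \<Longrightarrow> (\<integral>\<^sup>+ w. ennreal ((norm (\<zeta> y w))\<^sup>2) \<partial>P) \<le> ennreal (p y)"
    using second_moment by blast
  define \<mu> where "\<mu> y = (\<integral>w. \<zeta> y w \<partial>P)" for y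
  define c where "c y = (\<integral>w. norm (\<zeta> y w) \<partial>P)" for y
  have \<zeta>_int: "integrable P (\<zeta> y)" and \<mu>_subdiff: "\<mu> y \<in> clarke_subdiff f y" for y
    using \<zeta>_oracle by (auto simp: \<mu>_def)
  have \<omega>_meas: "\<And>k. \<omega> k \<in> measurable M P" and distr: "\<And>k. distr M P (\<omega> k) = P"
    using \<omega>_distr by auto
  note [measurable] = \<zeta>_measurable
  have \<zeta>_y[measurable]: "\<zeta> y \<in> borel_measurable P" for y
    using \<zeta>_int by (rule borel_measurable_integrable)
  have [measurable]: "\<mu> \<in> borel_measurable borel"
    unfolding \<mu>_def[abs_def] by (rule P.borel_measurable_lebesgue_integral[OF \<zeta>_measurable])
  have [measurable]: "c \<in> borel_measurable borel"
    unfolding c_def[abs_def] by (rule P.borel_measurable_lebesgue_integral) measurable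
  \<comment> \<open>Iterate n depends only on the start and the samples before n, so sample n is
    fresh for it.\<close>
  have adapted: "x n \<in> borel_measurable (past M P (x 0) \<omega> n)" for n
  proof (induction n)
    case 0 show ?case by (rule M.x0_past[OF \<omega>_meas x0_measurable])
  next
    case (Suc n)
    let ?F = "past M P (x 0) \<omega> (Suc n)"
    have [measurable]: "x n \<in> borel_measurable ?F"
      by (rule measurable_from_subalg[OF M.past_mono[OF \<omega>_meas x0_measurable] Suc])
    have [measurable]: "\<omega> n \<in> measurable ?F P" by (rule M.\<omega>_past[OF \<omega>_meas x0_measurable]) simp
    have "(\<lambda>s. case (x n s, \<omega> n s) of (y, w) \<Rightarrow> \<zeta> y w) \<in> borel_measurable ?F" by measurable
    then have [measurable]: "(\<lambda>s. \<zeta> (x n s) (\<omega> n s)) \<in> borel_measurable ?F" by simp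
    have pair: "(\<lambda>y :: 'a. (\<alpha> n, y)) \<in> measurable borel (borel :: (real \<times> 'a) measure)"
      unfolding borel_prod[symmetric] by measurable
    \<comment> \<open>\<open>T\<close> is measurable only on positive step sizes; positivity of
      \<open>\<alpha> n\<close> places the section inside that domain.\<close>
    have "(\<lambda>y :: 'a. (\<alpha> n, y)) \<in> measurable borel (restrict_space borel ({0<..} \<times> UNIV))"
      by (rule measurable_restrict_space2[OF _ pair]) (use \<alpha>_pos in auto)
    from measurable_compose[OF this T_measurable] have [measurable]: "T (\<alpha> n) \<in> borel_measurable borel" by simp
    have "(\<lambda>s. T (\<alpha> n) (x n s - \<alpha> n *\<^sub>R \<zeta> (x n s) (\<omega> n s))) \<in> borel_measurable ?F" by measurable
    then show ?case
      using x_step M.space_past[OF \<omega>_meas x0_measurable, where n = "Suc n"] by (subst measurable_cong) auto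
  qed
  \<comment> \<open>Stated for scalar functions dominated by the norm of the oracle, to cover its
    coordinates and its norm at once; the second moment bound p is uniform on a ball.\<close>
  have noise: "AE s in M. (\<forall>n. norm (x n s) \<le> R) \<longrightarrow> summable (\<lambda>n. \<alpha> n * (H (x n s) (\<omega> n s) - (\<integral>w. H (x n s) w \<partial>P)))"
    if H: "(\<lambda>(y, w). H y w) \<in> borel_measurable (borel \<Otimes>\<^sub>M P)" "\<And>y. integrable P (H y)"
      "\<And>y w. \<bar>H y w\<bar> \<le> norm (\<zeta> y w)" for R and H :: "'a \<Rightarrow> 'w \<Rightarrow> real"
  proof -
    have "bounded (p ` cball 0 R)" using p(1) unfolding bounded_on_bounded_sets_def by blast
    then obtain A where A: "\<forall>w\<in>p ` cball 0 R. norm w \<le> A" unfolding bounded_iff by blast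
    note [measurable] = H(1)
    show ?thesis
    proof (rule M.AE_summable_noise[where X = X and c = "\<bar>A\<bar>" and Z = "\<lambda>y w. H y w - (\<integral>w. H y w \<partial>P)",
          OF \<omega>_meas x0_measurable P_prob distr \<omega>_indep x0_indep adapted _ X_closed])
      show "(\<lambda>(y, w). H y w - (\<integral>w. H y w \<partial>P)) \<in> borel_measurable (borel \<Otimes>\<^sub>M P)"
      proof -
        have [measurable]: "(\<lambda>y. \<integral>w. H y w \<partial>P) \<in> borel_measurable borel"
          by (rule P.borel_measurable_lebesgue_integral[OF H(1)])
        have [measurable]: "(\<lambda>q. H (fst q) (snd q)) \<in> borel_measurable (borel \<Otimes>\<^sub>M P)"
          using H(1) by (simp add: case_prod_beta')
        show ?thesis by measurable
      qed
      show "(\<integral>w. H y w - (\<integral>w. H y w \<partial>P) \<partial>P) = 0" for y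
        using H(2)[of y] by (simp add: P.prob_space)
      fix y assume y: "y \<in> X" "norm y \<le> R"
      have "(\<integral>\<^sup>+w. ennreal ((H y w)\<^sup>2) \<partial>P) \<le> (\<integral>\<^sup>+w. ennreal ((norm (\<zeta> y w))\<^sup>2) \<partial>P)"
        using H(3) by (intro nn_integral_mono ennreal_leI) (simp add: abs_le_square_iff[symmetric])
      also have "\<dots> \<le> ennreal \<bar>A\<bar>"
      proof (rule order_trans[OF p(2)[OF y(1)] ennreal_leI])
        show "p y \<le> \<bar>A\<bar>" using bspec[OF A imageI[of y]] y(2) by auto
      qed
      finally show "(\<integral>\<^sup>+w. ennreal ((H y w - (\<integral>w. H y w \<partial>P))\<^sup>2) \<partial>P) \<le> ennreal \<bar>A\<bar>"
        by (intro P.centered_second_moment borel_measurable_integrable[OF H(2)]) auto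
    qed (use x_in_X \<alpha>_square_sum in auto)
  qed
  have noise_b: "AE s in M. (\<forall>n. norm (x n s) \<le> R) \<longrightarrow> summable (\<lambda>n. \<alpha> n * ((\<zeta> (x n s) (\<omega> n s) - \<mu> (x n s)) \<bullet> b))"
    if b: "b \<in> Basis" for R b
  proof -
    have "AE s in M. (\<forall>n. norm (x n s) \<le> R) \<longrightarrow>
        summable (\<lambda>n. \<alpha> n * (\<zeta> (x n s) (\<omega> n s) \<bullet> b - (\<integral>w. \<zeta> (x n s) w \<bullet> b \<partial>P)))"
    proof (rule noise)
      show "(\<lambda>(y, w). \<zeta> y w \<bullet> b) \<in> borel_measurable (borel \<Otimes>\<^sub>M P)"
        using borel_measurable_inner[OF \<zeta>_measurable borel_measurable_const[of b]] by (simp add: case_prod_beta')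
      show "\<bar>\<zeta> y w \<bullet> b\<bar> \<le> norm (\<zeta> y w)" for y w using b by (rule Basis_le_norm)
    qed (use \<zeta>_int in simp)
    then show ?thesis using \<zeta>_int by (simp add: \<mu>_def inner_diff_left)
  qed
  have noise_norm: "AE s in M. (\<forall>n. norm (x n s) \<le> R) \<longrightarrow> summable (\<lambda>n. \<alpha> n * (norm (\<zeta> (x n s) (\<omega> n s)) - c (x n s)))" for R
    unfolding c_def
  proof (rule noise)
    show "(\<lambda>(y, w). norm (\<zeta> y w)) \<in> borel_measurable (borel \<Otimes>\<^sub>M P)"
      using measurable_compose[OF \<zeta>_measurable borel_measurable_norm] by (simp add: case_prod_beta')
  qed (use \<zeta>_int in auto)
  \<comment> \<open>The bound on the iterates varies with the path, so the exceptional sets are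
    united over integer radii before a path is fixed.\<close>
  have "AE s in M. \<forall>R::nat. (\<forall>n. norm (x n s) \<le> real R) \<longrightarrow>
      (\<forall>b\<in>Basis. summable (\<lambda>n. \<alpha> n * ((\<zeta> (x n s) (\<omega> n s) - \<mu> (x n s)) \<bullet> b))) \<and>
      summable (\<lambda>n. \<alpha> n * (norm (\<zeta> (x n s) (\<omega> n s)) - c (x n s)))"
    unfolding AE_all_countable
  proof
    fix R :: nat
    have "AE s in M. \<forall>b\<in>Basis. (\<forall>n. norm (x n s) \<le> real R) \<longrightarrow>
        summable (\<lambda>n. \<alpha> n * ((\<zeta> (x n s) (\<omega> n s) - \<mu> (x n s)) \<bullet> b))"
      by (rule AE_finite_allI[OF finite_Basis noise_b])
    with noise_norm[of "real R"]
    show "AE s in M. (\<forall>n. norm (x n s) \<le> real R) \<longrightarrow>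
      (\<forall>b\<in>Basis. summable (\<lambda>n. \<alpha> n * ((\<zeta> (x n s) (\<omega> n s) - \<mu> (x n s)) \<bullet> b))) \<and>
      summable (\<lambda>n. \<alpha> n * (norm (\<zeta> (x n s) (\<omega> n s)) - c (x n s)))"
      by eventually_elim blast
  qed
  with x_bounded AE_space show ?thesis
  proof eventually_elim
    fix s assume bdd: "bdd_above (range (\<lambda>k. norm (x k s)))" and s: "s \<in> space M"
      and summ: "\<forall>R::nat. (\<forall>n. norm (x n s) \<le> real R) \<longrightarrow>
      (\<forall>b\<in>Basis. summable (\<lambda>n. \<alpha> n * ((\<zeta> (x n s) (\<omega> n s) - \<mu> (x n s)) \<bullet> b))) \<and>
      summable (\<lambda>n. \<alpha> n * (norm (\<zeta> (x n s) (\<omega> n s)) - c (x n s)))"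
    obtain A where A: "\<And>n. norm (x n s) \<le> A" using bdd unfolding bdd_above_def by blast
    obtain R :: nat where "A \<le> real R" using real_arch_simple by blast
    then have R: "norm (x n s) \<le> real R" for n using A[of n] by linarith
    let ?\<zeta> = "\<lambda>n. \<zeta> (x n s) (\<omega> n s)" and ?\<mu> = "\<lambda>n. \<mu> (x n s)"
    have "summable (\<lambda>n. \<Sum>b\<in>Basis. (\<alpha> n * ((?\<zeta> n - ?\<mu> n) \<bullet> b)) *\<^sub>R b)"
      using summ R by (intro summable_sum summable_scaleR_left) blast
    moreover have "(\<Sum>b\<in>Basis. (\<alpha> n * ((?\<zeta> n - ?\<mu> n) \<bullet> b)) *\<^sub>R b) = \<alpha> n *\<^sub>R (?\<zeta> n - ?\<mu> n)" for n
      using euclidean_representation[of "\<alpha> n *\<^sub>R (?\<zeta> n - ?\<mu> n)"] by simp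
    ultimately have noise_s: "summable (\<lambda>n. \<alpha> n *\<^sub>R (?\<zeta> n - ?\<mu> n))" by simp
    have noise_norm_s: "summable (\<lambda>n. \<alpha> n * (norm (?\<zeta> n) - c (x n s)))" using summ R by blast
    have "bounded (p ` cball 0 (real R))" using p(1) unfolding bounded_on_bounded_sets_def by blast
    then obtain A' where A': "\<forall>w\<in>p ` cball 0 (real R). norm w \<le> A'" unfolding bounded_iff by blast
    have cb: "c (x n s) \<le> 1 + \<bar>A'\<bar>" for n
      unfolding c_def
    proof (rule P.centered_second_moment(3))
      have "p (x n s) \<le> \<bar>A'\<bar>" using bspec[OF A' imageI[of "x n s"]] R[of n] by auto
      then show "(\<integral>\<^sup>+w. ennreal ((norm (\<zeta> (x n s) w))\<^sup>2) \<partial>P) \<le> ennreal \<bar>A'\<bar>"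
        using p(2)[of "x n s"] x_in_X s by (meson ennreal_leI order_trans)
    qed simp_all
    have min_s: "is_arg_min (\<lambda>u. g u + 1 / (2 * \<alpha> k) * (norm (u - (x k s - \<alpha> k *\<^sub>R ?\<zeta> k)))\<^sup>2) (\<lambda>u. u \<in> X) (x (Suc k) s)" for k
      using T_argmin \<alpha>_pos x_step s by simp
    have desc: "\<exists>\<tau>>0. f (z \<tau>) + g (z \<tau>) < (SUP t\<in>{0..\<tau>}. f (z t) + g (z t)) \<and>
             (SUP t\<in>{0..\<tau>}. f (z t) + g (z t)) \<le> f (z 0) + g (z 0)"
      if "subgradient_trajectory f g X z" "\<not> composite_critical f g X (z 0)" for z
      using descent that by blast
    \<comment> \<open>From here on one path is fixed and everything is deterministic.\<close>
    note path = proximal_path_convergence[where x = "\<lambda>k. x k s" and \<zeta> = ?\<zeta> and \<mu> = ?\<mu> and R = "real R" and c = "\<lambda>n. c (x n s)",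
        OF X_closed f_lip g_lip L weak_Sard desc _ \<alpha>_sum \<alpha>_square_sum _ R min_s \<mu>_subdiff noise_s noise_norm_s cb]
    show "(\<forall>c. limit_point (\<lambda>k. x k s) c \<longrightarrow> composite_critical f g X c) \<and> convergent (\<lambda>k. f (x k s) + g (x k s))"
      using path \<alpha>_pos x_in_X s by blast
  qed
qed

end
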